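(* Let $k$ be an algebraically closed field of characteristic $0$, let $H$ be a semisimple Hopf algebra over $k$, let $m$ be a positive integer, and let $\tau$ be a Hopf algebra automorphism of $H$ with $\tau^m=\mathrm{Id}$. Let $\chi$ be the character of a finite-dimensional left $H$-module, and let $\zeta_m\in k$ be a primitive $m$-th root of $1$. Then $$\nu_m(\chi,\tau)\in\mathbb{Z}[\zeta_m].$$
   Context: $\Lambda\in H$ denotes the unique two-sided integral normalized by $\varepsilon(\Lambda)=1$, where $\varepsilon$ is the counit; Sweedler notation is $\Delta^{m-1}(\Lambda)=\sum_{(\Lambda)}\Lambda_1\otimes\cdots\otimes\Lambda_m$. The $m$-th twisted Frobenius--Schur indicator is $$\nu_m(\chi,\tau)=\sum_{(\Lambda)}\chi\left(\Lambda_1\tau(\Lambda_2)\cdots\tau^{m-1}(\Lambda_m)\right).$$ *)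

theory Defs
  imports "HOL-Library.Multiset" "HOL-Computational_Algebra.Polynomial"
begin

text \<open>
  A finite sum of pure tensors \<open>x\<^sub>1 \<otimes> \<dots> \<otimes> x\<^sub>n\<close> (\<open>n \<ge> 1\<close>) of elements of a vector space is written as
  the multiset of the lists \<open>[x\<^sub>1, \<dots>, x\<^sub>n]\<close>.  Scalars are absorbed into the entries, so that the
  \<open>n\<close>-th tensor power over the base field is the monoid of such formal sums of lists of length \<open>n\<close>
  modulo the congruence generated by additivity in each slot and by moving scalars between slots.
  (This quotient is a group, the inverse of the class of \<open>[x\<^sub>1, \<dots>, x\<^sub>n]\<close> being that of
  \<open>[- x\<^sub>1, \<dots>, x\<^sub>n]\<close>; the rule \<open>zero\<close> is needed because one starts from the free monoid
  and not from the free group.)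
  Maps into a tensor power are given by representatives, and equality there is \<open>tensor_eq\<close>.
\<close>

inductive tensor_eq ::
  "('k::field \<Rightarrow> 'h::ab_group_add \<Rightarrow> 'h) \<Rightarrow> 'h list multiset \<Rightarrow> 'h list multiset \<Rightarrow> bool"
  for scale where
  refl: "tensor_eq scale s s"
| sym: "tensor_eq scale s t \<Longrightarrow> tensor_eq scale t s"
| trans: "tensor_eq scale s t \<Longrightarrow> tensor_eq scale t u \<Longrightarrow> tensor_eq scale s u"
| plus: "tensor_eq scale s t \<Longrightarrow> tensor_eq scale (s + u) (t + u)"
| zero: "tensor_eq scale {# xs @ 0 # ys #} {#}"
| add: "tensor_eq scale {# xs @ (a + b) # ys #} {# xs @ a # ys, xs @ b # ys #}"
| scale: "tensor_eq scale {# xs @ scale c a # ys @ b # zs #} {# xs @ a # ys @ scale c b # zs #}"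

definition tensor2 :: "('h \<times> 'h) multiset \<Rightarrow> 'h list multiset" where
  "tensor2 s = image_mset (\<lambda>(a, b). [a, b]) s"

locale unital_algebra = vector_space scale
  for scale :: "'k::field \<Rightarrow> 'h::ring_1 \<Rightarrow> 'h" +
  assumes scale_mult_left: "scale c x * y = scale c (x * y)"
    and scale_mult_right: "x * scale c y = scale c (x * y)"

text \<open>
  The comultiplication \<open>\<Delta> x = \<Sum> x\<^sub>1 \<otimes> x\<^sub>2\<close> is given by a multiset of pairs \<open>(x\<^sub>1, x\<^sub>2)\<close>, that is, by
  a choice of a Sweedler presentation of each \<open>\<Delta> x\<close>; its axioms are equalities of tensors.
\<close>

locale hopf_algebra = unital_algebra scale
  for scale :: "'k::field \<Rightarrow> 'h::ring_1 \<Rightarrow> 'h" +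
  fixes \<Delta> :: "'h \<Rightarrow> ('h \<times> 'h) multiset"
    and \<epsilon> :: "'h \<Rightarrow> 'k"
    and S :: "'h \<Rightarrow> 'h"
  assumes comult_add: "tensor_eq scale (tensor2 (\<Delta> (x + y))) (tensor2 (\<Delta> x + \<Delta> y))"
    and comult_scale:
      "tensor_eq scale (tensor2 (\<Delta> (scale c x)))
         (tensor2 (image_mset (\<lambda>(a, b). (scale c a, b)) (\<Delta> x)))"
    and counit_linear: "Vector_Spaces.linear scale (*) \<epsilon>"
    and coassoc:
      "tensor_eq scale
         (\<Sum>(a, b)\<in>#\<Delta> x. image_mset (\<lambda>(a1, a2). [a1, a2, b]) (\<Delta> a))
         (\<Sum>(a, b)\<in>#\<Delta> x. image_mset (\<lambda>(b1, b2). [a, b1, b2]) (\<Delta> b))"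
    and counit_left: "(\<Sum>(a, b)\<in>#\<Delta> x. scale (\<epsilon> a) b) = x"
    and counit_right: "(\<Sum>(a, b)\<in>#\<Delta> x. scale (\<epsilon> b) a) = x"
    and comult_mult:
      "tensor_eq scale (tensor2 (\<Delta> (x * y)))
         (tensor2 (\<Sum>(a, b)\<in>#\<Delta> x. image_mset (\<lambda>(c, d). (a * c, b * d)) (\<Delta> y)))"
    and comult_one: "tensor_eq scale (tensor2 (\<Delta> 1)) {# [1, 1] #}"
    and counit_mult: "\<epsilon> (x * y) = \<epsilon> x * \<epsilon> y"
    and counit_one: "\<epsilon> 1 = 1"
    and antipode_linear: "Vector_Spaces.linear scale scale S"
    and antipode_left: "(\<Sum>(a, b)\<in>#\<Delta> x. S a * b) = scale (\<epsilon> x) 1"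
    and antipode_right: "(\<Sum>(a, b)\<in>#\<Delta> x. a * S b) = scale (\<epsilon> x) 1"

text \<open>Compatibility of \<open>\<tau>\<close> with the antipode is automatic for bialgebra maps.\<close>

definition hopf_automorphism ::
  "('k::field \<Rightarrow> 'h::ring_1 \<Rightarrow> 'h) \<Rightarrow> ('h \<Rightarrow> ('h \<times> 'h) multiset) \<Rightarrow> ('h \<Rightarrow> 'k) \<Rightarrow> ('h \<Rightarrow> 'h) \<Rightarrow> bool"
  where
  "hopf_automorphism scale \<Delta> \<epsilon> \<tau> \<longleftrightarrow>
     bij \<tau> \<and> Vector_Spaces.linear scale scale \<tau> \<and>
     (\<forall>x y. \<tau> (x * y) = \<tau> x * \<tau> y) \<and> \<tau> 1 = 1 \<and>
     (\<forall>x. tensor_eq scale (tensor2 (\<Delta> (\<tau> x))) (tensor2 (image_mset (map_prod \<tau> \<tau>) (\<Delta> x)))) \<and>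
     (\<forall>x. \<epsilon> (\<tau> x) = \<epsilon> x)"

definition left_ideal :: "'h::ring_1 set \<Rightarrow> bool" where
  "left_ideal I \<longleftrightarrow> 0 \<in> I \<and> (\<forall>x\<in>I. \<forall>y\<in>I. x + y \<in> I) \<and> (\<forall>r. \<forall>x\<in>I. r * x \<in> I)"

text \<open>
  The ring, as a left module over itself, is semisimple: every submodule is a direct summand.
  The argument only fixes the type.
\<close>

definition semisimple_ring :: "'h::ring_1 itself \<Rightarrow> bool" where
  "semisimple_ring _ \<longleftrightarrow>
     (\<forall>I :: 'h set. left_ideal I \<longrightarrow>
        (\<exists>J. left_ideal J \<and> I \<inter> J = {0} \<and> (\<forall>x. \<exists>a\<in>I. \<exists>b\<in>J. x = a + b)))"

definition two_sided_integral ::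
  "('k::field \<Rightarrow> 'h::ring_1 \<Rightarrow> 'h) \<Rightarrow> ('h \<Rightarrow> 'k) \<Rightarrow> 'h \<Rightarrow> bool" where
  "two_sided_integral scale \<epsilon> t \<longleftrightarrow> (\<forall>h. h * t = scale (\<epsilon> h) t \<and> t * h = scale (\<epsilon> h) t)"

definition normalized_integral ::
  "('k::field \<Rightarrow> 'h::ring_1 \<Rightarrow> 'h) \<Rightarrow> ('h \<Rightarrow> 'k) \<Rightarrow> 'h" where
  "normalized_integral scale \<epsilon> = (THE t. two_sided_integral scale \<epsilon> t \<and> \<epsilon> t = 1)"

text \<open>
  \<open>iterated_comult \<Delta> n x\<close> is \<open>\<Delta>\<^sup>n x\<close>, a sum of tensors with \<open>n + 1\<close> factors, where
  \<open>\<Delta>\<^sup>n\<^sup>+\<^sup>1 = (id \<otimes> \<Delta>\<^sup>n) \<circ> \<Delta>\<close>.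
\<close>

primrec iterated_comult :: "('h \<Rightarrow> ('h \<times> 'h) multiset) \<Rightarrow> nat \<Rightarrow> 'h \<Rightarrow> 'h list multiset" where
  "iterated_comult \<Delta> 0 x = {# [x] #}"
| "iterated_comult \<Delta> (Suc n) x =
     (\<Sum>(a, b)\<in>#\<Delta> x. image_mset (\<lambda>ys. a # ys) (iterated_comult \<Delta> n b))"

locale hopf_module = V: vector_space scaleV
  for scale :: "'k::field \<Rightarrow> 'h::ring_1 \<Rightarrow> 'h"
    and scaleV :: "'k \<Rightarrow> 'v::ab_group_add \<Rightarrow> 'v" +
  fixes act :: "'h \<Rightarrow> 'v \<Rightarrow> 'v"
  assumes act_add_left: "act (x + y) v = act x v + act y v"
    and act_add_right: "act x (v + w) = act x v + act x w"
    and act_mult: "act (x * y) v = act x (act y v)"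
    and act_one: "act 1 v = v"
    and act_scale_left: "act (scale c x) v = scaleV c (act x v)"
    and act_scale_right: "act x (scaleV c v) = scaleV c (act x v)"

text \<open>The trace of the action of \<open>x\<close>, computed in a finite basis \<open>B\<close> of the module.\<close>

definition character ::
  "('k::field \<Rightarrow> 'v::ab_group_add \<Rightarrow> 'v) \<Rightarrow> 'v set \<Rightarrow> ('h \<Rightarrow> 'v \<Rightarrow> 'v) \<Rightarrow> 'h \<Rightarrow> 'k" where
  "character scaleV B act x = (\<Sum>b\<in>B. module.representation scaleV B (act x b) b)"

definition twisted_FS_indicator ::
  "('k::field \<Rightarrow> 'h::ring_1 \<Rightarrow> 'h) \<Rightarrow> ('h \<Rightarrow> ('h \<times> 'h) multiset) \<Rightarrow> ('h \<Rightarrow> 'k) \<Rightarrow>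
   nat \<Rightarrow> ('h \<Rightarrow> 'k) \<Rightarrow> ('h \<Rightarrow> 'h) \<Rightarrow> 'k" where
  "twisted_FS_indicator scale \<Delta> \<epsilon> m \<chi> \<tau> =
     (\<Sum>xs\<in>#iterated_comult \<Delta> (m - 1) (normalized_integral scale \<epsilon>).
        \<chi> (prod_list (map (\<lambda>i. (\<tau> ^^ i) (xs ! i)) [0..<m])))"

definition primitive_root_of_unity :: "nat \<Rightarrow> 'k::field \<Rightarrow> bool" where
  "primitive_root_of_unity m \<zeta> \<longleftrightarrow> \<zeta> ^ m = 1 \<and> (\<forall>j. 0 < j \<and> j < m \<longrightarrow> \<zeta> ^ j \<noteq> 1)"

definition int_adjoin :: "'k::field \<Rightarrow> 'k set" where
  "int_adjoin \<zeta> = range (\<lambda>p :: int poly. poly (map_poly of_int p) \<zeta>)"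

end

theory Submission
  imports Defs "HOL-Computational_Algebra.Polynomial_Factorial"
    "HOL-Computational_Algebra.Field_as_Ring" "HOL-Library.Function_Algebras"
begin

text \<open>
  Let \<open>\<Lambda>\<close> be the normalized integral of \<open>H\<close>, let \<open>V\<close> be the module with character \<open>\<chi>\<close>, and let
  \<open>H\<close> act on the \<open>i\<close>-th factor of \<open>V\<^sup>\<otimes>\<^sup>m\<close> through \<open>\<tau>\<^sup>i\<close>.  Since \<open>\<Lambda>\<close> is idempotent, it acts on \<open>V\<^sup>\<otimes>\<^sup>m\<close>
  by a projection \<open>P\<close>.  The trace of an operator followed by a cyclic shift of the factors is the trace of
  the product of the factors, so the indicator is the trace of \<open>P C\<close>, where \<open>C\<close> is the cyclic shift
  (\<open>trace_inv_proj_rotate\<close>).  If \<open>\<Delta> \<Lambda>\<close> is symmetric, the tensor \<open>\<Delta>\<^sup>m\<^sup>-\<^sup>1 \<Lambda>\<close> is invariant under cyclic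
  permutations; together with \<open>\<tau>\<^sup>m = id\<close> and \<open>\<tau> \<Lambda> = \<Lambda>\<close> this makes \<open>C\<close> commute with \<open>P\<close>
  (\<open>inv_proj_rotate\<close>).  Hence \<open>P C\<close> satisfies \<open>D\<^sup>m\<^sup>+\<^sup>1 = D\<close>, its spectral projections are
  polynomials in it, an idempotent has a natural number as its trace, and the indicator is a sum of powers of
  \<open>\<zeta>\<close> with natural coefficients (\<open>trace_powers_finite_order\<close>).
  
  The symmetry of \<open>\<Delta> \<Lambda>\<close> amounts to \<open>S\<^sup>2 = id\<close>, the theorem of Larson and Radford that a semisimple Hopf
  algebra in characteristic 0 has an involutory antipode.  Most of the text is a proof of that theorem.
  
  First, \<open>H\<close> is finite-dimensional, because each \<open>h = h S(\<Lambda>\<^sub>1) \<Lambda>\<^sub>2\<close> can be rewritten with right factors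
  taken from one fixed presentation of \<open>\<Delta> \<Lambda>\<close>.  The functionals
  \<open>\<lambda>(y) = Tr (x \<mapsto> S\<^sup>2(x) y)\<close> and \<open>\<mu>(y) = Tr (x \<mapsto> y S\<^sup>2(x))\<close> are a right and a left integral on
  \<open>H\<close>; they are nonzero since they take the value 1 at \<open>\<Lambda>\<close>, and \<open>\<Lambda>\<close> supplies dual bases for them.
  Cyclicity of the trace gives \<open>\<lambda>(a h) = \<lambda>(S\<^sup>2(h) a)\<close> and the analogous rule for \<open>\<mu>\<close>.  As integrals are
  unique up to scalars, \<open>\<mu>(h) = \<lambda>(g h)\<close> for a grouplike element \<open>g\<close>.  Comparing the two rules
  yields \<open>S\<^sup>4(h) = g h g\<^sup>-\<^sup>1\<close>, and \<open>g = 1\<close> as soon as \<open>\<lambda>(1) = Tr S\<^sup>2\<close> does not vanish.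
  
  For that, semisimplicity produces an invertible \<open>u\<close> with \<open>S\<^sup>2(a) = u a u\<^sup>-\<^sup>1\<close> and shows that
  \<open>z = u\<^sup>-\<^sup>2 g\<close> is central and that \<open>Tr S\<^sup>2\<close> is the trace of multiplication by \<open>z\<close>.  On the block of \<open>z\<close>
  with eigenvalue \<open>c = s\<^sup>2\<close> the element \<open>u\<^sup>-\<^sup>1 / s\<close> has finite order, and both it and its inverse have
  trace \<open>s\<close> times the dimension of the block.  So each block contributes to \<open>Tr S\<^sup>2\<close> a quotient of
  \<open>\<theta> \<theta>'\<close> by a natural number, where \<open>\<theta>\<close> is a sum of roots of unity and \<open>\<theta>'\<close> the sum of their inverses.
  Under a complex embedding of the cyclotomic field this is nonnegative, while the trivial block contributes
  1 (\<open>lam_one_nonzero\<close>).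
  
  Finally \<open>S\<^sup>4 = id\<close>, so \<open>Tr S\<^sup>2\<close> is a nonzero integer of absolute value at most \<open>n = dim H\<close>.  If \<open>x\<close>
  denotes the character of the regular representation of the dual algebra, viewed in \<open>H\<close>, then \<open>x\<^sup>2 = n x\<close>
  and \<open>\<lambda>(x) = \<lambda>(1)\<close>.  Therefore \<open>Tr S\<^sup>2\<close> is \<open>n\<close> times the trace of \<open>S\<^sup>2\<close> on the range of right
  multiplication by \<open>x\<close>, again an integer.  Thus \<open>Tr S\<^sup>2 = \<plusminus>n\<close>, and \<open>S\<^sup>2 = id\<close> because \<open>S\<^sup>2\<close> fixes 1.
\<close>

section \<open>Traces of operators of finite order\<close>

locale linear_space = vector_space scale
  for scale :: "'k::field_char_0 \<Rightarrow> 'v::ab_group_add \<Rightarrow> 'v"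
begin

abbreviation endo :: "('v \<Rightarrow> 'v) \<Rightarrow> bool" where
  "endo f \<equiv> Vector_Spaces.linear scale scale f"

abbreviation form :: "('v \<Rightarrow> 'k) \<Rightarrow> bool" where
  "form f \<equiv> Vector_Spaces.linear scale (*) f"

lemma endo_iff: "endo f \<longleftrightarrow> (\<forall>x y. f (x + y) = f x + f y) \<and> (\<forall>c x. f (scale c x) = scale c (f x))"
  by (simp add: Vector_Spaces.linear_iff vector_space_axioms)

lemma form_iff: "form f \<longleftrightarrow> (\<forall>x y. f (x + y) = f x + f y) \<and> (\<forall>c x. f (scale c x) = c * f x)"
proof -
  have "vector_space ((*) :: 'k \<Rightarrow> 'k \<Rightarrow> 'k)"
    by unfold_locales (simp_all add: algebra_simps)
  then show ?thesis by (simp add: Vector_Spaces.linear_iff vector_space_axioms)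
qed

lemma endo_sum: "endo f \<Longrightarrow> f (\<Sum>i\<in>I. g i) = (\<Sum>i\<in>I. f (g i))"
  by (simp add: linear_iff_module_hom module_hom.sum)

lemma form_sum: "form f \<Longrightarrow> f (\<Sum>i\<in>I. g i) = (\<Sum>i\<in>I. f (g i))"
  by (simp add: linear_iff_module_hom module_hom.sum)

lemma endo_zero: "endo f \<Longrightarrow> f 0 = 0"
  by (simp add: linear_iff_module_hom module_hom.zero)

lemma form_zero: "form f \<Longrightarrow> f 0 = 0"
  by (simp add: linear_iff_module_hom module_hom.zero)

text \<open>
  The trace is computed in a frame \<open>(e\<^sub>i, \<phi>\<^sub>i)\<close> that need only resolve the identity on the range of \<open>P\<close>;
  this lets operators on a space of functions with infinite domain be handled without a basis of that
  space.  Choosing a basis \<open>C\<close> of the range, the trace is the sum over \<open>C\<close> of the coordinates of \<open>P c = c\<close>,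
  that is, the number of elements of \<open>C\<close>.
\<close>

lemma trace_idempotent:
  fixes P :: "'v \<Rightarrow> 'v" and e :: "'i \<Rightarrow> 'v" and \<phi> :: "'i \<Rightarrow> 'v \<Rightarrow> 'k"
  assumes fin: "finite I" and lin: "endo P" and idem: "\<And>v. P (P v) = P v"
    and form: "\<And>i. form (\<phi> i)"
    and frame: "\<And>v. P v = (\<Sum>i\<in>I. scale (\<phi> i (P v)) (e i))"
  shows "\<exists>n. (\<Sum>i\<in>I. \<phi> i (P (e i))) = of_nat n \<and> (n = 0 \<longrightarrow> (\<forall>v. P v = 0))"
proof -
  obtain C where C: "C \<subseteq> range P" "independent C" "range P \<subseteq> span C"
    using maximal_independent_subset by blast
  have "range P \<subseteq> span (e ` I)"
  proof
    fix x assume "x \<in> range P"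
    then obtain v where "x = P v" by blast
    then have "x = (\<Sum>i\<in>I. scale (\<phi> i (P v)) (e i))" using frame by simp
    also have "\<dots> \<in> span (e ` I)" by (intro span_sum span_scale span_base) auto
    finally show "x \<in> span (e ` I)" .
  qed
  then have finC: "finite C"
    using independent_span_bound[of "e ` I" C] C fin by blast
  define R where "R c v = representation C (P v) c" for c v
  have in_span: "P v \<in> span C" for v using C by blast
  have R_lin: "form (R c)" for c
    unfolding form_iff R_def using lin in_span
    by (simp add: endo_iff representation_add[OF C(2)] representation_scale[OF C(2)])
  have P_eq: "P v = (\<Sum>c\<in>C. scale (R c v) c)" for v
    unfolding R_def using sum_representation_eq[OF C(2) in_span finC] by simp
  have fixC: "P c = c" if "c \<in> C" for c
    using that C idem by auto
  have R_C: "R c c = 1" if "c \<in> C" for c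
    unfolding R_def using that by (simp add: fixC representation_basis[OF C(2)])
  have exp_C: "(\<Sum>i\<in>I. scale (\<phi> i c) (e i)) = c" if "c \<in> C" for c
    using frame[of c] that by (simp add: fixC)
  have "(\<Sum>i\<in>I. \<phi> i (P (e i))) = (\<Sum>i\<in>I. \<phi> i (\<Sum>c\<in>C. scale (R c (e i)) c))"
    using P_eq by simp
  also have "\<dots> = (\<Sum>i\<in>I. \<Sum>c\<in>C. R c (e i) * \<phi> i c)"
    using form by (simp add: form_sum) (simp add: form_iff)
  also have "\<dots> = (\<Sum>c\<in>C. \<Sum>i\<in>I. \<phi> i c * R c (e i))"
    by (subst sum.swap) (simp add: mult.commute)
  also have "\<dots> = (\<Sum>c\<in>C. R c (\<Sum>i\<in>I. scale (\<phi> i c) (e i)))"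
    using R_lin by (simp add: form_sum) (simp add: form_iff)
  also have "\<dots> = of_nat (card C)"
    using exp_C R_C by simp
  finally have tr: "(\<Sum>i\<in>I. \<phi> i (P (e i))) = of_nat (card C)" .
  have "P v = 0" if "card C = 0" for v
    using that finC P_eq[of v] by simp
  then show ?thesis using tr by blast
qed

lemma endo_funpow: "endo D \<Longrightarrow> endo (D ^^ k)"
  by (induction k) (simp_all add: endo_iff)

end

lemma sum_root_of_unity_powers:
  fixes \<zeta> :: "'k::field_char_0"
  assumes prim: "primitive_root_of_unity M \<zeta>" and i: "i \<in> {1..M}" and k: "k \<in> {1..M}"
  shows "(\<Sum>j<M. \<zeta> ^ (j * k) / \<zeta> ^ (i * j)) = (if i = k then of_nat M else 0)"
proof -
  have M1: "\<zeta> ^ M = 1" using prim by (simp add: primitive_root_of_unity_def)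
  have nz: "\<zeta> \<noteq> 0" 
  proof
    assume "\<zeta> = 0"
    then have "M = 0" using M1 by (cases M) auto
    then show False using i by simp
  qed
  define x where "x = \<zeta> ^ k / \<zeta> ^ i"
  have "(\<Sum>j<M. \<zeta> ^ (j * k) / \<zeta> ^ (i * j)) = (\<Sum>j<M. x ^ j)"
    unfolding x_def by (simp add: power_divide power_mult mult.commute flip: power_mult)
  also have "\<dots> = (if i = k then of_nat M else 0)"
  proof (cases "i = k")
    case False
    have "x \<noteq> 1"
    proof
      assume "x = 1"
      then have eq: "\<zeta> ^ k = \<zeta> ^ i" using nz by (simp add: x_def)
      define d where "d = (if k < i then i - k else k - i)"
      have "\<zeta> ^ d = 1"
        using eq nz unfolding d_def by (auto simp: power_diff)
      moreover have "0 < d" "d < M" using i k False unfolding d_def by auto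
      ultimately show False using prim by (simp add: primitive_root_of_unity_def)
    qed
    moreover have "x ^ M = 1"
    proof -
      have "(\<zeta> ^ l) ^ M = 1" for l
        using M1 by (metis mult.commute power_mult power_one)
      then show ?thesis unfolding x_def by (simp add: power_divide)
    qed
    ultimately show ?thesis using False by (simp add: sum_gp_strict)
  next
    case True
    then have "x = 1" unfolding x_def using nz by simp
    then show ?thesis using True by simp
  qed
  finally show ?thesis .
qed

text \<open>
  For \<open>D\<^sup>M\<^sup>+\<^sup>1 = D\<close> the discrete Fourier transforms
  \<open>Q\<^sub>j = (1/M) \<Sum>\<^sub>i \<zeta>\<^sup>-\<^sup>i\<^sup>j D\<^sup>i\<close>, \<open>1 \<le> i \<le> M\<close>, are idempotents with \<open>D Q\<^sub>j = \<zeta>\<^sup>j Q\<^sub>j\<close>, and \<open>D\<^sup>k\<close> is the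
  sum of the \<open>\<zeta>\<^sup>j\<^sup>k Q\<^sub>j\<close>.  The hypothesis is that of an operator of finite order composed with a commuting
  projection.
\<close>

lemma (in linear_space) trace_powers_finite_order:
  fixes D :: "'v \<Rightarrow> 'v" and e :: "'i \<Rightarrow> 'v" and \<phi> :: "'i \<Rightarrow> 'v \<Rightarrow> 'k"
  assumes fin: "finite I" and lin: "endo D" and form: "\<And>i. form (\<phi> i)"
    and frame: "\<And>v. D v = (\<Sum>i\<in>I. scale (\<phi> i (D v)) (e i))"
    and prim: "primitive_root_of_unity M \<zeta>" and M: "M > 0"
    and ord: "\<And>v. (D ^^ (Suc M)) v = D v"
  shows "\<exists>d :: nat \<Rightarrow> nat. \<forall>k\<in>{1..M}.
           (\<Sum>i\<in>I. \<phi> i ((D ^^ k) (e i))) = (\<Sum>j<M. of_nat (d j) * \<zeta> ^ (j * k))"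
proof -
  have M1: "\<zeta> ^ M = 1" using prim by (simp add: primitive_root_of_unity_def)
  have nz: "\<zeta> \<noteq> 0" using M1 M by (metis power_eq_0_iff zero_neq_one)
  have Dk: "endo (D ^^ k)" for k using endo_funpow[OF lin] .
  have ord': "(D ^^ (M + Suc i)) v = (D ^^ Suc i) v" for i v
    using ord[of "(D ^^ i) v"] by (simp add: funpow_swap1 funpow_add)
  define Q where "Q j v = scale (1 / of_nat M) (\<Sum>i\<in>{1..M}. scale (1 / \<zeta> ^ (i * j)) ((D ^^ i) v))" for j v
  have Q_lin: "endo (Q j)" for j
    using Dk unfolding endo_iff Q_def
    by (simp add: sum.distrib scale_right_distrib scale_sum_right mult.commute mult.left_commute)
  have DQ: "D (Q j v) = scale (\<zeta> ^ j) (Q j v)" for j v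
  proof -
    have "D (Q j v) = scale (1 / of_nat M) (\<Sum>i\<in>{1..M}. scale (1 / \<zeta> ^ (i * j)) ((D ^^ Suc i) v))"
      using lin unfolding Q_def by (simp add: endo_iff endo_sum)
    also have "(\<Sum>i\<in>{1..M}. scale (1 / \<zeta> ^ (i * j)) ((D ^^ Suc i) v))
        = (\<Sum>i\<in>{1..M}. scale (\<zeta> ^ j / \<zeta> ^ (Suc i * j)) ((D ^^ Suc i) v))"
      using nz by (simp add: power_add)
    also have "\<dots> = (\<Sum>i\<in>{2..Suc M}. scale (\<zeta> ^ j / \<zeta> ^ (i * j)) ((D ^^ i) v))"
      by (rule sum.reindex_bij_witness[of _ "\<lambda>i. i - 1" Suc]) auto
    also have "\<dots> = (\<Sum>i\<in>{2..M}. scale (\<zeta> ^ j / \<zeta> ^ (i * j)) ((D ^^ i) v)) + scale (\<zeta> ^ j / \<zeta> ^ (Suc M * j)) ((D ^^ Suc M) v)"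
      using M by (simp add: atLeastAtMostSuc_conv add.commute)
    also have "scale (\<zeta> ^ j / \<zeta> ^ (Suc M * j)) ((D ^^ Suc M) v) = scale (\<zeta> ^ j / \<zeta> ^ (1 * j)) ((D ^^ 1) v)"
      using ord by (simp add: power_add power_mult M1)
    also have "(\<Sum>i\<in>{2..M}. scale (\<zeta> ^ j / \<zeta> ^ (i * j)) ((D ^^ i) v)) + \<dots>
        = (\<Sum>i\<in>{1..M}. scale (\<zeta> ^ j / \<zeta> ^ (i * j)) ((D ^^ i) v))"
    proof -
      have "{1..M} = insert 1 {2..M}" using M by auto
      then show ?thesis by (simp add: add.commute)
    qed
    finally show ?thesis
      unfolding Q_def by (simp add: scale_sum_right mult.commute)
  qed
  have DkQ: "(D ^^ i) (Q j v) = scale (\<zeta> ^ (i * j)) (Q j v)" for i j v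
  proof (induction i)
    case (Suc i)
    then show ?case using DQ[of j v] lin by (simp add: endo_iff power_add mult.commute)
  qed simp
  have Q_idem: "Q j (Q j v) = Q j v" for j v
  proof -
    have "Q j (Q j v) = scale (1 / of_nat M) (\<Sum>i\<in>{1..M}. scale (1 / \<zeta> ^ (i * j)) (scale (\<zeta> ^ (i * j)) (Q j v)))"
      using DkQ by (subst Q_def) simp
    also have "\<dots> = scale (1 / of_nat M) (\<Sum>i\<in>{1..M}. Q j v)"
      using nz by simp
    also have "\<dots> = Q j v"
      using M by (simp add: sum_constant_scale)
    finally show ?thesis .
  qed
  have Q_frame: "Q j v = (\<Sum>i\<in>I. scale (\<phi> i (Q j v)) (e i))" for j v
  proof -
    have "Q j v = D (Q j (scale (1 / \<zeta> ^ j) v))"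
      using DQ[of j "scale (1 / \<zeta> ^ j) v"] Q_lin[of j] nz by (simp add: endo_iff)
    then show ?thesis using frame by metis
  qed
  have "\<forall>j. \<exists>n. (\<Sum>i\<in>I. \<phi> i (Q j (e i))) = of_nat n"
    using trace_idempotent[OF fin Q_lin Q_idem form Q_frame] by blast
  then obtain d where d: "\<And>j. (\<Sum>i\<in>I. \<phi> i (Q j (e i))) = of_nat (d j)"
    by metis
  have "(\<Sum>i\<in>I. \<phi> i ((D ^^ k) (e i))) = (\<Sum>j<M. of_nat (d j) * \<zeta> ^ (j * k))" if k: "k \<in> {1..M}" for k
  proof -
    have Dk_eq: "(D ^^ k) v = (\<Sum>j<M. scale (\<zeta> ^ (j * k)) (Q j v))" for v
    proof -
      have "(\<Sum>j<M. scale (\<zeta> ^ (j * k)) (Q j v))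
          = (\<Sum>j<M. \<Sum>i\<in>{1..M}. scale ((\<zeta> ^ (j * k) / \<zeta> ^ (i * j)) / of_nat M) ((D ^^ i) v))"
        unfolding Q_def by (simp add: scale_sum_right mult.commute)
      also have "\<dots> = (\<Sum>i\<in>{1..M}. scale ((\<Sum>j<M. \<zeta> ^ (j * k) / \<zeta> ^ (i * j)) / of_nat M) ((D ^^ i) v))"
        by (subst sum.swap) (simp add: scale_sum_left sum_divide_distrib)
      also have "\<dots> = (\<Sum>i\<in>{1..M}. if i = k then (D ^^ i) v else 0)"
        using M by (intro sum.cong[OF HOL.refl], subst sum_root_of_unity_powers[OF prim _ k]) simp_all
      also have "\<dots> = (D ^^ k) v"
        using k by (simp add: sum.delta)
      finally show ?thesis by simp
    qed
    have "(\<Sum>i\<in>I. \<phi> i ((D ^^ k) (e i))) = (\<Sum>i\<in>I. \<Sum>j<M. \<zeta> ^ (j * k) * \<phi> i (Q j (e i)))"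
      using form by (simp add: Dk_eq form_sum) (simp add: form_iff)
    also have "\<dots> = (\<Sum>j<M. \<zeta> ^ (j * k) * (\<Sum>i\<in>I. \<phi> i (Q j (e i))))"
      by (subst sum.swap) (simp add: sum_distrib_left)
    finally show ?thesis by (simp add: d mult.commute)
  qed
  then show ?thesis by blast
qed

section \<open>Positivity in cyclotomic fields\<close>

abbreviation rat_eval :: "rat poly \<Rightarrow> 'k::field_char_0 \<Rightarrow> 'k" where
  "rat_eval P x \<equiv> poly (map_poly of_rat P) x"

lemma map_poly_of_rat_add: "map_poly of_rat (P + Q) = map_poly of_rat P + (map_poly of_rat Q :: 'k::field_char_0 poly)"
  by (rule poly_eqI) (simp add: coeff_map_poly of_rat_add)

lemma map_poly_of_rat_mult: "map_poly of_rat (P * Q) = map_poly of_rat P * (map_poly of_rat Q :: 'k::field_char_0 poly)"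
  by (rule poly_eqI) (simp add: coeff_map_poly coeff_mult of_rat_sum of_rat_mult)

lemma rat_eval_add: "rat_eval (P + Q) x = rat_eval P x + rat_eval Q x"
  by (simp add: map_poly_of_rat_add)

lemma rat_eval_mult: "rat_eval (P * Q) x = rat_eval P x * rat_eval Q x"
  by (simp add: map_poly_of_rat_mult)

lemma rat_eval_monom: "rat_eval (monom c n) x = of_rat c * x ^ n"
  by (simp add: map_poly_monom poly_monom)

lemma rat_eval_const: "rat_eval [:c:] x = of_rat c"
  by (simp add: map_poly_pCons)

lemma rat_eval_sum: "rat_eval (\<Sum>i\<in>I. P i) x = (\<Sum>i\<in>I. rat_eval (P i) x)"
  by (induction I rule: infinite_finite_induct) (simp_all add: rat_eval_add)

lemma degree_map_poly_of_rat: "degree (map_poly of_rat P :: 'k::field_char_0 poly) = degree P"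
  by (rule degree_map_poly) simp

lemma primitive_root_cis:
  assumes M: "M > 0"
  shows "primitive_root_of_unity M (cis (2 * pi / real M))"
proof -
  have "cis (2 * pi / real M) ^ M = 1"
    using M by (simp add: DeMoivre)
  moreover have "cis (2 * pi / real M) ^ j \<noteq> 1" if j: "0 < j" "j < M" for j
  proof
    assume "cis (2 * pi / real M) ^ j = 1"
    moreover have "cis (2 * pi / real M) ^ j = cis (2 * pi * real j / real M)"
      by (simp add: DeMoivre field_simps)
    moreover have "inj_on (\<lambda>k. cis (2 * pi * real k / real M)) {..<M}"
      using bij_betw_roots_unity[OF M] by (simp add: bij_betw_def)
    ultimately have "j = 0"
      using j by (auto dest!: inj_onD[of _ _ j 0])
    then show False using j by simp
  qed
  ultimately show ?thesis by (simp add: primitive_root_of_unity_def)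
qed

text \<open>
  Let \<open>q\<close> be a rational polynomial of least degree that vanishes at the complex root of unity \<open>\<omega>'\<close>, and let \<open>\<omega>\<close>
  be a root of \<open>q\<close> in the given field.  A polynomial that vanishes at \<open>\<omega>\<close> has a nonconstant common divisor with
  \<open>q\<close>, hence by minimality vanishes at \<open>\<omega>'\<close>.  So \<open>\<omega> \<mapsto> \<omega>'\<close> defines an embedding of the field generated by
  \<open>\<omega>\<close> into the complex numbers, and in particular \<open>\<omega>\<close> is primitive as well.
\<close>

lemma cyclotomic_embedding:
  assumes M: "M > 0"
  obtains \<omega> :: "'k::{alg_closed_field, field_char_0}" and \<omega>' :: complex
  where "primitive_root_of_unity M \<omega>" "primitive_root_of_unity M \<omega>'"
    "\<And>P. rat_eval P \<omega> = 0 \<Longrightarrow> rat_eval P \<omega>' = 0"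
proof -
  define \<omega>' where "\<omega>' = cis (2 * pi / real M)"
  have prim': "primitive_root_of_unity M \<omega>'"
    unfolding \<omega>'_def using M by (rule primitive_root_cis)
  have unity: "rat_eval (monom 1 j + [:-1:]) x = x ^ j - 1" for j and x :: "'a::field_char_0"
    by (simp only: rat_eval_add rat_eval_monom) (simp add: map_poly_pCons of_rat_minus)
  have "coeff (monom 1 M + [:- 1 :: rat:]) M = 1" using M by (simp add: coeff_pCons split: nat.split)
  then have "monom 1 M + [:- 1 :: rat:] \<noteq> 0" by force
  moreover have "rat_eval (monom 1 M + [:- 1:]) \<omega>' = 0"
    unfolding unity using prim' by (simp add: primitive_root_of_unity_def)
  \<comment> \<open>\<open>q\<close> plays the role of the minimal polynomial of \<open>\<omega>'\<close>.\<close>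
  ultimately obtain q where q: "q \<noteq> 0" "rat_eval q \<omega>' = 0"
    and q_min: "\<And>p. p \<noteq> 0 \<Longrightarrow> rat_eval p \<omega>' = 0 \<Longrightarrow> degree q \<le> degree p"
    using ex_has_least_nat[of "\<lambda>p. p \<noteq> 0 \<and> rat_eval p \<omega>' = 0" _ degree] by blast
  have "degree q > 0"
  proof (rule ccontr)
    assume "\<not> degree q > 0"
    then obtain c where "q = [:c:]" by (metis degree_eq_zeroE neq0_conv)
    then show False using q by (simp add: rat_eval_const)
  qed
  then have "degree (map_poly of_rat q :: 'k poly) > 0" by (simp add: degree_map_poly_of_rat)
  then obtain \<omega> :: 'k where \<omega>: "rat_eval q \<omega> = 0"
    using alg_closed_imp_poly_has_root by blast
  have q_dvd: "q dvd p" if "rat_eval p \<omega>' = 0" for p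
  proof -
    have "rat_eval (p div q * q + p mod q) \<omega>' = 0" using that by simp
    then have "rat_eval (p mod q) \<omega>' = 0" by (simp only: rat_eval_add rat_eval_mult q) simp
    then have "p mod q = 0"
      using q_min[of "p mod q"] degree_mod_less[of q p] q by (metis linorder_not_le)
    then show ?thesis by (simp add: dvd_eq_mod_eq_0)
  qed
  have transfer: "rat_eval P \<omega>' = 0" if P: "rat_eval P \<omega> = 0" for P
  proof -
    define g where "g = gcd P q"
    obtain a b where "bezout_coefficients P q = (a, b)" by fastforce
    then have "g = a * P + b * q" unfolding g_def using bezout_coefficients by metis
    then have g0: "rat_eval g \<omega> = 0" using P \<omega> by (simp only: rat_eval_add rat_eval_mult) simp
    obtain s where s: "q = g * s" unfolding g_def by (meson dvdE gcd_dvd2)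
    obtain t where t: "P = g * t" unfolding g_def by (meson dvdE gcd_dvd1)
    have nz: "g \<noteq> 0" "s \<noteq> 0" using q s by auto
    show ?thesis
    proof (cases "rat_eval g \<omega>' = 0")
      case True
      then show ?thesis by (simp only: t rat_eval_mult) simp
    next
      case False
      then have "rat_eval s \<omega>' = 0" using q(2) by (simp only: s rat_eval_mult) simp
      then have "degree q \<le> degree s" using q_min nz by blast
      then have "degree g = 0" using s nz by (simp add: degree_mult_eq)
      then obtain c where "g = [:c:]" by (metis degree_eq_zeroE)
      then show ?thesis using g0 nz by (simp add: rat_eval_const)
    qed
  qed
  have "\<omega> ^ M = 1"
  proof -
    have "q dvd monom 1 M + [:- 1:]"
      using q_dvd \<open>rat_eval (monom 1 M + [:- 1:]) \<omega>' = 0\<close> by blast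
    then obtain r where "monom 1 M + [:- 1:] = q * r" by (elim dvdE)
    then have "rat_eval (monom 1 M + [:- 1:]) \<omega> = 0" using \<omega> by (simp only: rat_eval_mult) simp
    then show ?thesis unfolding unity by simp
  qed
  moreover have "\<omega> ^ j \<noteq> 1" if "0 < j" "j < M" for j
  proof
    assume "\<omega> ^ j = 1"
    then have "rat_eval (monom 1 j + [:- 1:]) \<omega> = 0" unfolding unity by simp
    then have "\<omega>' ^ j = 1" using transfer unity[of j \<omega>'] by (metis eq_iff_diff_eq_0)
    then show False using prim' that by (simp add: primitive_root_of_unity_def)
  qed
  ultimately have "primitive_root_of_unity M \<omega>" by (simp add: primitive_root_of_unity_def)
  then show ?thesis using that prim' transfer by blast
qed

text \<open>
  \<open>N\<close> consists of the elements of the field generated by \<open>\<omega>\<close> whose image under a complex embedding is a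
  nonnegative real number.  As \<open>\<omega>\<^sup>M\<^sup>-\<^sup>1\<close> is the inverse of \<open>\<omega>\<close>, it is mapped to the complex conjugate of the
  image of \<open>\<omega>\<close>, so the products in the last clause are mapped to squared absolute values divided by \<open>n\<close>.
\<close>

lemma cyclotomic_positive_cone:
  assumes M: "M > 0"
  obtains \<omega> :: "'k::{alg_closed_field, field_char_0}" and N :: "'k set"
  where "primitive_root_of_unity M \<omega>" "0 \<in> N" "\<And>x y. x \<in> N \<Longrightarrow> y \<in> N \<Longrightarrow> x + y \<in> N"
    "\<And>x. x \<in> N \<Longrightarrow> 1 + x \<noteq> 0"
    "\<And>(d :: nat \<Rightarrow> nat) n. (\<Sum>j<M. of_nat (d j) * \<omega> ^ (j * 1)) * (\<Sum>j<M. of_nat (d j) * \<omega> ^ (j * (M - 1))) / of_nat n \<in> N"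
proof -
  obtain \<omega> :: 'k and \<omega>' :: complex where prim: "primitive_root_of_unity M \<omega>"
    and prim': "primitive_root_of_unity M \<omega>'"
    and transfer: "\<And>P. rat_eval P \<omega> = 0 \<Longrightarrow> rat_eval P \<omega>' = 0"
    using cyclotomic_embedding[OF M] by blast
  define N where "N = {rat_eval P \<omega> | P. \<exists>r\<ge>0. rat_eval P \<omega>' = complex_of_real r}"
  have unit: "\<omega>' ^ M = 1" using prim' by (simp add: primitive_root_of_unity_def)
  have cnj: "\<omega>' ^ (M - 1) = cnj \<omega>'"
  proof -
    have "norm \<omega>' ^ M = 1" using unit by (metis norm_one norm_power)
    then have "norm \<omega>' = 1" using M power_eq_1_iff[of "norm \<omega>'" M] by simp
    then have "\<omega>' * cnj \<omega>' = 1" by (simp add: complex_norm_square[symmetric])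
    moreover have "\<omega>' * \<omega>' ^ (M - 1) = 1" using unit M power_eq_if[of \<omega>' M] by simp
    ultimately show ?thesis by (metis mult_left_cancel mult_zero_left zero_neq_one)
  qed
  have "0 \<in> N" unfolding N_def by (rule CollectI, rule exI[of _ 0]) auto
  moreover have "x + y \<in> N" if xy: "x \<in> N" "y \<in> N" for x y
  proof -
    obtain P r where P: "x = rat_eval P \<omega>" "r \<ge> 0" "rat_eval P \<omega>' = complex_of_real r"
      using xy(1) unfolding N_def by blast
    obtain Q s where Q: "y = rat_eval Q \<omega>" "s \<ge> 0" "rat_eval Q \<omega>' = complex_of_real s"
      using xy(2) unfolding N_def by blast
    have "x + y = rat_eval (P + Q) \<omega>" "rat_eval (P + Q) \<omega>' = complex_of_real (r + s)" "r + s \<ge> 0"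
      using P Q by (simp_all add: rat_eval_add)
    then show ?thesis unfolding N_def by blast
  qed
  moreover have "1 + x \<noteq> 0" if x: "x \<in> N" for x
  proof
    assume "1 + x = 0"
    obtain P r where P: "x = rat_eval P \<omega>" "r \<ge> 0" "rat_eval P \<omega>' = complex_of_real r"
      using x unfolding N_def by blast
    have "rat_eval (1 + P) \<omega> = 0" using \<open>1 + x = 0\<close> P(1) by (simp add: rat_eval_add)
    then have "rat_eval (1 + P) \<omega>' = 0" by (rule transfer)
    then have "complex_of_real (1 + r) = 0" by (simp add: rat_eval_add P(3))
    then have "1 + r = 0" using of_real_eq_0_iff by blast
    then show False using P(2) by simp
  qed
  moreover have "(\<Sum>j<M. of_nat (d j) * \<omega> ^ (j * 1)) * (\<Sum>j<M. of_nat (d j) * \<omega> ^ (j * (M - 1))) / of_nat n \<in> N"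
    for d :: "nat \<Rightarrow> nat" and n
  proof -
    define F where "F k = (\<Sum>j<M. monom (of_nat (d j) :: rat) (j * k))" for k
    define P where "P = monom (1 / of_nat n) 0 * (F 1 * F (M - 1))"
    have F: "rat_eval (F k) x = (\<Sum>j<M. of_nat (d j) * x ^ (j * k))" for k and x :: "'a::field_char_0"
      unfolding F_def by (simp only: rat_eval_sum rat_eval_monom) simp
    have P: "rat_eval P x = (\<Sum>j<M. of_nat (d j) * x ^ (j * 1)) * (\<Sum>j<M. of_nat (d j) * x ^ (j * (M - 1))) / of_nat n"
      for x :: "'a::field_char_0"
      unfolding P_def by (simp only: rat_eval_mult rat_eval_monom F) (simp add: of_rat_divide)
    define y where "y = (\<Sum>j<M. of_nat (d j) * \<omega>' ^ j)"
    have "(\<Sum>j<M. of_nat (d j) * \<omega>' ^ (j * (M - 1))) = cnj y"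
    proof -
      have "\<omega>' ^ (j * (M - 1)) = cnj (\<omega>' ^ j)" for j
        using cnj by (metis complex_cnj_power mult.commute power_mult)
      then show ?thesis unfolding y_def by simp
    qed
    then have "rat_eval P \<omega>' = complex_of_real ((cmod y)\<^sup>2 / real n)"
      unfolding P by (simp add: complex_norm_square[symmetric] flip: y_def)
    moreover have "(cmod y)\<^sup>2 / real n \<ge> 0" by simp
    ultimately have "rat_eval P \<omega> \<in> N" unfolding N_def by blast
    then show ?thesis unfolding P .
  qed
  ultimately show ?thesis using that prim by blast
qed

section \<open>Sweedler calculus\<close>

text \<open>
  The universal property of tensor powers, in the form needed to evaluate Sweedler sums: a map that is additive in
  each slot and lets scalars move between slots cannot distinguish equal tensors.  The target is an arbitrary
  abelian group, so the same lemma serves scalar-valued and \<open>H\<close>-valued expressions.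
\<close>

lemma tensor_eq_imp_sum_eq:
  fixes F :: "'h::ab_group_add list \<Rightarrow> 'w::ab_group_add"
  assumes "tensor_eq scale s t"
    and add: "\<And>xs a b ys. F (xs @ (a + b) # ys) = F (xs @ a # ys) + F (xs @ b # ys)"
    and bal: "\<And>xs c a ys b zs. F (xs @ scale c a # ys @ b # zs) = F (xs @ a # ys @ scale c b # zs)"
  shows "(\<Sum>xs\<in>#s. F xs) = (\<Sum>xs\<in>#t. F xs)"
  using assms(1)
proof induction
  case (zero xs ys)
  have "F (xs @ 0 # ys) = F (xs @ 0 # ys) + F (xs @ 0 # ys)"
    using add[of xs 0 0 ys] by simp
  then show ?case by simp
qed (simp_all add: add bal)

locale hopf_calculus = hopf_algebra scale \<Delta> \<epsilon> S + linear_space scale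
  for scale :: "'k::field_char_0 \<Rightarrow> 'h::ring_1 \<Rightarrow> 'h"
    and \<Delta> :: "'h \<Rightarrow> ('h \<times> 'h) multiset"
    and \<epsilon> :: "'h \<Rightarrow> 'k"
    and S :: "'h \<Rightarrow> 'h"
begin

text \<open>
  Balanced biadditive maps, as in the universal property of a tensor product; they may take values in a
  group without scalar multiplication.
\<close>

definition balanced2 :: "('h \<Rightarrow> 'h \<Rightarrow> 'w::ab_group_add) \<Rightarrow> bool" where
  "balanced2 G \<longleftrightarrow> (\<forall>a a' b. G (a + a') b = G a b + G a' b) \<and>
     (\<forall>a b b'. G a (b + b') = G a b + G a b') \<and> (\<forall>c a b. G (scale c a) b = G a (scale c b))"

definition balanced3 :: "('h \<Rightarrow> 'h \<Rightarrow> 'h \<Rightarrow> 'w::ab_group_add) \<Rightarrow> bool" where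
  "balanced3 G \<longleftrightarrow> (\<forall>a. balanced2 (G a)) \<and> (\<forall>b. balanced2 (\<lambda>a. G a b)) \<and> (\<forall>c. balanced2 (\<lambda>a b. G a b c))"

text \<open>
  The Sweedler sum \<open>\<Sum> G x\<^sub>1 x\<^sub>2\<close>.  It depends on the chosen presentation of \<open>\<Delta> x\<close> unless \<open>G\<close> is balanced,
  which is why the rules below carry that side condition; the collection \<open>lin\<close> discharges it by rewriting.
\<close>

definition sw :: "'h \<Rightarrow> ('h \<Rightarrow> 'h \<Rightarrow> 'w::ab_group_add) \<Rightarrow> 'w" where
  "sw x G = (\<Sum>(a, b)\<in>#\<Delta> x. G a b)"

lemma sw_tensor:
  assumes "tensor_eq scale (tensor2 s) (tensor2 t)" and G: "balanced2 G"
  shows "(\<Sum>(a, b)\<in>#s. G a b) = (\<Sum>(a, b)\<in>#t. G a b)"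
proof -
  define F where "F xs = (case xs of [a, b] \<Rightarrow> G a b | _ \<Rightarrow> 0)" for xs
  have add: "F (xs @ (a + b) # ys) = F (xs @ a # ys) + F (xs @ b # ys)" for xs a b ys
    using G unfolding F_def balanced2_def by (auto split: list.splits simp: append_eq_Cons_conv Cons_eq_append_conv)
  have bal: "F (xs @ scale c a # ys @ b # zs) = F (xs @ a # ys @ scale c b # zs)" for xs c a ys b zs
    using G unfolding F_def balanced2_def by (auto split: list.splits simp: append_eq_Cons_conv Cons_eq_append_conv)
  have "(\<Sum>xs\<in>#tensor2 s. F xs) = (\<Sum>xs\<in>#tensor2 t. F xs)"
    using tensor_eq_imp_sum_eq[OF assms(1), of F] add bal by blast
  moreover have "(\<Sum>xs\<in>#tensor2 u. F xs) = (\<Sum>(a, b)\<in>#u. G a b)" for u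
    by (simp add: tensor2_def F_def image_mset.compositionality comp_def case_prod_unfold)
  ultimately show ?thesis by simp
qed

lemma sw_additive:
  assumes add: "\<And>x y. f (x + y) = f x + f y"
  shows "f (sw x G) = sw x (\<lambda>a b. f (G a b))"
proof -
  have "f 0 = 0" using add[of 0 0] by simp
  then have "f (\<Sum>p\<in>#M. F p) = (\<Sum>p\<in>#M. f (F p))" for M :: "('h \<times> 'h) multiset" and F
    by (induction M) (simp_all add: add)
  then show ?thesis unfolding sw_def by (simp add: case_prod_unfold)
qed

lemma sw_cong: "(\<And>a b. F a b = G a b) \<Longrightarrow> sw x F = sw x G"
  by (simp add: sw_def)

lemma sw_plus: "sw x (\<lambda>a b. F a b + G a b) = sw x F + sw x G"
  by (simp add: sw_def case_prod_unfold sum_mset.distrib)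

lemma sw_scale_right: "sw x (\<lambda>a b. scale c (G a b)) = scale c (sw x G)"
  by (rule sw_additive[symmetric]) (simp add: scale_right_distrib)

lemma sw_mult_const: "sw x (\<lambda>a b. (c :: 'w::ring) * G a b) = c * sw x G"
  by (rule sw_additive[symmetric]) (simp add: distrib_left)

lemma sw_mult_const_right: "sw x (\<lambda>a b. G a b * (c :: 'w::ring)) = sw x G * c"
  by (rule sw_additive[of "\<lambda>y. y * c", symmetric]) (simp add: distrib_right)

lemma sw_swap:
  fixes G :: "'h \<Rightarrow> 'h \<Rightarrow> 'h \<Rightarrow> 'h \<Rightarrow> 'w::ab_group_add"
  shows "sw x (\<lambda>a b. sw y (\<lambda>c d. G a b c d)) = sw y (\<lambda>c d. sw x (\<lambda>a b. G a b c d))"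
proof -
  have "(\<Sum>p\<in>#M. \<Sum>q\<in>#N. F p q) = (\<Sum>q\<in>#N. \<Sum>p\<in>#M. F p q)"
    for M N :: "('h \<times> 'h) multiset" and F :: "_ \<Rightarrow> _ \<Rightarrow> 'w"
    by (induction M) (simp_all add: sum_mset.distrib)
  then show ?thesis unfolding sw_def by (simp add: case_prod_unfold)
qed

lemma sw_add: "balanced2 G \<Longrightarrow> sw (x + y) G = sw x G + sw y G"
  unfolding sw_def using sw_tensor[OF comult_add] by simp

lemma sw_scale: "balanced2 G \<Longrightarrow> sw (scale c x) G = sw x (\<lambda>a b. G (scale c a) b)"
  unfolding sw_def using sw_tensor[OF comult_scale]
  by (simp add: image_mset.compositionality comp_def case_prod_unfold)

lemma sw_mult:
  fixes G :: "'h \<Rightarrow> 'h \<Rightarrow> 'w::ab_group_add"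
  assumes "balanced2 G"
  shows "sw (x * y) G = sw x (\<lambda>a b. sw y (\<lambda>c d. G (a * c) (b * d)))"
proof -
  have sum: "(\<Sum>q\<in>#(\<Sum>p\<in>#M. f p). F q) = (\<Sum>p\<in>#M. \<Sum>q\<in>#f p. F q)"
    for M :: "('h \<times> 'h) multiset" and f :: "_ \<Rightarrow> ('h \<times> 'h) multiset" and F :: "_ \<Rightarrow> 'w"
    by (induction M) simp_all
  show ?thesis
    unfolding sw_def using sw_tensor[OF comult_mult assms]
    by (simp add: case_prod_unfold sum image_mset.compositionality comp_def)
qed

lemma sw_one: "balanced2 G \<Longrightarrow> sw 1 G = G 1 1"
  unfolding sw_def using sw_tensor[of "\<Delta> 1" "{#(1, 1)#}" G] comult_one by (simp add: tensor2_def)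

lemma sw_coassoc:
  assumes G: "balanced3 G"
  shows "sw x (\<lambda>a c. sw a (\<lambda>a b. G a b c)) = sw x (\<lambda>a b. sw b (\<lambda>b c. G a b c))"
proof -
  define F where "F xs = (case xs of [a, b, c] \<Rightarrow> G a b c | _ \<Rightarrow> 0)" for xs
  have add: "F (xs @ (a + b) # ys) = F (xs @ a # ys) + F (xs @ b # ys)" for xs a b ys
    using G unfolding F_def balanced3_def balanced2_def 
    by (auto split: list.splits simp: append_eq_Cons_conv Cons_eq_append_conv)
  have bal: "F (xs @ scale c a # ys @ b # zs) = F (xs @ a # ys @ scale c b # zs)" for xs c a ys b zs
    using G unfolding F_def balanced3_def balanced2_def
    by (auto split: list.splits simp: append_eq_Cons_conv Cons_eq_append_conv)
  have sum: "(\<Sum>q\<in>#(\<Sum>p\<in>#M. f p). F q) = (\<Sum>p\<in>#M. \<Sum>q\<in>#f p. F q)"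
    for M :: "('h \<times> 'h) multiset" and f :: "_ \<Rightarrow> 'h list multiset"
    by (induction M) simp_all
  have F3: "F [a, b, c] = G a b c" for a b c by (simp add: F_def)
  have "(\<Sum>xs\<in>#(\<Sum>(a, b)\<in>#\<Delta> x. image_mset (\<lambda>(a1, a2). [a1, a2, b]) (\<Delta> a)). F xs)
      = (\<Sum>xs\<in>#(\<Sum>(a, b)\<in>#\<Delta> x. image_mset (\<lambda>(b1, b2). [a, b1, b2]) (\<Delta> b)). F xs)"
    using tensor_eq_imp_sum_eq[OF coassoc, of F] add bal by blast
  then show ?thesis
    by (simp add: sw_def case_prod_unfold sum image_mset.compositionality comp_def F3)
qed

lemma \<epsilon>_add: "\<epsilon> (x + y) = \<epsilon> x + \<epsilon> y" and \<epsilon>_scale: "\<epsilon> (scale c x) = c * \<epsilon> x"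
  using counit_linear form_iff by blast+

lemma S_add: "S (x + y) = S x + S y" and S_scale: "S (scale c x) = scale c (S x)"
  using antipode_linear endo_iff by blast+

lemma sw_counit_left: "sw x (\<lambda>a b. scale (\<epsilon> a) b) = x"
  unfolding sw_def by (rule counit_left)

lemma sw_counit_right: "sw x (\<lambda>a b. scale (\<epsilon> b) a) = x"
  unfolding sw_def by (rule counit_right)

lemma sw_antipode_left: "sw x (\<lambda>a b. S a * b) = scale (\<epsilon> x) 1"
  unfolding sw_def by (rule antipode_left)

lemma sw_antipode_right: "sw x (\<lambda>a b. a * S b) = scale (\<epsilon> x) 1"
  unfolding sw_def by (rule antipode_right)

lemmas lin = distrib_left distrib_right scale_right_distrib scale_left_distrib scale_mult_left scale_mult_right
  \<epsilon>_add \<epsilon>_scale S_add S_scale sw_add sw_scale sw_plus sw_scale_right sw_mult_const sw_mult_const_right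
  balanced2_def balanced3_def counit_mult

lemma S_one: "S 1 = 1"
  using sw_antipode_left[of 1] by (simp add: sw_one lin counit_one)

lemma S_counit: "\<epsilon> (S x) = \<epsilon> x"
proof -
  have "\<epsilon> x = \<epsilon> (sw x (\<lambda>a b. S a * b))"
    by (simp add: sw_antipode_left lin counit_one)
  also have "\<dots> = sw x (\<lambda>a b. \<epsilon> (S (scale (\<epsilon> b) a)))"
    by (subst sw_additive) (simp_all add: lin mult.commute)
  also have "\<dots> = \<epsilon> (S x)"
    by (subst sw_additive[of "\<lambda>x. \<epsilon> (S x)", symmetric]) (simp_all add: lin sw_counit_right)
  finally show ?thesis by simp
qed

text \<open>
  Both sides are obtained from \<open>S(x\<^sub>1 y\<^sub>1) x\<^sub>2 y\<^sub>2 S(y\<^sub>3) S(x\<^sub>3)\<close>, contracting either the last two legs of \<open>x\<close> and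
  \<open>y\<close> or the first two.
\<close>

lemma S_mult: "S (x * y) = S y * S x"
proof -
  have "S (x * y) = sw x (\<lambda>x1 x'. sw y (\<lambda>y1 y'. S (x1 * y1) * scale (\<epsilon> x' * \<epsilon> y') 1))"
  proof -
    have "sw x (\<lambda>x1 x'. sw y (\<lambda>y1 y'. S (x1 * y1) * scale (\<epsilon> x' * \<epsilon> y') 1))
        = sw x (\<lambda>x1 x'. sw y (\<lambda>y1 y'. S (scale (\<epsilon> x') x1 * scale (\<epsilon> y') y1)))"
      by (simp add: lin mult.commute)
    also have "\<dots> = sw x (\<lambda>x1 x'. S (scale (\<epsilon> x') x1 * sw y (\<lambda>y1 y'. scale (\<epsilon> y') y1)))"
      by (subst sw_additive[of "\<lambda>u. S (_ * u)"]) (simp_all only: distrib_left S_add)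
    also have "\<dots> = S (sw x (\<lambda>x1 x'. scale (\<epsilon> x') x1) * sw y (\<lambda>y1 y'. scale (\<epsilon> y') y1))"
      by (subst sw_additive[of "\<lambda>u. S (u * _)"]) (simp_all only: distrib_right S_add)
    finally show ?thesis by (simp add: sw_counit_right)
  qed
  also have "\<dots> = sw x (\<lambda>x1 x'. sw y (\<lambda>y1 y'. S (x1 * y1) * sw x' (\<lambda>x2 x3. sw y' (\<lambda>y2 y3. x2 * (y2 * S y3) * S x3))))"
    by (simp add: lin sw_antipode_right mult.commute)
  also have "\<dots> = sw x (\<lambda>x1 x'. sw x' (\<lambda>x2 x3. sw y (\<lambda>y1 y'. sw y' (\<lambda>y2 y3. S (x1 * y1) * (x2 * (y2 * S y3) * S x3)))))"
    by (rule sw_cong, simp only: sw_mult_const[symmetric] sw_mult_const_right[symmetric], subst sw_swap, rule HOL.refl)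
  also have "\<dots> = sw x (\<lambda>x' x3. sw x' (\<lambda>x1 x2. sw y (\<lambda>y' y3. sw y' (\<lambda>y1 y2. S (x1 * y1) * (x2 * (y2 * S y3) * S x3)))))"
    by (simp add: sw_coassoc lin)
  also have "\<dots> = sw x (\<lambda>x' x3. sw y (\<lambda>y' y3. sw (x' * y') (\<lambda>a b. S a * b) * (S y3 * S x3)))"
    by (rule sw_cong, subst sw_swap, rule sw_cong, subst sw_mult)
       (simp add: lin, simp only: sw_mult_const_right[symmetric] mult.assoc)
  also have "\<dots> = sw x (\<lambda>x' x3. sw y (\<lambda>y' y3. S (scale (\<epsilon> y') y3) * S (scale (\<epsilon> x') x3)))"
    by (simp add: sw_antipode_left lin)
  also have "\<dots> = S y * S x"
    by (simp add: sw_mult_const sw_mult_const_right sw_additive[of S, symmetric] S_add sw_counit_left)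
  finally show ?thesis .
qed

lemma sw_counit_left': "(\<And>x y. f (x + y) = f x + f y) \<Longrightarrow> sw x (\<lambda>a b. f (scale (\<epsilon> a) b)) = f x"
  by (subst sw_additive[symmetric]) (simp_all add: sw_counit_left)

lemma sw_counit_right': "(\<And>x y. f (x + y) = f x + f y) \<Longrightarrow> sw x (\<lambda>a b. f (scale (\<epsilon> b) a)) = f x"
  by (subst sw_additive[symmetric]) (simp_all add: sw_counit_right)

lemma sw_antipode_left': "(\<And>x y. f (x + y) = f x + f y) \<Longrightarrow> sw x (\<lambda>a b. f (S a * b)) = f (scale (\<epsilon> x) 1)"
  by (subst sw_additive[symmetric]) (simp_all add: sw_antipode_left)

lemma sw_antipode_right': "(\<And>x y. f (x + y) = f x + f y) \<Longrightarrow> sw x (\<lambda>a b. f (a * S b)) = f (scale (\<epsilon> x) 1)"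
  by (subst sw_additive[symmetric]) (simp_all add: sw_antipode_right)

lemma sw_antipode_right2:
  assumes F: "balanced2 F"
  shows "sw x (\<lambda>a u. sw u (\<lambda>b v. sw v (\<lambda>c d. F (a * S d) (b * S c)))) = F (scale (\<epsilon> x) 1) 1"
proof -
  have F': "F (a + a') b = F a b + F a' b" "F a (b + b') = F a b + F a b'" for a a' b b'
    using F unfolding balanced2_def by blast+
  have bal: "F a (scale c b) = F (scale c a) b" for c a b
    using F unfolding balanced2_def by metis
  have "sw x (\<lambda>a u. sw u (\<lambda>b v. sw v (\<lambda>c d. F (a * S d) (b * S c))))
      = sw x (\<lambda>a u. sw u (\<lambda>w d. sw w (\<lambda>b c. F (a * S d) (b * S c))))"
    by (rule sw_cong, rule sw_coassoc[symmetric]) (simp_all add: F' bal lin)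
  also have "\<dots> = sw x (\<lambda>a u. sw u (\<lambda>w d. F (a * S (scale (\<epsilon> w) d)) 1))"
    by (rule sw_cong, rule sw_cong, subst sw_antipode_right') (simp_all add: F' lin bal)
  also have "\<dots> = sw x (\<lambda>a u. F (a * S u) 1)"
    by (rule sw_cong, subst sw_counit_left'[of "\<lambda>z. F (_ * S z) 1"]) (simp_all add: F' lin)
  also have "\<dots> = F (scale (\<epsilon> x) 1) 1"
    by (subst sw_antipode_right'[of "\<lambda>z. F z 1"]) (simp_all add: F')
  finally show ?thesis .
qed

text \<open>
  \<open>\<Delta> (S x) = S(x\<^sub>2) \<otimes> S(x\<^sub>1)\<close>: the tensor \<open>\<Delta>(S(x\<^sub>1)) (x\<^sub>2 S(x\<^sub>5) \<otimes> x\<^sub>3 S(x\<^sub>4))\<close> collapses to the left side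
  by \<open>sw_antipode_right2\<close>, and to the right side because \<open>\<Delta>(S(x\<^sub>1)) \<Delta>(x\<^sub>2) = \<Delta>(\<epsilon>(x\<^sub>1) 1)\<close> for the first
  legs.
\<close>

lemma S_anticomult:
  assumes G: "balanced2 G"
  shows "sw (S x) G = sw x (\<lambda>a b. G (S b) (S a))"
proof -
  have G': "G (a + a') b = G a b + G a' b" "G a (b + b') = G a b + G a b'" "G a (scale c b) = G (scale c a) b" for a a' b b' c
    using G unfolding balanced2_def by metis+
  have "sw (S x) G = sw x (\<lambda>x1 x'. sw (S x1) (\<lambda>p q. G (p * scale (\<epsilon> x') 1) (q * 1)))"
  proof -
    have "sw (S x1) (\<lambda>p q. G (p * scale (\<epsilon> x') 1) (q * 1)) = sw (S (scale (\<epsilon> x') x1)) G" for x1 x'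
      by (simp add: lin G')
    then show ?thesis
      by (simp, subst sw_counit_right'[of "\<lambda>z. sw (S z) G"]) (simp_all add: lin G')
  qed
  also have "\<dots> = sw x (\<lambda>x1 x'. sw (S x1) (\<lambda>p q. sw x' (\<lambda>x2 u. sw u (\<lambda>x3 v. sw v (\<lambda>x4 x5.
      G (p * (x2 * S x5)) (q * (x3 * S x4)))))))"
    by (rule sw_cong, rule sw_cong, subst sw_antipode_right2[of "\<lambda>a b. G (_ * a) (_ * b)"]) (simp_all add: lin G')
  also have "\<dots> = sw x (\<lambda>x1 x'. sw x' (\<lambda>x2 u. sw u (\<lambda>x3 v. sw (S x1) (\<lambda>p q. sw v (\<lambda>x4 x5.
      G (p * (x2 * S x5)) (q * (x3 * S x4)))))))"
    by (rule sw_cong, subst sw_swap, rule sw_cong, subst sw_swap, rule HOL.refl)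
  also have "\<dots> = sw x (\<lambda>x1 x'. sw x' (\<lambda>u v. sw u (\<lambda>x2 x3. sw (S x1) (\<lambda>p q. sw v (\<lambda>x4 x5.
      G (p * (x2 * S x5)) (q * (x3 * S x4)))))))"
    by (rule sw_cong, rule sw_coassoc[symmetric]) (simp add: lin G')
  also have "\<dots> = sw x (\<lambda>y v. sw y (\<lambda>x1 u. sw u (\<lambda>x2 x3. sw (S x1) (\<lambda>p q. sw v (\<lambda>x4 x5.
      G (p * (x2 * S x5)) (q * (x3 * S x4)))))))"
    by (rule sw_coassoc[symmetric]) (simp add: lin G')
  also have "\<dots> = sw x (\<lambda>y v. sw y (\<lambda>x1 u. sw (S x1 * u) (\<lambda>p q. sw v (\<lambda>x4 x5. G (p * S x5) (q * S x4)))))"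
    by (rule sw_cong, rule sw_cong, subst sw_mult) (simp_all add: lin G' mult.assoc, subst sw_swap, rule HOL.refl)
  also have "\<dots> = sw x (\<lambda>y v. sw (scale (\<epsilon> y) v) (\<lambda>x4 x5. G (S x5) (S x4)))"
    by (rule sw_cong, subst sw_antipode_left'[of "\<lambda>z. sw z _"]) (simp_all add: lin G' sw_one mult.commute)
  also have "\<dots> = sw x (\<lambda>a b. G (S b) (S a))"
    by (subst sw_counit_left'[of "\<lambda>z. sw z _"]) (simp_all add: lin G')
  finally show ?thesis .
qed

end

section \<open>Integrals\<close>

text \<open>
  The element \<open>e\<close> is the component of 1 in \<open>I\<close> along a complementary left ideal.
\<close>

lemma semisimple_left_ideal_idempotent:
  assumes ss: "semisimple_ring TYPE('h::ring_1)" and I: "left_ideal (I :: 'h set)"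
  obtains e where "e \<in> I" "\<And>x. x \<in> I \<Longrightarrow> x * e = x"
proof -
  obtain J where J: "left_ideal J" "I \<inter> J = {0}" "\<And>x. \<exists>a\<in>I. \<exists>b\<in>J. x = a + b"
    using ss I unfolding semisimple_ring_def by metis
  obtain e f where ef: "e \<in> I" "f \<in> J" "1 = e + f" using J(3)[of 1] by blast
  have "x * e = x" if "x \<in> I" for x
  proof -
    have "x = x * e + x * f" using ef(3) by (metis distrib_left mult.right_neutral)
    then have xf: "x * f = x + (- x) * e" by (simp add: algebra_simps)
    have "x * f \<in> J" using J(1) ef unfolding left_ideal_def by blast
    moreover have "x * f \<in> I" unfolding xf using I that ef(1) unfolding left_ideal_def by blast
    ultimately have "x * f = 0" using J(2) by blast
    then show ?thesis using \<open>x = x * e + x * f\<close> by simp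
  qed
  then show ?thesis using that ef(1) by blast
qed

context hopf_calculus
begin

text \<open>
  The kernel of \<open>\<epsilon>\<close> is a left ideal, so it has a right identity \<open>e\<close>, and \<open>t = 1 - e\<close> is a left integral.  For a right
  integral, \<open>t h - \<epsilon>(h) t\<close> is a left integral annihilated by \<open>\<epsilon>\<close>; such an element squares to 0 and spans a left
  ideal, which in a semisimple ring forces it to vanish.
\<close>

lemma exists_integral:
  assumes ss: "semisimple_ring TYPE('h)"
  obtains t where "two_sided_integral scale \<epsilon> t" "\<epsilon> t = 1"
proof -
  have \<epsilon>0: "\<epsilon> 0 = 0" using counit_linear form_zero by blast
  have ker: "left_ideal {x. \<epsilon> x = 0}"
    unfolding left_ideal_def by (auto simp: \<epsilon>0 \<epsilon>_add counit_mult)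
  obtain e where e: "\<epsilon> e = 0" "\<And>x. \<epsilon> x = 0 \<Longrightarrow> x * e = x"
    by (rule semisimple_left_ideal_idempotent[OF ss ker]) simp
  define t where "t = 1 - e"
  have \<epsilon>t: "\<epsilon> t = 1"
    using \<epsilon>_add[of t e] e(1) by (simp add: t_def counit_one)
  have left: "h * t = scale (\<epsilon> h) t" for h
  proof -
    have "\<epsilon> (h + scale (- \<epsilon> h) 1) = 0" by (simp only: \<epsilon>_add \<epsilon>_scale) (simp add: counit_one)
    from e(2)[OF this] show ?thesis
      by (simp add: t_def algebra_simps scale_mult_left scale_right_diff_distrib)
  qed
  \<comment> \<open>The multiples of \<open>x\<close> form a left ideal; its right identity is a multiple of \<open>x\<close>, and \<open>x * x = 0\<close>.\<close>
  have left_zero: "x = 0" if x: "\<And>h. h * x = scale (\<epsilon> h) x" and "\<epsilon> x = 0" for x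
  proof -
    have multiples: "left_ideal (range (\<lambda>c. scale c x))"
      unfolding left_ideal_def
    proof (intro conjI ballI allI)
      show "0 \<in> range (\<lambda>c. scale c x)" by (rule range_eqI[of _ _ 0]) simp
      show "a + b \<in> range (\<lambda>c. scale c x)" if ab: "a \<in> range (\<lambda>c. scale c x)" "b \<in> range (\<lambda>c. scale c x)" for a b
        using ab by (auto simp flip: scale_left_distrib)
      show "r * a \<in> range (\<lambda>c. scale c x)" if "a \<in> range (\<lambda>c. scale c x)" for r a
        using that by (auto simp: scale_mult_right x)
    qed
    obtain f where f: "f \<in> range (\<lambda>c. scale c x)" "\<And>y. y \<in> range (\<lambda>c. scale c x) \<Longrightarrow> y * f = y"
      by (rule semisimple_left_ideal_idempotent[OF ss multiples]) (rule that)
    have "x \<in> range (\<lambda>c. scale c x)" by (rule range_eqI[of _ _ 1]) simp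
    then have "x = x * f" using f(2) by simp
    also have "\<dots> = 0" using f(1) by (auto simp: scale_mult_right x \<open>\<epsilon> x = 0\<close>)
    finally show ?thesis .
  qed
  have right: "t * h = scale (\<epsilon> h) t" for h
  proof -
    define x where "x = t * h + scale (- \<epsilon> h) t"
    have "x = 0"
    proof (rule left_zero)
      show "h' * x = scale (\<epsilon> h') x" for h'
        unfolding x_def
        by (simp add: distrib_left right_diff_distrib scale_mult_right scale_mult_left left scale_right_diff_distrib mult.commute flip: mult.assoc)
      show "\<epsilon> x = 0" unfolding x_def by (simp only: \<epsilon>_add \<epsilon>_scale counit_mult \<epsilon>t) simp
    qed
    then show ?thesis unfolding x_def by simp
  qed
  have "two_sided_integral scale \<epsilon> t"
    unfolding two_sided_integral_def using left right by blast
  then show ?thesis using that \<epsilon>t by blast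
qed

lemma normalized_integral_eq:
  assumes t: "two_sided_integral scale \<epsilon> t" "\<epsilon> t = 1"
  shows "normalized_integral scale \<epsilon> = t"
  unfolding normalized_integral_def
proof (rule the_equality)
  fix u assume u: "two_sided_integral scale \<epsilon> u \<and> \<epsilon> u = 1"
  have "t * u = u" using u t by (simp add: two_sided_integral_def)
  moreover have "t * u = t" using u t unfolding two_sided_integral_def by (metis scale_one)
  ultimately show "u = t" by simp
qed (use t in simp)

text \<open>
  \<open>\<Lambda>\<^sub>1 \<otimes> h \<Lambda>\<^sub>2 = S(h) \<Lambda>\<^sub>1 \<otimes> \<Lambda>\<^sub>2\<close>, from \<open>S(h\<^sub>1) h\<^sub>2 \<Lambda>\<^sub>1 \<otimes> h\<^sub>3 \<Lambda>\<^sub>2\<close>.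
\<close>

lemma integral_move_left:
  assumes t: "\<And>h. h * t = scale (\<epsilon> h) t" and G: "balanced2 G"
  shows "sw t (\<lambda>a b. G a (h * b)) = sw t (\<lambda>a b. G (S h * a) b)"
proof -
  have G': "G (a + a') b = G a b + G a' b" "G a (b + b') = G a b + G a b'" "G a (scale c b) = G (scale c a) b" for a a' b b' c
    using G unfolding balanced2_def by metis+
  have Gf: "G (a + a') = (\<lambda>b. G a b + G a' b)" for a a' using G' by (intro ext)
  have "sw t (\<lambda>a b. G (S h * a) b) = sw h (\<lambda>h1 u. sw t (\<lambda>a b. G (S (scale (\<epsilon> u) h1) * a) b))"
    by (subst sw_counit_right'[of "\<lambda>z. sw t (\<lambda>a b. G (S z * a) b)"]) (simp_all add: lin G' Gf)
  also have "\<dots> = sw h (\<lambda>h1 u. sw (u * t) (\<lambda>a b. G (S h1 * a) b))"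
    by (simp add: t lin G' Gf)
  also have "\<dots> = sw h (\<lambda>h1 u. sw u (\<lambda>h2 h3. sw t (\<lambda>a b. G (S h1 * (h2 * a)) (h3 * b))))"
    by (simp add: sw_mult lin G' Gf)
  also have "\<dots> = sw h (\<lambda>u h3. sw u (\<lambda>h1 h2. sw t (\<lambda>a b. G (S h1 * h2 * a) (h3 * b))))"
    unfolding mult.assoc by (rule sw_coassoc[symmetric]) (simp add: lin G' Gf)
  also have "\<dots> = sw h (\<lambda>u h3. sw t (\<lambda>a b. G a (scale (\<epsilon> u) h3 * b)))"
    by (rule sw_cong, subst sw_antipode_left'[of "\<lambda>z. sw t (\<lambda>a b. G (z * a) (_ * b))"]) (simp_all add: lin G' Gf)
  also have "\<dots> = sw t (\<lambda>a b. G a (h * b))"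
    by (subst sw_counit_left'[of "\<lambda>z. sw t (\<lambda>a b. G a (z * b))"]) (simp_all add: lin G' Gf)
  finally show ?thesis by simp
qed

text \<open>
  \<open>\<Lambda>\<^sub>1 h \<otimes> \<Lambda>\<^sub>2 = \<Lambda>\<^sub>1 \<otimes> \<Lambda>\<^sub>2 S(h)\<close>, the mirror image.
\<close>

lemma integral_move_right:
  assumes t: "\<And>h. t * h = scale (\<epsilon> h) t" and G: "balanced2 G"
  shows "sw t (\<lambda>a b. G (a * h) b) = sw t (\<lambda>a b. G a (b * S h))"
proof -
  have G': "G (a + a') b = G a b + G a' b" "G a (b + b') = G a b + G a b'" "G a (scale c b) = G (scale c a) b" for a a' b b' c
    using G unfolding balanced2_def by metis+
  have Gf: "G (a + a') = (\<lambda>b. G a b + G a' b)" for a a' using G' by (intro ext)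
  have "sw t (\<lambda>a b. G a (b * S h)) = sw h (\<lambda>u h3. sw t (\<lambda>a b. G a (b * S (scale (\<epsilon> u) h3))))"
    by (subst sw_counit_left'[of "\<lambda>z. sw t (\<lambda>a b. G a (b * S z))"]) (simp_all add: lin G' Gf)
  also have "\<dots> = sw h (\<lambda>u h3. sw (t * u) (\<lambda>a b. G a (b * S h3)))"
    by (simp add: t lin G' Gf)
  also have "\<dots> = sw h (\<lambda>u h3. sw u (\<lambda>h1 h2. sw t (\<lambda>a b. G (a * h1) (b * h2 * S h3))))"
    by (rule sw_cong, subst sw_mult, simp add: lin G', subst sw_swap, rule HOL.refl)
  also have "\<dots> = sw h (\<lambda>h1 u. sw u (\<lambda>h2 h3. sw t (\<lambda>a b. G (a * h1) (b * (h2 * S h3)))))"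
    unfolding mult.assoc by (rule sw_coassoc) (simp add: lin G' Gf)
  also have "\<dots> = sw h (\<lambda>h1 u. sw t (\<lambda>a b. G (a * scale (\<epsilon> u) h1) b))"
    by (rule sw_cong, subst sw_antipode_right'[of "\<lambda>z. sw t (\<lambda>a b. G (a * _) (b * z))"]) (simp_all add: lin G' Gf)
  also have "\<dots> = sw t (\<lambda>a b. G (a * h) b)"
    by (subst sw_counit_right'[of "\<lambda>z. sw t (\<lambda>a b. G (a * z) b)"]) (simp_all add: lin G' Gf)
  finally show ?thesis by simp
qed

lemma sw_cong_mem: "(\<And>a b. (a, b) \<in># \<Delta> x \<Longrightarrow> F a b = G a b) \<Longrightarrow> sw x F = sw x G"
  unfolding sw_def by (intro arg_cong[of _ _ sum_mset] image_mset_cong) auto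

lemma sw_sum: "sw x (\<lambda>a b. \<Sum>i\<in>I. G i a b) = (\<Sum>i\<in>I. sw x (G i))"
  by (induction I rule: infinite_finite_induct) (simp_all add: sw_plus, simp_all add: sw_def case_prod_unfold)

lemma sw_in_span:
  assumes "\<And>a b. (a, b) \<in># \<Delta> x \<Longrightarrow> G a b \<in> span T"
  shows "sw x G \<in> span T"
proof -
  have "(\<forall>p\<in>#M. F p \<in> span T) \<Longrightarrow> (\<Sum>p\<in>#M. F p) \<in> span T" for M :: "('h \<times> 'h) multiset" and F
    by (induction M) (auto simp: span_zero span_add)
  from this[of "\<Delta> x" "\<lambda>(a, b). G a b"] show ?thesis
    unfolding sw_def using assms by (auto simp: case_prod_unfold)
qed

text \<open>
  Expand the left legs of \<open>\<Delta> t\<close> in finitely many basis vectors \<open>e\<close>.  Then \<open>h = h S(t\<^sub>1) t\<^sub>2\<close> is a combination of terms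
  \<open>h S(e) t\<^sub>2\<close>, and \<open>integral_move_left\<close> moves the factor \<open>h S(e)\<close> to the left leg, where a coordinate turns it into
  a scalar.  What remains lies in the span of the right legs of \<open>\<Delta> t\<close>, a finite set that does not depend on \<open>h\<close>.
\<close>

lemma finite_dimensional:
  assumes t: "two_sided_integral scale \<epsilon> t" "\<epsilon> t = 1"
  obtains E where "finite E" "independent E" "span E = UNIV"
proof -
  have left: "h * t = scale (\<epsilon> h) t" for h using t by (simp add: two_sided_integral_def)
  obtain E where E: "independent E" "span E = UNIV"
    by (rule maximal_independent_subset[of UNIV]) auto
  define crd where "crd e v = representation E v e" for e v
  have crd: "crd e (x + y) = crd e x + crd e y" "crd e (scale c x) = c * crd e x" for e x y c
    unfolding crd_def using E by (simp_all add: representation_add representation_scale)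
  define E0 where "E0 = (\<Union>(a, b)\<in>set_mset (\<Delta> t). {e. crd e a \<noteq> 0})"
  have E0: "finite E0" unfolding E0_def crd_def by (auto simp: finite_representation)
  have exp: "a = (\<Sum>e\<in>E0. scale (crd e a) e)" if "(a, b) \<in># \<Delta> t" for a b
  proof -
    have "a = (\<Sum>e | crd e a \<noteq> 0. scale (crd e a) e)"
      unfolding crd_def using sum_nonzero_representation_eq[OF E(1)] E(2) by simp
    also have "\<dots> = (\<Sum>e\<in>E0. scale (crd e a) e)"
      by (rule sum.mono_neutral_left) (use that E0 in \<open>auto simp: E0_def\<close>)
    finally show ?thesis .
  qed
  have h_eq: "h \<in> span (snd ` set_mset (\<Delta> t))" for h
  proof -
    have "h = sw t (\<lambda>a b. h * (S a * b))"
      by (simp add: lin sw_antipode_left t)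
    also have "\<dots> = sw t (\<lambda>a b. \<Sum>e\<in>E0. scale (crd e a) (h * S e * b))"
    proof (rule sw_cong_mem)
      fix a b assume "(a, b) \<in># \<Delta> t"
      then have "h * (S a * b) = h * (S (\<Sum>e\<in>E0. scale (crd e a) e) * b)" using exp by simp
      then show "h * (S a * b) = (\<Sum>e\<in>E0. scale (crd e a) (h * S e * b))"
        by (simp add: endo_sum[OF antipode_linear] S_scale sum_distrib_left sum_distrib_right lin mult.assoc)
    qed
    also have "\<dots> = (\<Sum>e\<in>E0. sw t (\<lambda>a b. scale (crd e (S (h * S e) * a)) b))"
      unfolding sw_sum
      by (rule sum.cong[OF HOL.refl], rule integral_move_left[OF left, of "\<lambda>a b. scale (crd _ a) b"])
         (simp add: lin crd mult.commute)
    also have "\<dots> \<in> span (snd ` set_mset (\<Delta> t))"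
      by (intro span_sum sw_in_span span_scale span_base) force
    finally show ?thesis .
  qed
  have "finite E"
    using independent_span_bound[of "snd ` set_mset (\<Delta> t)" E] E h_eq by blast
  then show ?thesis using that E by blast
qed

end

section \<open>Traces on finite-dimensional spaces\<close>

locale finite_linear_space = linear_space scale + finite_dimensional_vector_space scale Basis
  for scale :: "'k::field_char_0 \<Rightarrow> 'v::ab_group_add \<Rightarrow> 'v" and Basis
begin

definition crd :: "'v \<Rightarrow> 'v \<Rightarrow> 'k" where
  "crd b v = representation Basis v b"

definition tr :: "('v \<Rightarrow> 'v) \<Rightarrow> 'k" where
  "tr f = (\<Sum>b\<in>Basis. crd b (f b))"

lemma crd_add: "crd b (x + y) = crd b x + crd b y" and crd_scale: "crd b (scale c x) = c * crd b x"
  unfolding crd_def using independent_Basis span_Basis by (simp_all add: representation_add representation_scale)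

lemma crd_form: "form (crd b)"
  by (simp add: form_iff crd_add crd_scale)

lemma sum_crd: "(\<Sum>b\<in>Basis. scale (crd b v) b) = v"
  unfolding crd_def using sum_representation_eq[OF independent_Basis _ finite_Basis] span_Basis by simp

lemma form_expand: "form p \<Longrightarrow> p v = (\<Sum>b\<in>Basis. crd b v * p b)"
  by (subst sum_crd[of v, symmetric]) (simp add: form_sum, simp add: form_iff)

lemma endo_expand: "endo p \<Longrightarrow> p v = (\<Sum>b\<in>Basis. scale (crd b v) (p b))"
  by (subst sum_crd[of v, symmetric]) (simp add: endo_sum, simp add: endo_iff)

lemma eq_if_forms_eq:
  assumes "\<And>p. form p \<Longrightarrow> p x = p y"
  shows "x = y"
proof -
  have "(\<Sum>b\<in>Basis. scale (crd b x) b) = (\<Sum>b\<in>Basis. scale (crd b y) b)"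
    using assms[OF crd_form] by simp
  then show ?thesis by (simp add: sum_crd)
qed

lemma tr_add: "tr (\<lambda>x. f x + g x) = tr f + tr g"
  by (simp add: tr_def crd_add sum.distrib)

lemma tr_scale: "tr (\<lambda>x. scale c (f x)) = c * tr f"
  by (simp add: tr_def crd_scale sum_distrib_left)

lemma tr_rank_one:
  assumes "form p"
  shows "tr (\<lambda>x. scale (p x) y) = p y"
  using form_expand[OF assms, of y] by (simp add: tr_def crd_scale mult.commute)

lemma tr_comp:
  assumes f: "endo f" and g: "endo g"
  shows "tr (\<lambda>x. f (g x)) = tr (\<lambda>x. g (f x))"
proof -
  have *: "tr (\<lambda>x. f (g x)) = (\<Sum>b\<in>Basis. \<Sum>c\<in>Basis. crd c (g b) * crd b (f c))" if f: "endo f" for f g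
    unfolding tr_def by (simp add: endo_expand[OF f, of "g _"] form_sum[OF crd_form] crd_scale)
  show ?thesis
    unfolding *[OF f] *[OF g] by (subst sum.swap) (simp add: mult.commute)
qed

lemma tr_id: "tr (\<lambda>x. x) = of_nat (card Basis)"
  by (simp add: tr_def crd_def representation_basis[OF independent_Basis])

end

section \<open>Trace functionals as integrals on the Hopf algebra\<close>

locale semisimple_hopf = hopf_calculus scale \<Delta> \<epsilon> S + finite_linear_space scale Basis
  for scale :: "'k::field_char_0 \<Rightarrow> 'h::ring_1 \<Rightarrow> 'h"
    and \<Delta> :: "'h \<Rightarrow> ('h \<times> 'h) multiset"
    and \<epsilon> :: "'h \<Rightarrow> 'k"
    and S :: "'h \<Rightarrow> 'h"
    and Basis :: "'h set" +
  fixes \<Lambda> :: 'h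
  assumes semisimple: "semisimple_ring TYPE('h)"
    and integral: "two_sided_integral scale \<epsilon> \<Lambda>"
    and integral_normalized: "\<epsilon> \<Lambda> = 1"
begin

lemma \<Lambda>_left: "h * \<Lambda> = scale (\<epsilon> h) \<Lambda>" and \<Lambda>_right: "\<Lambda> * h = scale (\<epsilon> h) \<Lambda>"
  using integral by (simp_all add: two_sided_integral_def)

text \<open>
  For \<open>S\<^sup>2 = id\<close> these are the characters of the right and of the left regular representation.
\<close>

definition lam :: "'h \<Rightarrow> 'k" where "lam y = tr (\<lambda>x. S (S x) * y)"

definition mu :: "'h \<Rightarrow> 'k" where "mu y = tr (\<lambda>x. y * S (S x))"

lemma lam_add: "lam (x + y) = lam x + lam y" and lam_scale: "lam (scale c x) = c * lam x"
  by (simp_all add: lam_def lin tr_add tr_scale)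

lemma mu_add: "mu (x + y) = mu x + mu y" and mu_scale: "mu (scale c x) = c * mu x"
  by (simp_all add: mu_def lin tr_add tr_scale)

lemmas linear_simps = lin lam_add lam_scale mu_add mu_scale crd_add crd_scale

lemma lam_form: "form lam" and mu_form: "form mu"
  by (simp_all add: form_iff linear_simps)

lemma lam_\<Lambda>: "lam \<Lambda> = 1"
  using tr_rank_one[OF counit_linear, of \<Lambda>]
  by (simp add: lam_def \<Lambda>_left S_counit integral_normalized)

lemma mu_\<Lambda>: "mu \<Lambda> = 1"
  using tr_rank_one[OF counit_linear, of \<Lambda>]
  by (simp add: mu_def \<Lambda>_right S_counit integral_normalized)

lemma lam_nakayama: "lam (a * h) = lam (S (S h) * a)"
  unfolding lam_def using tr_comp[of "\<lambda>y. y * h" "\<lambda>x. S (S x) * a"]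
  by (simp add: endo_iff lin S_mult mult.assoc)

lemma mu_nakayama: "mu (h * a) = mu (a * S (S h))"
  unfolding mu_def using tr_comp[of "\<lambda>y. h * y" "\<lambda>x. a * S (S x)"]
  by (simp add: endo_iff lin S_mult mult.assoc)

lemma lam_S: "lam (S y) = mu y"
  unfolding lam_def mu_def using tr_comp[of S "\<lambda>x. y * S x"]
  by (simp add: endo_iff lin S_mult)

text \<open>
  Start from \<open>h = \<Lambda>\<^sub>1 S(\<Lambda>\<^sub>2) h\<close>, expand the factor \<open>\<Lambda>\<^sub>2\<close> in the basis and move \<open>S(e) h\<close> from the left leg to the right
  one.  The sum over the basis then becomes a trace.
\<close>

lemma dual_bases_mu: "sw \<Lambda> (\<lambda>a b. scale (mu (b * S h)) a) = h"
proof -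
  have "h = sw \<Lambda> (\<lambda>a b. a * S b * h)"
    by (simp add: sw_mult_const_right sw_antipode_right integral_normalized)
  also have "\<dots> = sw \<Lambda> (\<lambda>a b. \<Sum>e\<in>Basis. scale (crd e b) (a * (S e * h)))"
    by (rule sw_cong, subst endo_expand[OF antipode_linear])
       (simp add: sum_distrib_left sum_distrib_right lin mult.assoc)
  also have "\<dots> = (\<Sum>e\<in>Basis. sw \<Lambda> (\<lambda>a b. scale (crd e (b * S (S e * h))) a))"
    unfolding sw_sum
    by (rule sum.cong[OF HOL.refl], rule integral_move_right[OF \<Lambda>_right, of "\<lambda>a b. scale (crd _ b) a"])
       (simp add: linear_simps mult.commute)
  also have "\<dots> = sw \<Lambda> (\<lambda>a b. scale (mu (b * S h)) a)"
    unfolding sw_sum[symmetric] mu_def tr_def by (simp add: scale_sum_left S_mult mult.assoc)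
  finally show ?thesis by simp
qed

lemma dual_bases_lam: "sw \<Lambda> (\<lambda>a b. scale (lam (S h * a)) b) = h"
proof -
  have "h = sw \<Lambda> (\<lambda>a b. h * (S a * b))"
    by (simp add: sw_mult_const sw_antipode_left integral_normalized)
  also have "\<dots> = sw \<Lambda> (\<lambda>a b. \<Sum>e\<in>Basis. scale (crd e a) (h * S e * b))"
    by (rule sw_cong, subst endo_expand[OF antipode_linear])
       (simp add: sum_distrib_left sum_distrib_right lin mult.assoc)
  also have "\<dots> = (\<Sum>e\<in>Basis. sw \<Lambda> (\<lambda>a b. scale (crd e (S (h * S e) * a)) b))"
    unfolding sw_sum
    by (rule sum.cong[OF HOL.refl], rule integral_move_left[OF \<Lambda>_left, of "\<lambda>a b. scale (crd _ a) b"])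
       (simp add: linear_simps mult.commute)
  also have "\<dots> = sw \<Lambda> (\<lambda>a b. scale (lam (S h * a)) b)"
    unfolding sw_sum[symmetric] lam_def tr_def by (simp add: scale_sum_left S_mult mult.assoc)
  finally show ?thesis by simp
qed

lemma S_eq_0_iff: "S h = 0 \<longleftrightarrow> h = 0"
proof
  assume "S h = 0"
  then show "h = 0"
    using dual_bases_mu[of h] by (simp add: form_zero[OF mu_form] sw_def case_prod_unfold)
qed (simp add: endo_zero[OF antipode_linear])

lemma S_inj: "S x = S y \<Longrightarrow> x = y"
  using S_eq_0_iff[of "x - y"] S_add[of "x - y" y] by simp

lemma surj_S: "surj S"
proof (rule linear_inj_imp_surj[OF antipode_linear])
  show "inj S" using S_inj by (rule injI)
qed

lemma scale_add_fun: "scale (c + d) = (\<lambda>x. scale c x + scale d x)"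
  by (rule ext) (rule scale_left_distrib)

text \<open>
  The sum \<open>\<lambda>(h\<^sub>1) h\<^sub>2\<close> is the partial trace of \<open>x \<mapsto> S\<^sup>2(x) h\<^sub>1 \<otimes> h\<^sub>2\<close>.  With \<open>F(x) = S\<^sup>2(x) h\<close> this map equals
  \<open>F(x\<^sub>1)\<^sub>1 \<otimes> S(x\<^sub>2) F(x\<^sub>1)\<^sub>2\<close>.  In the partial trace the first leg is fed back into \<open>x\<close>; cutting the loop at \<open>x\<^sub>1\<close>
  instead turns \<open>x\<^sub>1 \<otimes> x\<^sub>2\<close> into the first two legs of \<open>F(x)\<close>, and the antipode axiom leaves \<open>Tr(F) 1\<close>.
\<close>

lemma lam_integral: "sw h (\<lambda>a b. scale (lam a) b) = scale (lam h) 1"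
proof -
  \<comment> \<open>The operator whose first leg is traced, with the coproduct of \<open>S\<^sup>2(x\<^sub>1) h\<close> made visible; tracing it is done next.\<close>
  have shift: "sw h (\<lambda>h1 h2. scale (crd e (S (S x) * h1)) h2)
      = sw x (\<lambda>x1 x2. sw (S (S x1) * h) (\<lambda>p q. scale (crd e p) (S x2 * q)))" for e x
  proof -
    have "sw x (\<lambda>x1 x2. sw (S (S x1) * h) (\<lambda>p q. scale (crd e p) (S x2 * q)))
      = sw x (\<lambda>x1 x2. sw x1 (\<lambda>a b. sw h (\<lambda>h1 h2. scale (crd e (S (S a) * h1)) (S (S b * x2) * h2))))"
      by (simp add: sw_mult S_anticomult linear_simps S_mult mult.assoc mult.commute)
    also have "\<dots> = sw x (\<lambda>a u. sw u (\<lambda>b x2. sw h (\<lambda>h1 h2. scale (crd e (S (S a) * h1)) (S (S b * x2) * h2))))"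
      by (rule sw_coassoc) (simp add: linear_simps S_mult mult.assoc mult.commute)
    also have "\<dots> = sw x (\<lambda>a u. sw h (\<lambda>h1 h2. scale (crd e (S (S (scale (\<epsilon> u) a)) * h1)) h2))"
      by (rule sw_cong, subst sw_antipode_left'[of "\<lambda>z. sw h (\<lambda>h1 h2. scale (crd e (S (S _) * h1)) (S z * h2))"])
         (simp_all add: linear_simps S_one mult.commute)
    also have "\<dots> = sw h (\<lambda>h1 h2. scale (crd e (S (S x) * h1)) h2)"
      by (subst sw_counit_right'[of "\<lambda>z. sw h (\<lambda>h1 h2. scale (crd e (S (S z) * h1)) h2)"])
         (simp_all add: linear_simps scale_add_fun)
    finally show ?thesis by simp
  qed
  define F where "F x = S (S x) * h" for x
  have F: "F (x + y) = F x + F y" "F (scale c x) = scale c (F x)" for x y c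
    by (simp_all add: F_def lin)
  have "sw h (\<lambda>a b. scale (lam a) b) = (\<Sum>e\<in>Basis. sw e (\<lambda>x1 x2. sw (F x1) (\<lambda>p q. scale (crd e p) (S x2 * q))))"
    unfolding lam_def tr_def F_def by (simp add: scale_sum_left sw_sum shift)
  \<comment> \<open>Cut the loop at \<open>x1\<close>, so that the sum over \<open>e\<close> can be contracted with \<open>p\<close>.\<close>
  also have "\<dots> = (\<Sum>e\<in>Basis. sw e (\<lambda>x1 x2. \<Sum>j\<in>Basis. scale (crd j x1) (sw (F j) (\<lambda>p q. scale (crd e p) (S x2 * q)))))"
    by (rule sum.cong[OF HOL.refl], rule sw_cong,
        rule endo_expand[of "\<lambda>z. sw (F z) (\<lambda>p q. scale (crd _ p) (S _ * q))"])
       (simp add: endo_iff F linear_simps mult.commute flip: sw_scale_right)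
  also have "\<dots> = (\<Sum>j\<in>Basis. sw (F j) (\<lambda>p q. \<Sum>e\<in>Basis. scale (crd e p) (sw e (\<lambda>x1 x2. scale (crd j x1) (S x2 * q)))))"
  proof -
    have "sw e (\<lambda>x1 x2. scale (crd j x1) (sw (F j) (\<lambda>p q. scale (crd e p) (S x2 * q))))
        = sw (F j) (\<lambda>p q. scale (crd e p) (sw e (\<lambda>x1 x2. scale (crd j x1) (S x2 * q))))" for e j
      by (simp only: sw_scale_right[symmetric]) (subst sw_swap, simp add: mult.commute)
    then show ?thesis
      unfolding sw_sum by (subst sum.swap) simp
  qed
  also have "\<dots> = (\<Sum>j\<in>Basis. sw (F j) (\<lambda>p q. sw p (\<lambda>x1 x2. scale (crd j x1) (S x2 * q))))"
    by (rule sum.cong[OF HOL.refl], rule sw_cong,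
        rule endo_expand[of "\<lambda>z. sw z (\<lambda>x1 x2. scale (crd _ x1) (S x2 * _))", symmetric])
       (simp add: endo_iff linear_simps mult.commute flip: sw_scale_right)
  also have "\<dots> = (\<Sum>j\<in>Basis. sw (F j) (\<lambda>x1 u. sw u (\<lambda>x2 q. scale (crd j x1) (S x2 * q))))"
    by (rule sum.cong[OF HOL.refl], rule sw_coassoc) (simp add: linear_simps mult.commute)
  also have "\<dots> = (\<Sum>j\<in>Basis. scale (crd j (F j)) 1)"
  proof (rule sum.cong[OF HOL.refl])
    fix j
    have "sw (F j) (\<lambda>x1 u. sw u (\<lambda>x2 q. scale (crd j x1) (S x2 * q))) = sw (F j) (\<lambda>x1 u. scale (crd j (scale (\<epsilon> u) x1)) 1)"
      by (simp add: sw_scale_right sw_antipode_left crd_scale mult.commute)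
    also have "\<dots> = scale (crd j (F j)) 1"
      by (subst sw_counit_right'[of "\<lambda>z. scale (crd j z) 1"]) (simp_all add: linear_simps)
    finally show "sw (F j) (\<lambda>x1 u. sw u (\<lambda>x2 q. scale (crd j x1) (S x2 * q))) = scale (crd j (F j)) 1" .
  qed
  also have "\<dots> = scale (lam h) 1"
    by (simp add: lam_def tr_def F_def scale_sum_left)
  finally show ?thesis .
qed

lemma mu_integral: "sw h (\<lambda>a b. scale (mu b) a) = scale (mu h) 1"
proof (rule S_inj)
  have "S (sw h (\<lambda>a b. scale (mu b) a)) = sw h (\<lambda>a b. scale (lam (S b)) (S a))"
    by (subst sw_additive) (simp_all add: lin lam_S)
  also have "\<dots> = sw (S h) (\<lambda>a b. scale (lam a) b)"
    by (subst S_anticomult) (simp_all add: linear_simps mult.commute)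
  also have "\<dots> = S (scale (mu h) 1)"
    by (simp add: lam_integral lam_S S_scale S_one)
  finally show "S (sw h (\<lambda>a b. scale (mu b) a)) = S (scale (mu h) 1)" .
qed

lemma form_sw: "form f \<Longrightarrow> f (sw x (\<lambda>a b. scale (c a b) (G a b))) = sw x (\<lambda>a b. c a b * f (G a b))"
  by (subst sw_additive) (simp_all add: form_iff)

text \<open>
  By the dual bases a functional \<open>f\<close> is determined by the element \<open>f(\<Lambda>\<^sub>1) \<Lambda>\<^sub>2\<close>, which for an integral is
  \<open>f(\<Lambda>) 1\<close>.
\<close>

lemma right_integral_unique:
  assumes f: "form f" and int: "\<And>h. sw h (\<lambda>a b. scale (f a) b) = scale (f h) 1"
  shows "f h = f \<Lambda> * lam h"
proof -
  have exp: "p h = mu (sw \<Lambda> (\<lambda>a b. scale (p a) b) * S h)" if p: "form p" for p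
  proof -
    have "p h = sw \<Lambda> (\<lambda>a b. mu (b * S h) * p a)"
      by (subst dual_bases_mu[symmetric]) (rule form_sw[OF p])
    also have "\<dots> = sw \<Lambda> (\<lambda>a b. mu (scale (p a) b * S h))"
      by (simp add: linear_simps mult.commute)
    also have "\<dots> = mu (sw \<Lambda> (\<lambda>a b. scale (p a) b) * S h)"
      by (subst sw_additive[of "\<lambda>z. mu (z * S h)"]) (simp_all add: linear_simps)
    finally show ?thesis .
  qed
  show ?thesis
    using exp[OF f] exp[OF lam_form] by (simp add: int lam_integral linear_simps lam_\<Lambda>)
qed

lemma left_integral_unique:
  assumes f: "form f" and int: "\<And>h. sw h (\<lambda>a b. scale (f b) a) = scale (f h) 1"
  shows "f h = f \<Lambda> * mu h"
proof -
  have exp: "p h = lam (S h * sw \<Lambda> (\<lambda>a b. scale (p b) a))" if p: "form p" for p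
  proof -
    have "p h = sw \<Lambda> (\<lambda>a b. lam (S h * a) * p b)"
      by (subst dual_bases_lam[symmetric]) (rule form_sw[OF p])
    also have "\<dots> = sw \<Lambda> (\<lambda>a b. lam (S h * scale (p b) a))"
      by (simp add: linear_simps mult.commute)
    also have "\<dots> = lam (S h * sw \<Lambda> (\<lambda>a b. scale (p b) a))"
      by (subst sw_additive[of "\<lambda>z. lam (S h * z)"]) (simp_all add: linear_simps)
    finally show ?thesis .
  qed
  show ?thesis
    using exp[OF f] exp[OF mu_form] by (simp add: int mu_integral linear_simps mu_\<Lambda>)
qed

lemma lam_nondegenerate:
  assumes "\<And>a. lam (y * a) = 0"
  shows "y = 0"
proof -
  obtain h where h: "y = S h" using surj_S by blast
  have "h = sw \<Lambda> (\<lambda>a b. scale (lam (S h * a)) b)" using dual_bases_lam by simp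
  also have "\<dots> = 0" using assms by (simp add: h[symmetric]) (simp add: sw_def case_prod_unfold)
  finally show ?thesis by (simp add: h S_eq_0_iff)
qed

section \<open>The distinguished grouplike element\<close>

text \<open>
  The element that relates the two kinds of integrals: \<open>h\<^sub>1 \<lambda>(h\<^sub>2) = \<lambda>(h) g\<close>.
\<close>

definition g :: 'h where "g = sw \<Lambda> (\<lambda>a b. scale (lam b) a)"

text \<open>
  For each functional \<open>p\<close> the functional \<open>p(h\<^sub>1) \<lambda>(h\<^sub>2)\<close> is again a right integral, hence proportional to \<open>\<lambda>\<close>.
\<close>

lemma lam_g: "sw h (\<lambda>a b. scale (lam b) a) = scale (lam h) g"
proof (rule eq_if_forms_eq)
  fix p :: "'h \<Rightarrow> 'k" assume p: "form p"
  have p': "p (x + y) = p x + p y" "p (scale c x) = c * p x" for x y c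
    using p by (simp_all add: form_iff)
  define f where "f h = sw h (\<lambda>a b. p a * lam b)" for h
  have f: "form f"
    by (simp add: form_iff f_def linear_simps p' mult.assoc mult.left_commute)
  have "sw h (\<lambda>a b. scale (f a) b) = scale (f h) 1" for h
  proof -
    have "sw h (\<lambda>a b. scale (f a) b) = sw h (\<lambda>a b. sw a (\<lambda>c d. scale (p c * lam d) b))"
      unfolding f_def by (rule sw_cong, rule sw_additive) (simp add: scale_left_distrib)
    also have "\<dots> = sw h (\<lambda>c u. sw u (\<lambda>d b. scale (p c) (scale (lam d) b)))"
      unfolding scale_scale by (rule sw_coassoc) (simp add: linear_simps p' mult.assoc mult.commute mult.left_commute)
    also have "\<dots> = sw h (\<lambda>c u. scale (p c * lam u) 1)"
      unfolding sw_scale_right lam_integral by simp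
    also have "\<dots> = scale (f h) 1"
      unfolding f_def by (rule sw_additive[symmetric]) (simp add: scale_left_distrib)
    finally show ?thesis .
  qed
  then have "f h = f \<Lambda> * lam h" using right_integral_unique[OF f] by blast
  moreover have "f h = p (sw h (\<lambda>a b. scale (lam b) a))" for h
    unfolding f_def by (simp add: form_sw[OF p] mult.commute)
  ultimately show "p (sw h (\<lambda>a b. scale (lam b) a)) = p (scale (lam h) g)"
    by (simp add: p' g_def mult.commute)
qed

text \<open>
  \<open>\<Delta> x = x \<otimes> x\<close>, tested on pairs of linear forms.  In finite dimension this is equivalent to equality of tensors,
  see \<open>grouplike_sw\<close>, and it avoids quantifying over the target of a balanced map.
\<close>

definition grouplike :: "'h \<Rightarrow> bool" where
  "grouplike x \<longleftrightarrow> \<epsilon> x = 1 \<and> (\<forall>p q. form p \<longrightarrow> form q \<longrightarrow> sw x (\<lambda>a b. p a * q b) = p x * q x)"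

text \<open>
  A Sweedler sum is determined by its values on products of coordinate forms; identities between tensors may
  therefore be checked on pairs of linear forms.
\<close>

lemma sw_expand:
  assumes G: "balanced2 G"
  shows "sw x G = (\<Sum>i\<in>Basis. \<Sum>j\<in>Basis. G (scale (sw x (\<lambda>a b. crd i a * crd j b)) i) j)"
proof -
  have G': "G (a + a') b = G a b + G a' b" "G a (b + b') = G a b + G a b'" "G a (scale c b) = G (scale c a) b" for a a' b b' c
    using G unfolding balanced2_def by metis+
  have G0: "G 0 b = 0" "G a 0 = 0" for a b
    using G'(1)[of 0 0 b] G'(2)[of a 0 0] by simp_all
  have sum1: "G (\<Sum>i\<in>I. f i) b = (\<Sum>i\<in>I. G (f i) b)" for I :: "'h set" and f b
    by (induction I rule: infinite_finite_induct) (simp_all add: G' G0)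
  have sum2: "G a (\<Sum>i\<in>I. f i) = (\<Sum>i\<in>I. G a (f i))" for I :: "'h set" and f a
    by (induction I rule: infinite_finite_induct) (simp_all add: G' G0)
  have exp: "G a b = (\<Sum>i\<in>Basis. \<Sum>j\<in>Basis. G (scale (crd i a * crd j b) i) j)" for a b
  proof -
    have "G a b = G (\<Sum>i\<in>Basis. scale (crd i a) i) (\<Sum>j\<in>Basis. scale (crd j b) j)"
      by (simp only: sum_crd)
    also have "\<dots> = (\<Sum>i\<in>Basis. \<Sum>j\<in>Basis. G (scale (crd i a * crd j b) i) j)"
      by (simp only: sum1) (simp only: sum2 G'(3) scale_scale mult.commute)
    finally show ?thesis .
  qed
  have "sw x G = (\<Sum>i\<in>Basis. \<Sum>j\<in>Basis. sw x (\<lambda>a b. G (scale (crd i a * crd j b) i) j))"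
    unfolding sw_sum[symmetric] by (rule sw_cong) (rule exp)
  also have "\<dots> = (\<Sum>i\<in>Basis. \<Sum>j\<in>Basis. G (scale (sw x (\<lambda>a b. crd i a * crd j b)) i) j)"
    by (subst sw_additive[of "\<lambda>c. G (scale c _) _"]) (simp_all add: scale_left_distrib G')
  finally show ?thesis .
qed

lemma grouplike_sw:
  assumes x: "grouplike x" and G: "balanced2 G"
  shows "sw x G = G x x"
proof -
  have G': "G (a + a') b = G a b + G a' b" "G a (b + b') = G a b + G a b'" "G a (scale c b) = G (scale c a) b" for a a' b b' c
    using G unfolding balanced2_def by metis+
  have G0: "G 0 b = 0" "G a 0 = 0" for a b
    using G'(1)[of 0 0 b] G'(2)[of a 0 0] by simp_all
  have sum1: "G (\<Sum>i\<in>I. f i) b = (\<Sum>i\<in>I. G (f i) b)" for I :: "'h set" and f b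
    by (induction I rule: infinite_finite_induct) (simp_all add: G' G0)
  have sum2: "G a (\<Sum>i\<in>I. f i) = (\<Sum>i\<in>I. G a (f i))" for I :: "'h set" and f a
    by (induction I rule: infinite_finite_induct) (simp_all add: G' G0)
  have "sw x G = (\<Sum>i\<in>Basis. \<Sum>j\<in>Basis. G (scale (crd i x * crd j x) i) j)"
    using x crd_form by (simp add: sw_expand[OF G] grouplike_def)
  also have "\<dots> = (\<Sum>i\<in>Basis. \<Sum>j\<in>Basis. G (scale (crd i x) i) (scale (crd j x) j))"
    by (simp add: G'(3) mult.commute)
  also have "\<dots> = G (\<Sum>i\<in>Basis. scale (crd i x) i) (\<Sum>j\<in>Basis. scale (crd j x) j)"
    by (simp only: sum1) (simp only: sum2)
  finally show ?thesis by (simp only: sum_crd)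
qed

lemma grouplike_g: "grouplike g"
proof -
  have "\<epsilon> g = 1"
  proof -
    have "\<epsilon> g = sw \<Lambda> (\<lambda>a b. lam b * \<epsilon> a)"
      unfolding g_def by (rule form_sw[OF counit_linear])
    also have "\<dots> = lam (sw \<Lambda> (\<lambda>a b. scale (\<epsilon> a) b))"
      by (simp add: form_sw[OF lam_form] mult.commute)
    finally show ?thesis by (simp add: sw_counit_left lam_\<Lambda>)
  qed
  moreover have "sw g (\<lambda>a b. p a * q b) = p g * q g" if p: "form p" and q: "form q" for p q
  proof -
    have p': "p (x + y) = p x + p y" "p (scale c x) = c * p x" for x y c
      using p by (simp_all add: form_iff)
    have q': "q (x + y) = q x + q y" "q (scale c x) = c * q x" for x y c
      using q by (simp_all add: form_iff)
    have "sw g (\<lambda>a b. p a * q b) = sw \<Lambda> (\<lambda>a b. sw (scale (lam b) a) (\<lambda>a b. p a * q b))"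
      unfolding g_def by (rule sw_additive) (simp add: linear_simps p' q')
    also have "\<dots> = sw \<Lambda> (\<lambda>a b. sw a (\<lambda>c d. p c * (lam b * q d)))"
      by (simp add: linear_simps p' q' mult_ac)
    also have "\<dots> = sw \<Lambda> (\<lambda>c u. sw u (\<lambda>d b. p c * (lam b * q d)))"
      by (rule sw_coassoc) (simp add: linear_simps p' q' mult.left_commute)
    also have "\<dots> = sw \<Lambda> (\<lambda>c u. p c * q (scale (lam u) g))"
      by (simp only: lam_g[symmetric] form_sw[OF q] sw_mult_const)
    also have "\<dots> = sw \<Lambda> (\<lambda>c u. lam u * p c) * q g"
      unfolding sw_mult_const_right[symmetric] by (simp add: q' mult_ac)
    also have "\<dots> = p g * q g"
      unfolding g_def form_sw[OF p] ..
    finally show ?thesis .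
  qed
  ultimately show ?thesis by (simp add: grouplike_def)
qed

lemma grouplike_mult:
  assumes x: "grouplike x" and y: "grouplike y"
  shows "grouplike (x * y)"
proof -
  have "sw (x * y) (\<lambda>a b. p a * q b) = p (x * y) * q (x * y)" if p: "form p" and q: "form q" for p q
  proof -
    have p': "p (x + y) = p x + p y" "p (scale c x) = c * p x" for x y c
      using p by (simp_all add: form_iff)
    have q': "q (x + y) = q x + q y" "q (scale c x) = c * q x" for x y c
      using q by (simp_all add: form_iff)
    have "sw (x * y) (\<lambda>a b. p a * q b) = sw x (\<lambda>a b. sw y (\<lambda>c d. p (a * c) * q (b * d)))"
      by (rule sw_mult) (simp add: linear_simps p' q' mult.left_commute)
    also have "\<dots> = sw x (\<lambda>a b. p (a * y) * q (b * y))"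
      by (rule sw_cong, rule grouplike_sw[OF y]) (simp add: linear_simps p' q' mult.left_commute)
    also have "\<dots> = p (x * y) * q (x * y)"
      by (rule grouplike_sw[OF x]) (simp add: linear_simps p' q' mult.left_commute)
    finally show ?thesis .
  qed
  then show ?thesis using x y by (simp add: grouplike_def counit_mult)
qed

lemma grouplike_one: "grouplike 1"
  by (simp add: grouplike_def counit_one sw_one lin form_iff mult.left_commute)

lemma grouplike_inverse:
  assumes "grouplike x"
  shows "x * S x = 1" "S x * x = 1"
proof -
  have "x * S x = scale (\<epsilon> x) 1"
    using sw_antipode_right[of x] by (subst (asm) grouplike_sw[OF assms]) (simp_all add: lin)
  then show "x * S x = 1" using assms by (simp add: grouplike_def)
  have "S x * x = scale (\<epsilon> x) 1"
    using sw_antipode_left[of x] by (subst (asm) grouplike_sw[OF assms]) (simp_all add: lin)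
  then show "S x * x = 1" using assms by (simp add: grouplike_def)
qed

lemma grouplike_S2:
  assumes "grouplike x"
  shows "S (S x) = x"
proof -
  have "S x * S (S x) = 1" using grouplike_inverse(2)[OF assms] by (metis S_mult S_one)
  then show ?thesis using grouplike_inverse(1)[OF assms] by (metis mult.assoc mult.left_neutral mult.right_neutral)
qed

text \<open>
  If \<open>x\<close> is a combination of independent grouplikes \<open>y\<close> with coefficients \<open>c y\<close>, comparing \<open>x \<otimes> x\<close> with \<open>\<Delta> x\<close> gives
  \<open>c y * c z = 0\<close> for \<open>y \<noteq> z\<close> and \<open>c y * c y = c y\<close>, so \<open>x\<close> is one of the \<open>y\<close>.
\<close>

lemma independent_grouplikes:
  assumes "finite X" "\<And>x. x \<in> X \<Longrightarrow> grouplike x"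
  shows "independent X"
  using assms
proof (induction X rule: finite_induct)
  case (insert x X)
  then have X: "independent X" and x: "grouplike x" by auto
  have "x \<notin> span X"
  proof
    assume xs: "x \<in> span X"
    \<comment> \<open>The coordinate forms of a basis containing \<open>X\<close> separate its elements.\<close>
    define E where "E = extend_basis X"
    have E: "X \<subseteq> E" "independent E" "span E = UNIV"
      unfolding E_def using X by (simp_all add: extend_basis_superset independent_extend_basis)
    define p where "p y v = representation E v y" for y v
    have p: "form (p y)" for y
      unfolding form_iff p_def using E by (simp add: representation_add representation_scale)
    have p': "p y (u + v) = p y u + p y v" "p y (scale c u) = c * p y u" for y u v c
      using p by (simp_all add: form_iff)
    have p_X: "p y z = (if z = y then 1 else 0)" if "z \<in> X" for y z
      unfolding p_def using that E representation_basis[OF E(2), of z] by auto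
    define c where "c y = p y x" for y
    have x_eq: "x = (\<Sum>z\<in>X. scale (c z) z)"
    proof -
      have "representation E x = representation X x"
        using E xs by (intro representation_extend) auto
      then show ?thesis
        unfolding c_def p_def using sum_representation_eq[OF X xs insert(1)] by simp
    qed
    have mult: "c y * c z = (if y = z then c y else 0)" if yz: "y \<in> X" "z \<in> X" for y z
    proof -
      have "c y * c z = sw x (\<lambda>a b. p y a * p z b)"
        using x p unfolding grouplike_def c_def by simp
      also have "\<dots> = (\<Sum>w\<in>X. c w * sw w (\<lambda>a b. p y a * p z b))"
        by (subst x_eq, subst form_sum[of "\<lambda>x. sw x _"])
           (simp_all add: form_iff linear_simps p' mult.assoc mult.left_commute)
      also have "\<dots> = (\<Sum>w\<in>X. c w * (p y w * p z w))"
        using insert.prems p by (intro sum.cong) (simp_all add: grouplike_def)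
      also have "\<dots> = (\<Sum>w\<in>X. if w = y then (if y = z then c y else 0) else 0)"
        by (rule sum.cong) (auto simp: p_X)
      also have "\<dots> = (if y = z then c y else 0)"
        using yz insert(1) by simp
      finally show ?thesis .
    qed
    have "x \<noteq> 0" using x form_zero[OF counit_linear] by (auto simp: grouplike_def)
    then obtain y where y: "y \<in> X" "c y \<noteq> 0" using x_eq by (metis (mono_tags, lifting) scale_zero_left sum.neutral)
    have "c z = (if z = y then 1 else 0)" if "z \<in> X" for z
      using mult[of z y] mult[of y y] that y by (auto split: if_splits)
    then have "x = (\<Sum>z\<in>X. if z = y then z else 0)"
      by (subst x_eq, intro sum.cong) auto
    also have "\<dots> = y" using y insert(1) by simp
    finally show False using y insert(2) by simp
  qed
  then show ?case using X insert(2) by (simp add: independent_insert)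
qed (simp add: independent_empty)

lemma grouplike_finite_order:
  assumes x: "grouplike x"
  obtains n where "n > 0" "x ^ n = 1"
proof -
  have pow: "grouplike (x ^ n)" for n
    by (induction n) (simp_all add: grouplike_one grouplike_mult x)
  have "\<not> inj_on (\<lambda>n. x ^ n) {..card Basis}"
  proof
    assume inj: "inj_on (\<lambda>n. x ^ n) {..card Basis}"
    have "independent ((\<lambda>n. x ^ n) ` {..card Basis})"
      by (rule independent_grouplikes) (auto simp: pow)
    then have "card ((\<lambda>n. x ^ n) ` {..card Basis}) \<le> card Basis"
      using independent_span_bound[OF finite_Basis] span_Basis by auto
    then show False using inj by (simp add: card_image)
  qed
  then obtain i j where ij: "x ^ i = x ^ j" "i < j"
    unfolding inj_on_def by (metis linorder_neqE_nat)
  have inv: "S x ^ n * x ^ n = 1" for n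
  proof (induction n)
    case (Suc n)
    have "S x ^ Suc n * x ^ Suc n = S x ^ n * (S x * x) * x ^ n"
      by (simp only: power_Suc2[of "S x"] power_Suc[of x] mult.assoc)
    then show ?case using Suc grouplike_inverse(2)[OF x] by simp
  qed simp
  have "x ^ j = x ^ i * x ^ (j - i)" using ij(2) by (simp flip: power_add)
  then have "S x ^ i * x ^ i = S x ^ i * x ^ i * x ^ (j - i)" using ij(1) by (simp add: mult.assoc)
  then have "x ^ (j - i) = 1" by (simp add: inv)
  then show ?thesis using that ij(2) by (metis zero_less_diff)
qed

text \<open>
  The functional \<open>h \<mapsto> \<lambda>(g h)\<close> is a left integral: multiply \<open>h\<^sub>1 \<lambda>(g h\<^sub>2)\<close> by \<open>S(g) g = 1\<close> and use \<open>lam_g\<close> for \<open>g h\<close>.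
\<close>

lemma mu_eq_lam_g: "mu h = lam (g * h)"
proof -
  have f: "form (\<lambda>h. lam (g * h))" by (simp add: form_iff linear_simps)
  have "sw h (\<lambda>a b. scale (lam (g * b)) a) = scale (lam (g * h)) 1" for h
  proof -
    have "sw h (\<lambda>a b. scale (lam (g * b)) a) = S g * sw h (\<lambda>a b. scale (lam (g * b)) (g * a))"
      by (simp add: sw_mult_const[symmetric] scale_mult_right grouplike_inverse(2)[OF grouplike_g] flip: mult.assoc)
    also have "sw h (\<lambda>a b. scale (lam (g * b)) (g * a)) = sw (g * h) (\<lambda>a b. scale (lam b) a)"
      by (subst sw_mult, simp add: linear_simps mult.commute)
         (subst grouplike_sw[OF grouplike_g], simp_all add: linear_simps mult.commute)
    also have "S g * \<dots> = scale (lam (g * h)) 1"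
      by (simp add: lam_g scale_mult_right grouplike_inverse(2)[OF grouplike_g])
    finally show ?thesis .
  qed
  then have "lam (g * h) = lam (g * \<Lambda>) * mu h" by (rule left_integral_unique[OF f])
  also have "lam (g * \<Lambda>) = 1"
    using grouplike_g by (simp add: \<Lambda>_left lam_scale lam_\<Lambda> grouplike_def)
  finally show ?thesis by simp
qed

text \<open>
  Radford's formula for the fourth power of the antipode, in the unimodular case.  The functional
  \<open>a \<mapsto> \<mu>(h a) = \<lambda>(g h a)\<close> can be rewritten with the twisted commutation rule of \<open>\<mu>\<close> and then with that of
  \<open>\<lambda>\<close>.
\<close>

lemma S4_conjugation: "S (S (S (S h))) * g = g * h"
proof -
  have "lam ((g * h - S (S (S (S h))) * g) * a) = 0" for a
  proof -
    have "lam (g * h * a) = mu (h * a)" by (simp add: mu_eq_lam_g mult.assoc)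
    also have "\<dots> = lam (g * a * S (S h))" using mu_nakayama[of h a] by (simp add: mu_eq_lam_g mult.assoc)
    also have "\<dots> = lam (S (S (S (S h))) * g * a)" using lam_nakayama[of "g * a" "S (S h)"] by (simp add: mult.assoc)
    finally have "lam (g * h * a) = lam (S (S (S (S h))) * g * a)" .
    then show ?thesis
      using lam_add[of "(g * h - S (S (S (S h))) * g) * a" "S (S (S (S h))) * g * a"] by (simp add: algebra_simps)
  qed
  then show ?thesis using lam_nondegenerate[of "g * h - S (S (S (S h))) * g"] by simp
qed

lemma g_eq_one:
  assumes "lam 1 \<noteq> 0"
  shows "g = 1"
proof -
  have "scale (lam 1) (g - 1) = 0"
    using lam_g[of 1] by (subst (asm) sw_one) (simp_all add: linear_simps mult.commute scale_right_diff_distrib)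
  then show ?thesis using assms by simp
qed

end

section \<open>The trace of the squared antipode is nonzero\<close>

locale semisimple_hopf_closed = semisimple_hopf scale \<Delta> \<epsilon> S Basis \<Lambda>
  for scale :: "'k::{alg_closed_field, field_char_0} \<Rightarrow> 'h::ring_1 \<Rightarrow> 'h"
    and \<Delta> :: "'h \<Rightarrow> ('h \<times> 'h) multiset"
    and \<epsilon> :: "'h \<Rightarrow> 'k"
    and S :: "'h \<Rightarrow> 'h"
    and Basis :: "'h set"
    and \<Lambda> :: 'h
begin

definition chi :: "'h \<Rightarrow> 'k" where "chi h = tr (\<lambda>x. h * x)"

text \<open>
  By \<open>S2_u\<close> this element implements \<open>S\<^sup>2\<close> by conjugation once it is invertible, and by \<open>chi_eq_lam\<close> it is the density
  of the regular character with respect to \<open>\<lambda>\<close>.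
\<close>

definition u :: 'h where "u = sw \<Lambda> (\<lambda>a b. S (S a) * S b)"

lemma chi_add: "chi (x + y) = chi x + chi y" and chi_scale: "chi (scale c x) = c * chi x"
  by (simp_all add: chi_def lin tr_add tr_scale)

lemma chi_form: "form chi"
  by (simp add: form_iff chi_add chi_scale)

lemma tr_mult: "tr (\<lambda>x. a * (b * x)) = chi (a * b)"
  by (simp add: chi_def tr_def mult.assoc)

lemma tr_sw: "tr (\<lambda>x. sw t (\<lambda>a b. F a b x)) = sw t (\<lambda>a b. tr (F a b))"
  unfolding tr_def sw_sum by (subst sw_additive[of "crd _"]) (simp_all add: crd_add)

lemma S2_u: "S (S a) * u = u * a"
proof -
  obtain b where b: "a = S b" using surj_S by blast
  have "S (S (S b)) * u = sw \<Lambda> (\<lambda>x y. S (S (S b * x)) * S y)"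
    by (simp add: u_def S_mult mult.assoc flip: sw_mult_const)
  also have "\<dots> = sw \<Lambda> (\<lambda>x y. S (S x) * S (b * y))"
    by (rule integral_move_left[OF \<Lambda>_left, of "\<lambda>x y. S (S x) * S y", symmetric]) (simp add: linear_simps)
  also have "\<dots> = u * S b"
    by (simp add: u_def S_mult mult.assoc flip: sw_mult_const_right)
  finally show ?thesis unfolding b .
qed

text \<open>
  Compute the trace of left multiplication by \<open>h\<close> in the dual bases given by \<open>\<Lambda>\<close> and \<open>\<mu>\<close>.
\<close>

lemma chi_eq_lam: "chi h = lam (u * h)"
proof -
  have "chi h = tr (\<lambda>x. sw \<Lambda> (\<lambda>a b. scale (mu (b * S x)) (h * a)))"
  proof -
    have exp: "h * x = sw \<Lambda> (\<lambda>a b. scale (mu (b * S x)) (h * a))" for x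
      by (subst dual_bases_mu[of x, symmetric]) (simp add: scale_mult_right flip: sw_mult_const)
    show ?thesis unfolding chi_def by (rule arg_cong[of _ _ tr], rule ext, rule exp)
  qed
  also have "\<dots> = sw \<Lambda> (\<lambda>a b. mu (b * S (h * a)))"
    unfolding tr_sw by (rule sw_cong, rule tr_rank_one) (simp add: form_iff linear_simps)
  also have "\<dots> = sw \<Lambda> (\<lambda>a b. lam (S (S h) * (S (S a) * S b)))"
    by (simp add: S_mult mult.assoc flip: lam_S)
  also have "\<dots> = lam (S (S h) * u)"
    by (simp add: u_def sw_additive[of "\<lambda>x. lam (_ * x)"] linear_simps)
  also have "\<dots> = lam (u * h)" by (rule lam_nakayama[symmetric])
  finally show ?thesis .
qed

lemma left_mult_idempotent_trace:
  assumes "e * e = e"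
  shows "\<exists>n. chi e = of_nat n \<and> (n = 0 \<longrightarrow> e = 0)"
proof -
  have "\<exists>n. (\<Sum>i\<in>Basis. crd i (e * i)) = of_nat n \<and> (n = 0 \<longrightarrow> (\<forall>v. e * v = 0))"
    using trace_idempotent[of Basis "\<lambda>v. e * v" crd "\<lambda>b. b"] assms
    by (simp add: finite_Basis endo_iff lin crd_form sum_crd flip: mult.assoc)
  then show ?thesis unfolding chi_def tr_def by (metis mult.right_neutral)
qed

text \<open>
  The right annihilator of \<open>u\<close> is a left ideal because \<open>u a = S\<^sup>2(a) u\<close>, so it contains a right identity \<open>e\<close>.  But
  \<open>\<chi>(e) = \<lambda>(u e) = 0\<close>, and in characteristic 0 an idempotent of trace 0 vanishes.
\<close>

lemma u_invertible: "\<exists>w. u * w = 1 \<and> w * u = 1"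
proof -
  define I where "I = {h. u * h = 0}"
  have "left_ideal I"
    unfolding left_ideal_def I_def
    by (auto simp: distrib_left) (metis S2_u mult.assoc mult_zero_right)
  then obtain e where e: "e \<in> I" "\<And>x. x \<in> I \<Longrightarrow> x * e = x"
    by (rule semisimple_left_ideal_idempotent[OF semisimple]) (rule that)
  have "chi e = 0" using e(1) by (simp add: chi_eq_lam I_def form_zero[OF lam_form])
  then have "e = 0" using left_mult_idempotent_trace[of e] e by auto
  then have inj: "h = 0" if "u * h = 0" for h using e(2)[of h] that by (simp add: I_def)
  have lin_u: "endo (\<lambda>h. u * h)" by (simp add: endo_iff lin)
  have "inj (\<lambda>h. u * h)"
    using inj by (intro injI) (metis eq_iff_diff_eq_0 right_diff_distrib)
  then have "surj (\<lambda>h. u * h)" by (rule linear_inj_imp_surj[OF lin_u])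
  then obtain w where w: "u * w = 1" by (metis surj_def)
  have "u * (w * u - 1) = 0" using w by (simp add: right_diff_distrib flip: mult.assoc)
  then have "w * u = 1" using inj by fastforce
  then show ?thesis using w by blast
qed

definition w :: 'h where "w = (SOME w. u * w = 1 \<and> w * u = 1)"

lemma u_w: "u * w = 1" and w_u: "w * u = 1"
  using someI_ex[OF u_invertible] by (simp_all add: w_def)

lemma w_u': "w * (u * x) = x" and u_w': "u * (w * x) = x"
  by (simp_all add: w_u u_w flip: mult.assoc)

lemma S2_eq: "S (S a) = u * (a * w)"
  using S2_u[of a] u_w by (metis mult.assoc mult.right_neutral)

lemma w_commute: "a * w = w * S (S a)"
  by (simp add: S2_eq w_u')

lemma lam_eq_chi: "lam h = chi (w * h)"
  by (simp add: chi_eq_lam u_w')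

lemma mu_eq_chi: "mu h = chi (w * (g * h))"
  by (simp add: mu_eq_lam_g lam_eq_chi)

lemma g_w: "g * w = w * g"
  by (simp add: w_commute grouplike_S2[OF grouplike_g])

text \<open>
  \<open>w\<close> is the density of \<open>\<lambda>\<close> and \<open>w g\<close> that of \<open>\<mu>\<close> with respect to the regular character; \<open>z\<close> is the product of the
  two densities.  On a simple block of dimension \<open>d\<^sup>2\<close> on which \<open>S\<^sup>2\<close> is conjugation by \<open>v\<close> it is the scalar
  \<open>tr(v) tr(v\<^sup>-\<^sup>1) / d\<^sup>2\<close>.
\<close>

definition z :: 'h where "z = w * (w * g)"

lemma z_central: "a * z = z * a"
proof -
  have "a * z = w * (w * (S (S (S (S a))) * g))"
    unfolding z_def by (metis w_commute mult.assoc)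
  then show ?thesis by (simp add: S4_conjugation z_def mult.assoc)
qed

text \<open>
  On a central element \<open>c\<close> the functionals \<open>\<lambda>\<close> and \<open>\<mu>\<close> agree, since left and right multiplication by \<open>c\<close> coincide.
  Moreover \<open>\<lambda>(w g c)\<close> is the trace of \<open>x \<mapsto> u x w w g c = u x z c\<close>, and as \<open>z c\<close> is central this is
  left multiplication by \<open>u z c = w g c\<close>.
\<close>

lemma chi_central:
  assumes c: "\<And>a. a * c = c * a"
  shows "chi (w * (g * c)) = chi (w * c)" "chi (z * c) = chi (w * c)"
proof -
  have "mu c = lam c" by (simp add: mu_def lam_def c)
  then show 1: "chi (w * (g * c)) = chi (w * c)" by (simp add: mu_eq_chi lam_eq_chi)
  have "chi (z * c) = lam (w * (g * c))" by (simp add: lam_eq_chi z_def mult.assoc)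
  also have "\<dots> = chi (w * (g * c))"
  proof -
    have "u * (x * w) * (w * (g * c)) = w * (g * c) * x" for x
    proof -
      have "u * (x * w) * (w * (g * c)) = u * (x * z * c)" by (simp add: z_def mult.assoc)
      also have "\<dots> = u * (z * c * x)" by (metis z_central c mult.assoc)
      also have "\<dots> = w * (g * c) * x" by (simp add: z_def mult.assoc u_w')
      finally show ?thesis .
    qed
    then show ?thesis unfolding lam_def chi_def S2_eq by simp
  qed
  finally show "chi (z * c) = chi (w * c)" using 1 by simp
qed

text \<open>
  With \<open>c = s\<^sup>2\<close>, the operator \<open>D = w E / s\<close> satisfies \<open>D\<^sup>2\<^sup>n = E\<close> because \<open>z\<^sup>n = w\<^sup>2\<^sup>n g\<^sup>n\<close>, and \<open>D\<^sup>2\<^sup>n\<^sup>-\<^sup>1 = w g E / s\<close> because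
  \<open>w w g = z\<close>.  By \<open>chi_central\<close> both have trace \<open>c \<chi>(E) / s = s \<chi>(E)\<close>, so
  \<open>\<chi>(z E) = c \<chi>(E)\<close> is the product of the two traces divided by the natural number \<open>\<chi>(E)\<close>.
\<close>

lemma central_block_trace:
  assumes E: "\<And>a. a * E = E * a" "E * E = E" and zE: "z * E = scale c E"
    and n: "n > 0" "g ^ n = 1" and prim: "primitive_root_of_unity (2 * n) \<omega>"
  shows "\<exists>(d :: nat \<Rightarrow> nat) k. chi (z * E) =
    (\<Sum>j<2*n. of_nat (d j) * \<omega> ^ (j * 1)) * (\<Sum>j<2*n. of_nat (d j) * \<omega> ^ (j * (2*n - 1))) / of_nat k"
proof (cases "c = 0")
  case True
  then show ?thesis using form_zero[OF chi_form] by (intro exI[of _ "\<lambda>_. 0"]) (simp add: zE)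
next
  case False
  obtain s where s: "s ^ 2 = c" using nth_root_exists[of 2 c] by auto
  have s0: "s \<noteq> 0" using s False by auto
  define D where "D x = scale (1 / s) (w * (E * x))" for x
  have EE: "E * (E * x) = E * x" for x using E(2) by (simp flip: mult.assoc)
  have Ec: "E * (y * x) = y * (E * x)" for x y
    by (simp only: mult.assoc[symmetric] E(1))
  have D_pow: "(D ^^ Suc i) x = scale (1 / s ^ Suc i) (w ^ Suc i * (E * x))" for i x
  proof (induction i)
    case (Suc i)
    have "E * (w ^ Suc i * (E * x)) = w ^ Suc i * (E * x)"
      by (simp only: Ec[of "w ^ Suc i"] EE)
    then show ?case using Suc by (simp add: D_def lin mult.assoc)
  qed (simp add: D_def)
  have z_pow: "z ^ i = w ^ (2 * i) * g ^ i" for i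
  proof (induction i)
    case (Suc i)
    have comm: "w ^ (2 * i) * g = g * w ^ (2 * i)"
      by (rule power_commuting_commutes) (rule g_w[symmetric])
    have "z ^ Suc i = w * (w * (g * w ^ (2 * i))) * g ^ i"
      using Suc by (simp add: z_def mult.assoc)
    also have "\<dots> = w * (w * w ^ (2 * i)) * (g * g ^ i)"
      by (simp only: comm[symmetric] mult.assoc)
    finally show ?case by (simp add: mult.assoc)
  qed simp
  have z_pow_E: "z ^ i * (E * x) = scale (c ^ i) (E * x)" for i x
  proof (induction i)
    case (Suc i)
    have "z ^ Suc i * (E * x) = z ^ i * ((z * E) * x)"
      by (simp only: power_Suc2 mult.assoc)
    then show ?case using Suc by (simp add: zE lin mult.commute)
  qed simp
  have w_pow: "w ^ (2 * n) * (E * x) = scale (c ^ n) (E * x)" for x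
    using z_pow[of n] z_pow_E[of n x] n by simp
  have s_pow: "s ^ (2 * i) = c ^ i" for i using s by (simp add: power_mult)
  have D_M: "(D ^^ (2 * n)) x = E * x" for x
    using D_pow[of "2 * n - 1" x] n False by (simp add: w_pow s_pow)
  have w_pow': "w ^ (2 * n - 1) * (E * x) = scale (c ^ (n - 1)) (w * (g * (E * x)))" for x
  proof -
    have "scale c (w ^ (2 * n - 1) * (E * x)) = w ^ (2 * n - 1) * ((z * E) * x)"
      by (simp add: zE lin)
    also have "\<dots> = w ^ Suc (2 * n - 1) * (w * (g * (E * x)))"
      by (simp only: z_def power_Suc2 mult.assoc)
    also have "\<dots> = w ^ (2 * n) * (E * (w * (g * x)))"
      using n by (simp add: Ec[of w] Ec[of g])
    also have "\<dots> = scale (c ^ n) (w * (g * (E * x)))"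
      unfolding w_pow by (simp add: Ec[of w] Ec[of g])
    also have "\<dots> = scale c (scale (c ^ (n - 1)) (w * (g * (E * x))))"
      using n by (simp add: power_eq_if)
    finally show ?thesis using False by (simp only: scale_cancel_left simp_thms)
  qed
  have tr_D: "tr D = s * chi E"
  proof -
    have "tr D = chi (w * E) / s"
      unfolding D_def[abs_def] tr_scale tr_mult by simp
    also have "chi (w * E) = s * s * chi E"
      using chi_central(2)[OF E(1)] by (simp add: zE chi_scale power2_eq_square flip: s)
    finally show ?thesis using s0 by simp
  qed
  have tr_D': "tr (D ^^ (2 * n - 1)) = s * chi E"
  proof -
    define r where "r = 2 * (n - 1)"
    have r: "2 * n - 1 = Suc r" using n by (simp add: r_def)
    have s_r: "s ^ Suc r = s * c ^ (n - 1)" using s_pow by (simp add: r_def)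
    have D_eq: "(D ^^ (2 * n - 1)) x = scale (1 / s) (w * (g * E) * x)" for x
    proof -
      have "(D ^^ (2 * n - 1)) x = scale (1 / s ^ Suc r) (w ^ (2 * n - 1) * (E * x))"
        unfolding r by (rule D_pow)
      also have "\<dots> = scale (c ^ (n - 1) / s ^ Suc r) (w * (g * (E * x)))"
        unfolding w_pow' by simp
      also have "c ^ (n - 1) / s ^ Suc r = 1 / s"
        unfolding s_r using False by simp
      finally show ?thesis by (simp add: mult.assoc)
    qed
    have "tr (D ^^ (2 * n - 1)) = chi (w * (g * E)) / s"
      unfolding chi_def tr_def D_eq by (simp add: crd_scale sum_divide_distrib)
    also have "chi (w * (g * E)) = s * s * chi E"
      using chi_central[OF E(1)] by (simp add: zE chi_scale power2_eq_square flip: s)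
    finally show ?thesis using s0 by simp
  qed
  have "\<exists>d :: nat \<Rightarrow> nat. \<forall>k\<in>{1..2*n}. (\<Sum>i\<in>Basis. crd i ((D ^^ k) i)) = (\<Sum>j<2*n. of_nat (d j) * \<omega> ^ (j * k))"
  proof (rule trace_powers_finite_order[OF finite_Basis _ crd_form _ prim, of D "\<lambda>b. b"])
    show "endo D" by (simp add: endo_iff D_def lin mult.commute)
    show "D v = (\<Sum>i\<in>Basis. scale (crd i (D v)) i)" for v by (simp add: sum_crd)
    show "0 < 2 * n" using n by simp
    show "(D ^^ Suc (2 * n)) v = D v" for v using D_M EE by (simp add: D_def)
  qed
  then obtain d :: "nat \<Rightarrow> nat" where d: "\<And>k. k \<in> {1..2*n} \<Longrightarrow> tr (D ^^ k) = (\<Sum>j<2*n. of_nat (d j) * \<omega> ^ (j * k))"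
    unfolding tr_def by blast
  have chi_E: "chi E = of_nat (\<Sum>j<2*n. d j)"
  proof -
    have "chi E = tr (D ^^ (2 * n))" using D_M by (simp add: chi_def tr_def)
    also have "\<dots> = (\<Sum>j<2*n. of_nat (d j) * \<omega> ^ (j * (2 * n)))" using d n by simp
    also have "\<dots> = (\<Sum>j<2*n. of_nat (d j))"
    proof (rule sum.cong[OF HOL.refl])
      fix j
      have "\<omega> ^ (j * (2 * n)) = 1"
        using prim by (metis primitive_root_of_unity_def mult.commute power_mult power_one)
      then show "of_nat (d j) * \<omega> ^ (j * (2 * n)) = of_nat (d j)" by simp
    qed
    finally show ?thesis by simp
  qed
  have "chi (z * E) = (s * chi E) * (s * chi E) / chi E"
    by (simp add: zE chi_scale s[symmetric] power2_eq_square)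
  also have "\<dots> = (\<Sum>j<2*n. of_nat (d j) * \<omega> ^ (j * 1)) * (\<Sum>j<2*n. of_nat (d j) * \<omega> ^ (j * (2*n - 1)))
      / of_nat (\<Sum>j<2*n. d j)"
  proof -
    have "s * chi E = (\<Sum>j<2*n. of_nat (d j) * \<omega> ^ (j * 1))"
      using d[of 1] n tr_D by simp
    moreover have "s * chi E = (\<Sum>j<2*n. of_nat (d j) * \<omega> ^ (j * (2 * n - 1)))"
      using d[of "2 * n - 1"] n tr_D' by simp
    ultimately show ?thesis by (simp only: chi_E)
  qed
  finally show ?thesis by blast
qed

text \<open>
  A semisimple ring has no nonzero central nilpotents.
\<close>

lemma central_reduced:
  fixes y v :: 'h
  assumes y: "\<And>a. a * y = y * a" and yyv: "y * (y * v) = 0"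
  shows "y * v = 0"
proof -
  have I: "left_ideal (range (\<lambda>r. r * (y * v)))"
    unfolding left_ideal_def
  proof (intro conjI ballI allI)
    show "0 \<in> range (\<lambda>r. r * (y * v))" by (rule range_eqI[of _ _ 0]) simp
    show "a + b \<in> range (\<lambda>r. r * (y * v))"
      if ab: "a \<in> range (\<lambda>r. r * (y * v))" "b \<in> range (\<lambda>r. r * (y * v))" for a b
      using ab by (auto simp flip: distrib_right)
    show "r * a \<in> range (\<lambda>r. r * (y * v))" if "a \<in> range (\<lambda>r. r * (y * v))" for r a
      using that by (auto simp flip: mult.assoc)
  qed
  obtain e where e: "e \<in> range (\<lambda>r. r * (y * v))" "\<And>x. x \<in> range (\<lambda>r. r * (y * v)) \<Longrightarrow> x * e = x"
    by (rule semisimple_left_ideal_idempotent[OF semisimple I]) (rule that)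
  obtain r where r: "e = r * (y * v)" using e(1) by blast
  have "y * v \<in> range (\<lambda>r. r * (y * v))" by (rule range_eqI[of _ _ 1]) simp
  \<comment> \<open>Since \<open>y\<close> is central, both of its occurrences can be collected in front of \<open>v\<close>.\<close>
  then have "y * v = y * (v * r * y) * v" using e(2)[of "y * v"] by (simp add: r mult.assoc)
  also have "\<dots> = y * (y * v) * (r * v)" by (simp only: y mult.assoc)
  finally show ?thesis by (simp add: yyv)
qed

definition decomposable :: "'h \<Rightarrow> bool" where
  "decomposable v \<longleftrightarrow> (\<exists>C f. finite C \<and> v = (\<Sum>c\<in>C. f c) \<and> (\<forall>c\<in>C. z * f c = scale c (f c)))"

text \<open>
  The value of the polynomial \<open>p\<close> at \<open>z\<close>, applied to \<open>v\<close>.  Evaluation by \<open>poly\<close> is unsuitable, as the coefficients act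
  by \<open>scale\<close> and \<open>H\<close> is not commutative.
\<close>

definition z_eval :: "'k poly \<Rightarrow> 'h \<Rightarrow> 'h" where
  "z_eval p v = (\<Sum>i\<le>degree p. scale (coeff p i) (z ^ i * v))"

lemma z_eval_eq: "degree p \<le> n \<Longrightarrow> z_eval p v = (\<Sum>i\<le>n. scale (coeff p i) (z ^ i * v))"
  unfolding z_eval_def by (rule sum.mono_neutral_left) (auto simp: coeff_eq_0)

lemma z_eval_add: "z_eval (p + q) v = z_eval p v + z_eval q v"
proof -
  define n where "n = max (degree p) (degree q)"
  have "degree p \<le> n" "degree q \<le> n" "degree (p + q) \<le> n"
    unfolding n_def by (simp_all add: degree_add_le)
  then show ?thesis by (simp add: z_eval_eq[of _ n] scale_left_distrib sum.distrib)
qed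

lemma z_eval_smult: "z_eval (smult c p) v = scale c (z_eval p v)"
  by (simp add: z_eval_eq[of _ "degree p"] scale_sum_right degree_smult_le)

lemma z_eval_pCons_0: "z_eval (pCons 0 p) v = z_eval p (z * v)"
proof -
  have "z_eval (pCons 0 p) v = (\<Sum>i\<le>Suc (degree p). scale (coeff (pCons 0 p) i) (z ^ i * v))"
    by (rule z_eval_eq) (simp add: degree_pCons_le)
  also have "\<dots> = (\<Sum>i\<le>degree p. scale (coeff p i) (z ^ i * (z * v)))"
    by (subst sum.atMost_Suc_shift) (simp add: mult.assoc power_Suc2 del: power_Suc)
  finally show ?thesis by (simp add: z_eval_def)
qed

lemma z_eval_linear_factor: "z_eval ([:- c, 1:] * q) v = z_eval q (z * v - scale c v)"
proof -
  have "[:- c, 1:] * q = pCons 0 q + smult (- c) q" by simp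
  then show ?thesis
    by (simp only: z_eval_add z_eval_smult z_eval_pCons_0)
       (simp add: z_eval_def right_diff_distrib scale_mult_right scale_right_diff_distrib sum_subtractf sum_negf scale_sum_right mult.commute)
qed

text \<open>
  Induction on the degree.  If \<open>c\<^sub>0\<close> is a root of \<open>p\<close>, the vector \<open>(z - c\<^sub>0) v\<close> is annihilated by a polynomial of smaller degree
  and so is a sum of eigenvectors \<open>f c\<close>.  Subtracting \<open>f c / (c - c\<^sub>0)\<close> for \<open>c \<noteq> c\<^sub>0\<close> from \<open>v\<close> leaves \<open>v'\<close> with
  \<open>(z - c\<^sub>0)\<^sup>2 v' = 0\<close>; \<open>central_reduced\<close> excludes a nontrivial Jordan block.
\<close>

lemma decomposable_if_z_eval:
  "p \<noteq> 0 \<Longrightarrow> z_eval p v = 0 \<Longrightarrow> decomposable v"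
proof (induction "degree p" arbitrary: p v)
  case 0
  then obtain a where "p = [:a:]" "a \<noteq> 0" by (metis degree_eq_zeroE pCons_0_0)
  then have "v = 0" using 0 by (simp add: z_eval_def)
  then show ?case unfolding decomposable_def by (intro exI[of _ "{}"]) simp
next
  case (Suc n)
  then obtain c0 where "poly p c0 = 0" using alg_closed_imp_poly_has_root[of p] by auto
  then obtain q where q: "p = [:- c0, 1:] * q" by (auto simp: poly_eq_0_iff_dvd)
  have q0: "q \<noteq> 0" using q Suc.prems by auto
  define x where "x = z * v - scale c0 v"
  have "degree p = Suc (degree q)" unfolding q using q0 by (subst degree_mult_eq) simp_all
  then have "decomposable x"
    using Suc.hyps Suc.prems q0 unfolding x_def by (metis Suc_inject q z_eval_linear_factor)
  then obtain C f where C: "finite C" "x = (\<Sum>c\<in>C. f c)" "\<And>c. c \<in> C \<Longrightarrow> z * f c = scale c (f c)"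
    unfolding decomposable_def by blast
  define y where "y = z - scale c0 1"
  have y_eq: "y * a = z * a - scale c0 a" for a by (simp add: y_def left_diff_distrib scale_mult_left)
  have y_central: "a * y = y * a" for a
    by (simp add: y_def left_diff_distrib right_diff_distrib scale_mult_left scale_mult_right z_central)
  define v' where "v' = v - (\<Sum>c\<in>C - {c0}. scale (1 / (c - c0)) (f c))"
  have "y * scale (1 / (c - c0)) (f c) = f c" if "c \<in> C - {c0}" for c
  proof -
    have "y * scale (1 / (c - c0)) (f c) = scale (1 / (c - c0)) (scale (c - c0) (f c))"
      using that C(3) by (simp add: y_eq scale_mult_right scale_right_diff_distrib scale_left_diff_distrib mult.commute)
    then show ?thesis using that by simp
  qed
  then have "y * v' = x - (\<Sum>c\<in>C - {c0}. f c)"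
    by (simp add: v'_def right_diff_distrib sum_distrib_left) (simp add: y_eq x_def)
  also have "\<dots> = (if c0 \<in> C then f c0 else 0)"
    using C(1) by (auto simp: C(2) sum.remove)
  finally have yv': "y * v' = (if c0 \<in> C then f c0 else 0)" .
  have "y * (y * v') = 0" unfolding yv' using C(3) by (simp add: y_eq)
  then have "y * v' = 0" by (rule central_reduced[OF y_central])
  then have v': "z * v' = scale c0 v'" by (simp add: y_eq)
  define f' where "f' c = (if c = c0 then v' else scale (1 / (c - c0)) (f c))" for c
  have "v = (\<Sum>c\<in>insert c0 (C - {c0}). f' c)"
  proof -
    have "(\<Sum>c\<in>insert c0 (C - {c0}). f' c) = v' + (\<Sum>c\<in>C - {c0}. f' c)"
      using C(1) by (subst sum.insert) (simp_all add: f'_def)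
    also have "(\<Sum>c\<in>C - {c0}. f' c) = (\<Sum>c\<in>C - {c0}. scale (1 / (c - c0)) (f c))"
      by (rule sum.cong) (auto simp: f'_def)
    finally show ?thesis by (simp add: v'_def)
  qed
  moreover have "\<forall>c\<in>insert c0 (C - {c0}). z * f' c = scale c (f' c)"
    using v' C(3) by (auto simp: f'_def scale_mult_right mult.commute)
  moreover have "finite (insert c0 (C - {c0}))" using C(1) by simp
  ultimately show ?case
    unfolding decomposable_def by (intro exI[of _ "insert c0 (C - {c0})"] exI[of _ f'] conjI)
qed

lemma z_annihilator: "\<exists>p. p \<noteq> 0 \<and> z_eval p 1 = 0"
proof (cases "inj_on (\<lambda>i. z ^ i) {..card Basis}")
  case False
  then obtain i j where ij: "i \<noteq> j" "z ^ i = z ^ j" unfolding inj_on_def by blast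
  define p where "p = monom (1 :: 'k) i - monom 1 j"
  have "coeff p i = 1" using ij by (simp add: p_def)
  then have "p \<noteq> 0" by auto
  moreover have "z_eval p 1 = 0"
  proof -
    have ev: "z_eval (monom 1 k) 1 = z ^ k" for k
      by (simp add: z_eval_def degree_monom_eq if_distrib[of "\<lambda>c. scale c _"] cong: if_cong)
    have "p = monom 1 i + smult (- 1) (monom 1 j)" by (simp add: p_def)
    then show ?thesis by (simp only: z_eval_add z_eval_smult ev) (simp add: ij)
  qed
  ultimately show ?thesis by blast
next
  case True
  have "dependent ((\<lambda>i. z ^ i) ` {..card Basis})"
  proof (rule ccontr)
    assume "independent ((\<lambda>i. z ^ i) ` {..card Basis})"
    then have "card ((\<lambda>i. z ^ i) ` {..card Basis}) \<le> card Basis"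
      using independent_span_bound[OF finite_Basis] span_Basis by auto
    then show False using True by (simp add: card_image)
  qed
  then obtain a v where a: "v \<in> (\<lambda>i. z ^ i) ` {..card Basis}" "a v \<noteq> 0"
    "(\<Sum>v\<in>(\<lambda>i. z ^ i) ` {..card Basis}. scale (a v) v) = 0"
    using dependent_finite[of "(\<lambda>i. z ^ i) ` {..card Basis}"] by auto
  define p where "p = (\<Sum>i\<le>card Basis. monom (a (z ^ i)) i)"
  have cf: "coeff p i = (if i \<le> card Basis then a (z ^ i) else 0)" for i
    by (simp add: p_def coeff_sum)
  obtain i where "i \<le> card Basis" "a (z ^ i) \<noteq> 0" using a(1,2) by blast
  then have "coeff p i \<noteq> 0" by (simp add: cf)
  then have "p \<noteq> 0" by auto
  moreover have "z_eval p 1 = 0"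
  proof -
    have "degree p \<le> card Basis" by (rule degree_le) (simp add: cf)
    then have "z_eval p 1 = (\<Sum>i\<le>card Basis. scale (a (z ^ i)) (z ^ i))"
      by (simp add: z_eval_eq cf)
    then show ?thesis using a(3) True by (simp add: sum.reindex)
  qed
  ultimately show ?thesis by blast
qed

lemma eigenvectors_independent:
  assumes "finite C" "\<And>c. c \<in> C \<Longrightarrow> z * x c = scale c (x c)" "(\<Sum>c\<in>C. x c) = 0" "c \<in> C"
  shows "x c = 0"
  using assms
proof (induction C arbitrary: x c rule: finite_induct)
  case (insert c0 C)
  define y where "y c = scale (c - c0) (x c)" for c
  have x0: "x c0 = - (\<Sum>c\<in>C. x c)" using insert by (simp add: eq_neg_iff_add_eq_0)
  have "(\<Sum>c\<in>C. y c) = z * (\<Sum>c\<in>C. x c) - scale c0 (\<Sum>c\<in>C. x c)"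
    unfolding y_def sum_distrib_left scale_sum_right sum_subtractf[symmetric]
    using insert.prems(1) by (intro sum.cong) (simp_all add: scale_left_diff_distrib)
  also have "\<dots> = - (z * x c0 - scale c0 (x c0))" by (simp add: x0 scale_minus_right)
  also have "\<dots> = 0" using insert.prems(1) by simp
  finally have "y c = 0" if "c \<in> C" for c
    using insert.IH[of y c] insert.prems(1) that by (simp add: y_def scale_mult_right mult.commute)
  then have C0: "x c = 0" if "c \<in> C" for c using that insert.hyps(2) by (auto simp: y_def)
  then have "x c0 = 0" by (simp add: x0)
  then show ?case using C0 insert.prems(3) by blast
qed simp

text \<open>
  The components \<open>E c\<close> of 1 are the block idempotents: uniqueness of the decomposition into eigenvectors, applied to
  \<open>a = a 1 = 1 a\<close> and to \<open>E d = 1 (E d)\<close>, makes them central and idempotent.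
\<close>

lemma central_blocks:
  obtains C E where "finite C" "(\<Sum>c\<in>C. E c) = 1" "\<And>c. c \<in> C \<Longrightarrow> z * E c = scale c (E c)"
    "\<And>c a. c \<in> C \<Longrightarrow> a * E c = E c * a" "\<And>c. c \<in> C \<Longrightarrow> E c * E c = E c"
proof -
  have "decomposable 1" using z_annihilator decomposable_if_z_eval by blast
  then obtain C E where C: "finite C" "1 = (\<Sum>c\<in>C. E c)" and E: "\<And>c. c \<in> C \<Longrightarrow> z * E c = scale c (E c)"
    unfolding decomposable_def by blast
  have central: "a * E c = E c * a" if c: "c \<in> C" for c a
  proof -
    have "a * E c - E c * a = 0"
    proof (rule eigenvectors_independent[OF C(1) _ _ c])
      fix d assume d: "d \<in> C"
      have "z * (a * E d) = scale d (a * E d)" using E[OF d] by (metis z_central mult.assoc scale_mult_right)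
      moreover have "z * (E d * a) = scale d (E d * a)" using E[OF d] by (metis mult.assoc scale_mult_left)
      ultimately show "z * (a * E d - E d * a) = scale d (a * E d - E d * a)"
        by (simp add: right_diff_distrib scale_right_diff_distrib)
    next
      show "(\<Sum>d\<in>C. a * E d - E d * a) = 0"
        by (simp add: sum_subtractf flip: sum_distrib_left sum_distrib_right C(2))
    qed
    then show ?thesis by simp
  qed
  have orth: "E c * E d = (if c = d then E d else 0)" if c: "c \<in> C" and d: "d \<in> C" for c d
  proof -
    have "E c' * E d - (if c' = d then E d else 0) = 0" if c': "c' \<in> C" for c'
    proof (rule eigenvectors_independent[OF C(1) _ _ c'])
      fix b assume b: "b \<in> C"
      have "z * (E b * E d) = scale b (E b * E d)" using E[OF b] by (metis mult.assoc scale_mult_left)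
      then show "z * (E b * E d - (if b = d then E d else 0)) = scale b (E b * E d - (if b = d then E d else 0))"
        using E[OF d] by (auto simp: right_diff_distrib scale_right_diff_distrib)
    next
      show "(\<Sum>b\<in>C. E b * E d - (if b = d then E d else 0)) = 0"
        using C d by (simp add: sum_subtractf flip: sum_distrib_right C(2))
    qed
    then show ?thesis using c by simp
  qed
  show ?thesis using that[OF C(1) C(2)[symmetric] E central] orth by simp
qed

text \<open>
  Splitting off \<open>\<Lambda>\<close> from the blocks isolates a summand equal to 1, so that nonnegativity of the remaining
  summands suffices.
\<close>

lemma lam_one_nonzero: "lam 1 \<noteq> 0"
proof -
  obtain n where n: "n > 0" "g ^ n = 1" using grouplike_finite_order[OF grouplike_g] by blast
  have "2 * n > 0" using n by simp
  then obtain \<omega> :: 'k and N where prim: "primitive_root_of_unity (2 * n) \<omega>" and N0: "0 \<in> N"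
    and N_add: "\<And>x y. x \<in> N \<Longrightarrow> y \<in> N \<Longrightarrow> x + y \<in> N"
    and N_pos: "\<And>x. x \<in> N \<Longrightarrow> 1 + x \<noteq> 0"
    and N_norm: "\<And>(d :: nat \<Rightarrow> nat) k. (\<Sum>j<2*n. of_nat (d j) * \<omega> ^ (j * 1)) * (\<Sum>j<2*n. of_nat (d j) * \<omega> ^ (j * (2*n - 1))) / of_nat k \<in> N"
    by (rule cyclotomic_positive_cone) (rule that)
  obtain C E where C: "finite C" "(\<Sum>c\<in>C. E c) = 1" and zE: "\<And>c. c \<in> C \<Longrightarrow> z * E c = scale c (E c)"
    and E: "\<And>c a. c \<in> C \<Longrightarrow> a * E c = E c * a" "\<And>c. c \<in> C \<Longrightarrow> E c * E c = E c"
    by (rule central_blocks) (rule that)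
  have \<Lambda>_central: "a * \<Lambda> = \<Lambda> * a" for a by (simp add: \<Lambda>_left \<Lambda>_right)
  have \<Lambda>_idem: "\<Lambda> * \<Lambda> = \<Lambda>" by (simp add: \<Lambda>_left integral_normalized)
  \<comment> \<open>The trivial block is split off; \<open>\<Lambda>\<close> is itself a central idempotent.\<close>
  define F where "F c = E c * (1 - \<Lambda>)" for c
  have F: "a * F c = F c * a" "F c * F c = F c" "z * F c = scale c (F c)" if "c \<in> C" for c a
  proof -
    have comm: "a * (1 - \<Lambda>) = (1 - \<Lambda>) * a" for a
      by (simp add: left_diff_distrib right_diff_distrib \<Lambda>_central)
    have idem: "(1 - \<Lambda>) * (1 - \<Lambda>) = 1 - \<Lambda>"
      by (simp add: left_diff_distrib right_diff_distrib \<Lambda>_idem)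
    show "a * F c = F c * a"
    proof -
      have "a * F c = (a * E c) * (1 - \<Lambda>)" by (simp only: F_def mult.assoc)
      also have "\<dots> = E c * (a * (1 - \<Lambda>))" by (simp only: E(1)[OF that, of a] mult.assoc)
      finally show ?thesis by (simp only: comm[of a] F_def mult.assoc)
    qed
    show "F c * F c = F c"
    proof -
      have "F c * F c = E c * ((1 - \<Lambda>) * E c) * (1 - \<Lambda>)" by (simp only: F_def mult.assoc)
      also have "\<dots> = (E c * E c) * ((1 - \<Lambda>) * (1 - \<Lambda>))" by (simp only: comm[of "E c", symmetric] mult.assoc)
      finally show ?thesis by (simp only: E(2)[OF that] idem F_def)
    qed
    show "z * F c = scale c (F c)"
      unfolding F_def using zE[OF that] by (simp add: scale_mult_left flip: mult.assoc)
  qed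
  have chi_N: "chi (z * F c) \<in> N" if c: "c \<in> C" for c
  proof -
    obtain d :: "nat \<Rightarrow> nat" and k where "chi (z * F c) =
        (\<Sum>j<2*n. of_nat (d j) * \<omega> ^ (j * 1)) * (\<Sum>j<2*n. of_nat (d j) * \<omega> ^ (j * (2*n - 1))) / of_nat k"
      using central_block_trace[OF F[OF c] n prim] by blast
    then show ?thesis using N_norm[of d k] by simp
  qed
  have sum_N: "(\<And>c. c \<in> D \<Longrightarrow> f c \<in> N) \<Longrightarrow> (\<Sum>c\<in>D. f c) \<in> N" for D and f :: "'k \<Rightarrow> 'k"
    by (induction D rule: infinite_finite_induct) (simp_all add: N0 N_add)
  have "(\<Sum>c\<in>C. chi (z * F c)) \<in> N" by (rule sum_N) (rule chi_N)
  moreover have "lam 1 = 1 + (\<Sum>c\<in>C. chi (z * F c))"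
  proof -
    have "lam 1 = chi z" using chi_central(2)[of 1] by (simp add: lam_eq_chi)
    also have "z = z * \<Lambda> + (\<Sum>c\<in>C. z * F c)"
    proof -
      have "(\<Sum>c\<in>C. z * F c) = z * ((\<Sum>c\<in>C. E c) * (1 - \<Lambda>))"
        by (simp only: F_def sum_distrib_left sum_distrib_right)
      then show ?thesis by (simp add: C(2) right_diff_distrib)
    qed
    also have "chi \<dots> = chi (z * \<Lambda>) + (\<Sum>c\<in>C. chi (z * F c))"
      by (simp add: chi_add form_sum[OF chi_form])
    also have "chi (z * \<Lambda>) = 1"
    proof -
      have chi_\<Lambda>: "chi (h * \<Lambda>) = \<epsilon> h" for h
        using tr_rank_one[OF counit_linear, of \<Lambda>]
        by (simp add: \<Lambda>_left chi_scale integral_normalized) (simp add: chi_def \<Lambda>_right integral_normalized)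
      have "\<epsilon> z = \<epsilon> w" using chi_central(2)[OF \<Lambda>_central] by (simp add: chi_\<Lambda>)
      moreover have "\<epsilon> z = \<epsilon> w * \<epsilon> w"
        using grouplike_g by (simp add: z_def counit_mult grouplike_def)
      moreover have "\<epsilon> w \<noteq> 0" using u_w by (metis counit_mult counit_one mult_zero_right zero_neq_one)
      ultimately show ?thesis by (simp add: chi_\<Lambda>)
    qed
    finally show ?thesis .
  qed
  ultimately show ?thesis using N_pos by metis
qed

lemma S_order_4: "S (S (S (S h))) = h"
  using S4_conjugation[of h] g_eq_one[OF lam_one_nonzero] by simp

end

section \<open>The antipode is an involution\<close>

context semisimple_hopf_closed
begin

text \<open>
  Convolution by \<open>p\<close> in the dual algebra, transposed to an operator on \<open>H\<close>.
\<close>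

definition conv_op :: "('h \<Rightarrow> 'k) \<Rightarrow> 'h \<Rightarrow> 'h" where
  "conv_op p y = sw y (\<lambda>a b. scale (p a) b)"

text \<open>
  The character of the regular representation of the dual algebra, viewed as an element of \<open>H\<close> (see
  \<open>form_regular\<close>).
\<close>

definition regular :: 'h where
  "regular = (\<Sum>e\<in>Basis. sw e (\<lambda>a b. scale (crd e b) a))"

lemma conv_op_endo: "form p \<Longrightarrow> endo (conv_op p)"
  by (simp add: form_iff endo_iff conv_op_def lin mult.commute flip: sw_scale_right)

lemma form_regular:
  assumes p: "form p"
  shows "p regular = tr (conv_op p)"
  unfolding regular_def tr_def conv_op_def
  by (simp add: form_sum[OF p] form_sw[OF p] form_sw[OF crd_form] mult.commute)

lemma regular_cocommutative_forms:
  assumes p: "form p" and q: "form q"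
  shows "sw regular (\<lambda>a b. p a * q b) = sw regular (\<lambda>a b. q a * p b)"
proof -
  have conv: "sw regular (\<lambda>a b. p a * q b) = tr (\<lambda>y. conv_op q (conv_op p y))"
    if p: "form p" and q: "form q" for p q
  proof -
    have p': "p (x + y) = p x + p y" "p (scale c x) = c * p x" for x y c
      using p by (simp_all add: form_iff)
    have q': "q (x + y) = q x + q y" "q (scale c x) = c * q x" for x y c
      using q by (simp_all add: form_iff)
    define f where "f x = sw x (\<lambda>a b. p a * q b)" for x
    have f: "form f"
      by (simp add: form_iff f_def lin p' q' mult_ac)
    have "conv_op q (conv_op p y) = conv_op f y" for y
    proof -
      have "conv_op q (conv_op p y) = sw y (\<lambda>a b. conv_op q (scale (p a) b))"
        unfolding conv_op_def[of p] using conv_op_endo[OF q] by (intro sw_additive) (simp add: endo_iff)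
      also have "\<dots> = sw y (\<lambda>a b. sw b (\<lambda>c d. scale (p a * q c) d))"
        by (simp add: conv_op_def lin q' flip: sw_scale_right)
      also have "\<dots> = sw y (\<lambda>u d. sw u (\<lambda>a c. scale (p a * q c) d))"
        by (rule sw_coassoc[symmetric]) (simp add: lin p' q' mult_ac)
      also have "\<dots> = conv_op f y"
        unfolding conv_op_def f_def by (rule sw_cong, rule sw_additive[symmetric]) (simp add: scale_left_distrib)
      finally show ?thesis .
    qed
    then show ?thesis using form_regular[OF f] by (simp add: f_def)
  qed
  show ?thesis
    unfolding conv[OF p q] conv[OF q p] using conv_op_endo[OF p] conv_op_endo[OF q] by (rule tr_comp[symmetric])
qed

lemma cocommutative_if_forms:
  assumes "\<And>p q. form p \<Longrightarrow> form q \<Longrightarrow> sw x (\<lambda>a b. p a * q b) = sw x (\<lambda>a b. q a * p b)"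
    and G: "balanced2 G"
  shows "sw x G = sw x (\<lambda>a b. G b a)"
proof -
  have G': "balanced2 (\<lambda>a b. G b a)" and bal: "G (scale c a) b = G a (scale c b)" for a b c
    using G unfolding balanced2_def by metis+
  have "sw x G = (\<Sum>i\<in>Basis. \<Sum>j\<in>Basis. G i (scale (sw x (\<lambda>a b. crd j a * crd i b)) j))"
    unfolding sw_expand[OF G] bal using assms(1)[OF crd_form crd_form] by simp
  also have "\<dots> = sw x (\<lambda>a b. G b a)"
    unfolding sw_expand[OF G'] by (rule sum.swap)
  finally show ?thesis .
qed

lemma counit_regular: "\<epsilon> regular = of_nat (card Basis)"
proof -
  have "conv_op \<epsilon> = (\<lambda>x. x)" by (rule ext) (simp add: conv_op_def sw_counit_left)
  then show ?thesis using form_regular[OF counit_linear] by (simp add: tr_id)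
qed

text \<open>
  Multiplying a regular character by a character \<open>y\<close> gives \<open>\<epsilon>(y)\<close> times the regular character.  In terms of traces,
  \<open>p(x y)\<close> is the trace of \<open>v \<mapsto> p(v\<^sub>1 y) v\<^sub>2 = p(v\<^sub>1 y\<^sub>1) v\<^sub>2 y\<^sub>2 S(y\<^sub>3)\<close>, which by cyclicity is the trace of convolution by
  \<open>p\<close> after right multiplication by \<open>S(y\<^sub>2) y\<^sub>1\<close>.  For the cocommutative element \<open>y = x\<close> the legs may be exchanged, and
  \<open>S(y\<^sub>1) y\<^sub>2 = \<epsilon>(y) 1\<close>.
\<close>

lemma regular_mult: "regular * regular = scale (of_nat (card Basis)) regular"
proof (rule eq_if_forms_eq)
  fix p :: "'h \<Rightarrow> 'k" assume p: "form p"
  have p': "p (x + y) = p x + p y" "p (scale c x) = c * p x" for x y c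
    using p by (simp_all add: form_iff)
  note Q = conv_op_endo[OF p, unfolded endo_iff]
  define y where "y = regular"
  have "p (regular * y) = tr (conv_op (\<lambda>a. p (a * y)))"
    using form_regular[of "\<lambda>a. p (a * y)"] by (simp add: form_iff lin p')
  also have "conv_op (\<lambda>a. p (a * y)) = (\<lambda>v. sw y (\<lambda>a b. conv_op p (v * a) * S b))"
  proof
    fix v
    have "sw y  (\<lambda>a b. conv_op p (v * a) * S b) = sw y (\<lambda>u c. sw v (\<lambda>v1 v2. sw u (\<lambda>a b. scale (p (v1 * a)) (v2 * b * S c))))"
      by (rule sw_cong) (simp add: conv_op_def sw_mult lin p' mult.commute scale_mult_left flip: sw_mult_const_right)
    also have "\<dots> = sw v (\<lambda>v1 v2. sw y (\<lambda>u c. sw u (\<lambda>a b. scale (p (v1 * a)) (v2 * (b * S c)))))"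
      by (subst sw_swap) (simp add: mult.assoc)
    also have "\<dots> = sw v (\<lambda>v1 v2. sw y (\<lambda>a u. sw u (\<lambda>b c. scale (p (v1 * a)) (v2 * (b * S c)))))"
      by (rule sw_cong, rule sw_coassoc) (simp add: lin p' mult_ac)
    also have "\<dots> = sw v (\<lambda>v1 v2. sw y (\<lambda>a u. scale (p (v1 * scale (\<epsilon> u) a)) v2))"
      by (rule sw_cong, rule sw_cong, subst sw_antipode_right'[of "\<lambda>x. scale _ (_ * x)"]) (simp_all add: lin p' mult.commute)
    also have "\<dots> = sw v (\<lambda>v1 v2. scale (p (v1 * y)) v2)"
      by (rule sw_cong, subst sw_counit_right'[of "\<lambda>x. scale (p (_ * x)) _"]) (simp_all add: lin p')
    finally show "conv_op (\<lambda>a. p (a * y)) v = sw y (\<lambda>a b. conv_op p (v * a) * S b)"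
      by (simp add: conv_op_def)
  qed
  also have "tr (\<lambda>v. sw y (\<lambda>a b. conv_op p (v * a) * S b)) = sw y (\<lambda>a b. tr (\<lambda>v. conv_op p (v * a) * S b))"
    by (rule tr_sw)
  also have "\<dots> = sw y (\<lambda>a b. tr (\<lambda>v. conv_op p (v * (S b * a))))"
  proof (rule sw_cong)
    fix a b
    show "tr (\<lambda>v. conv_op p (v * a) * S b) = tr (\<lambda>v. conv_op p (v * (S b * a)))"
      using tr_comp[of "\<lambda>v. v * S b" "\<lambda>v. conv_op p (v * a)"] Q by (simp add: endo_iff lin mult.assoc)
  qed
  also have "\<dots> = sw y (\<lambda>a b. tr (\<lambda>v. conv_op p (v * (S a * b))))"
    unfolding y_def
    by (rule cocommutative_if_forms[OF regular_cocommutative_forms]) (simp_all add: lin Q tr_add tr_scale)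
  also have "\<dots> = tr (\<lambda>v. conv_op p (v * scale (\<epsilon> y) 1))"
    by (subst sw_antipode_left'[of "\<lambda>x. tr (\<lambda>v. conv_op p (v * x))"]) (simp_all add: lin Q tr_add)
  also have "\<dots> = \<epsilon> y * tr (conv_op p)"
    by (simp add: lin Q tr_scale)
  finally show "p (regular * regular) = p (scale (of_nat (card Basis)) regular)"
    by (simp add: y_def counit_regular form_regular[OF p] p')
qed

lemma S2_regular: "S (S regular) = regular"
proof (rule eq_if_forms_eq)
  fix p :: "'h \<Rightarrow> 'k" assume p: "form p"
  have p': "p (x + y) = p x + p y" "p (scale c x) = c * p x" for x y c
    using p by (simp_all add: form_iff)
  have f: "form (\<lambda>x. p (S (S x)))" by (simp add: form_iff lin p')
  have "S (S (conv_op (\<lambda>x. p (S (S x))) y)) = conv_op p (S (S y))" for y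
    by (simp add: conv_op_def S_anticomult lin p' sw_additive[of S] mult.commute)
  then have eq: "conv_op (\<lambda>x. p (S (S x))) y = S (S (conv_op p (S (S y))))" for y
    by (metis S_order_4)
  have "p (S (S regular)) = tr (conv_op (\<lambda>x. p (S (S x))))"
    using form_regular[OF f] .
  also have "\<dots> = tr (\<lambda>y. S (S (conv_op p (S (S y)))))"
    using eq by (simp add: tr_def)
  also have "\<dots> = tr (\<lambda>y. conv_op p (S (S (S (S y)))))"
    using tr_comp[of "\<lambda>x. S (S x)" "\<lambda>y. conv_op p (S (S y))"] conv_op_endo[OF p]
    by (simp add: endo_iff lin)
  also have "\<dots> = p regular"
    by (simp add: S_order_4 form_regular[OF p])
  finally show "p (S (S regular)) = p regular" .
qed

lemma lam_regular: "lam regular = lam 1"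
  using form_regular[OF lam_form] tr_rank_one[OF lam_form, of 1]
  by (simp add: conv_op_def lam_integral tr_def)

text \<open>
  \<open>T\<close> is an involution on its range; \<open>p\<close> and \<open>q\<close> are the dimensions of its eigenspaces for 1 and \<open>-1\<close>, the traces of
  the idempotents \<open>(T\<^sup>2 \<plusminus> T) / 2\<close>.
\<close>

lemma involution_trace:
  assumes T: "endo T" and T3: "\<And>x. T (T (T x)) = T x"
  obtains p q where "tr T = of_nat p - of_nat q" "tr (\<lambda>x. T (T x)) = of_nat p + of_nat q"
    "\<And>x. p = 0 \<Longrightarrow> T (T x) = - T x" "\<And>x. q = 0 \<Longrightarrow> T (T x) = T x"
proof -
  have T': "T (x + y) = T x + T y" "T (scale c x) = scale c (T x)" for x y c
    using T by (simp_all add: endo_iff)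
  have half: "scale (1/2) (x + x) = x" for x
    by (simp add: scale_right_distrib flip: scale_left_distrib)
  have nat: "\<exists>n. tr (\<lambda>x. scale (1/2) (T (T x) + scale c (T x))) = of_nat n \<and>
      (n = 0 \<longrightarrow> (\<forall>x. scale (1/2) (T (T x) + scale c (T x)) = 0))" if c: "c * c = 1" for c
  proof -
    define P where "P x = scale (1/2) (T (T x) + scale c (T x))" for x
    have P_endo: "endo P" by (simp add: endo_iff P_def T' scale_right_distrib mult.left_commute add_ac)
    have TP: "T (P x) = scale c (P x)" for x
      by (simp add: P_def T' T3 c scale_right_distrib add.commute mult.commute)
    have "P (P x) = scale (1/2) (P x + P x)" for x
      by (subst P_def) (simp add: TP T' c)
    then have "P (P x) = P x" for x unfolding half .
    then have "\<exists>n. (\<Sum>b\<in>Basis. crd b (P b)) = of_nat n \<and> (n = 0 \<longrightarrow> (\<forall>x. P x = 0))"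
      using trace_idempotent[of Basis P crd "\<lambda>b. b", OF finite_Basis P_endo _ crd_form] by (simp add: sum_crd)
    then show ?thesis unfolding tr_def P_def .
  qed
  obtain p where p: "tr (\<lambda>x. scale (1/2) (T (T x) + scale 1 (T x))) = of_nat p"
    "p = 0 \<Longrightarrow> scale (1/2) (T (T x) + scale 1 (T x)) = 0" for x
    using nat[of 1] by auto
  obtain q where q: "tr (\<lambda>x. scale (1/2) (T (T x) + scale (-1) (T x))) = of_nat q"
    "q = 0 \<Longrightarrow> scale (1/2) (T (T x) + scale (-1) (T x)) = 0" for x
    using nat[of "-1"] by auto
  have p1: "(tr (\<lambda>x. T (T x)) + tr T) / 2 = of_nat p"
    using p(1) unfolding tr_scale tr_add by simp
  have q1: "(tr (\<lambda>x. T (T x)) - tr T) / 2 = of_nat q"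
    using q(1) unfolding tr_scale tr_add by simp
  show ?thesis
  proof (rule that)
    show "tr T = of_nat p - of_nat q" "tr (\<lambda>x. T (T x)) = of_nat p + of_nat q"
      unfolding p1[symmetric] q1[symmetric] by (simp_all add: field_simps)
    show "T (T x) = - T x" if "p = 0" for x
      using p(2)[OF that] by (simp add: eq_neg_iff_add_eq_0)
    show "T (T x) = T x" if "q = 0" for x
      using q(2)[OF that] by simp
  qed
qed

text \<open>
  The antipode theorem of Larson and Radford.  With \<open>T = S\<^sup>2\<close> followed by right multiplication by the idempotent \<open>x / n\<close>, where
  \<open>x\<close> is \<open>regular\<close>, the trace of \<open>T\<close> is \<open>\<lambda>(x) / n = \<lambda>(1) / n\<close>, and it is an integer as \<open>T\<^sup>3 = T\<close>.  So the nonzero integer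
  \<open>Tr S\<^sup>2\<close> is divisible by \<open>n\<close>, which leaves only \<open>S\<^sup>2 = \<plusminus>id\<close>.
\<close>

lemma S_involution: "S (S x) = x"
proof -
  define n where "n = card Basis"
  have one0: "(1 :: 'h) \<noteq> 0" using counit_one form_zero[OF counit_linear] by (metis zero_neq_one)
  obtain p q where pq: "tr (\<lambda>x. S (S x)) = of_nat p - of_nat q" "tr (\<lambda>x. x) = of_nat p + of_nat q"
    and p0: "\<And>x. p = 0 \<Longrightarrow> x = - S (S x)" and q0: "\<And>x. q = 0 \<Longrightarrow> x = S (S x)"
    using involution_trace[of "\<lambda>x. S (S x)"] by (auto simp: endo_iff lin S_order_4)
  have n: "n = p + q" using pq(2) by (simp add: tr_id n_def flip: of_nat_add)
  have "n \<noteq> 0" using one0 sum_crd[of 1] finite_Basis by (auto simp: n_def)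
  then have n0: "(of_nat n :: 'k) \<noteq> 0" by simp
  \<comment> \<open>\<open>regular\<close> divided by \<open>n\<close> is an idempotent fixed by \<open>S\<^sup>2\<close>.\<close>
  define T where "T x = scale (1 / of_nat n) (S (S x) * regular)" for x
  have TT: "T (T x) = scale (1 / of_nat n) (x * regular)" for x
    using n0 by (simp add: T_def lin S_mult S2_regular S_order_4 regular_mult mult.assoc n_def)
  have T3: "T (T (T x)) = T x" for x
    unfolding TT[of "T x"] using n0 by (simp add: T_def lin regular_mult mult.assoc n_def)
  have T_endo: "endo T" by (simp add: endo_iff T_def lin mult.commute)
  obtain p' q' where "tr T = of_nat p' - of_nat q'"
    by (rule involution_trace[OF T_endo T3]) (rule that)
  moreover have "tr T = lam regular / of_nat n"
    by (simp add: T_def[abs_def] tr_scale lam_def)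
  moreover have lam1: "lam 1 = of_nat p - of_nat q" using pq(1) by (simp add: lam_def)
  ultimately have "(of_nat p - of_nat q :: 'k) = of_nat n * (of_nat p' - of_nat q')"
    using n0 by (simp add: lam_regular nonzero_divide_eq_eq mult.commute)
  then have "of_int (int p - int q) = (of_int (int n * (int p' - int q')) :: 'k)" by simp
  then have int_eq: "int p - int q = int n * (int p' - int q')" by (simp only: of_int_eq_iff)
  moreover have "int p - int q \<noteq> 0" using lam_one_nonzero lam1 by auto
  ultimately have "int n dvd \<bar>int p - int q\<bar>" "\<bar>int p - int q\<bar> > 0" by simp_all
  then have "int n \<le> \<bar>int p - int q\<bar>" by (rule zdvd_imp_le)
  then have "p = 0 \<or> q = 0" using n by auto
  moreover have "p \<noteq> 0"
  proof
    assume "p = 0"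
    then have "\<epsilon> 1 = \<epsilon> (scale (-1) 1)" using p0[of 1] by (simp add: S_one)
    then have "(1 :: 'k) = -1" by (simp only: \<epsilon>_scale counit_one) simp
    then show False by simp
  qed
  ultimately show ?thesis using q0 by metis
qed

text \<open>
  As \<open>S\<^sup>2 = id\<close>, the functional \<open>\<lambda> = \<mu>\<close> satisfies \<open>\<lambda>(x y) = \<lambda>(y x)\<close>, and every functional has the form
  \<open>x \<mapsto> \<lambda>(S(h) x)\<close>.  The two dual basis formulas say that contracting either leg of \<open>\<Delta> \<Lambda>\<close> with this functional
  gives \<open>h\<close>.
\<close>

lemma \<Lambda>_cocommutative:
  assumes "balanced2 G"
  shows "sw \<Lambda> G = sw \<Lambda> (\<lambda>a b. G b a)"
proof (rule cocommutative_if_forms[OF _ assms])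
  fix p q :: "'h \<Rightarrow> 'k" assume p: "form p" and q: "form q"
  have lam_mu: "mu x = lam x" for x
    using g_eq_one[OF lam_one_nonzero] by (simp add: mu_eq_lam_g)
  have lam_comm: "lam (x * y) = lam (y * x)" for x y
    using lam_nakayama[of x y] by (simp add: S_involution)
  define h where "h = sw \<Lambda> (\<lambda>a b. scale (q b) a)"
  have q_eq: "q x = lam (S h * x)" for x
  proof -
    have "q x = q (sw \<Lambda> (\<lambda>a b. scale (lam (S x * a)) b))" by (simp only: dual_bases_lam)
    also have "\<dots> = sw \<Lambda> (\<lambda>a b. q b * lam (S x * a))"
      by (simp only: form_sw[OF q]) (simp only: mult.commute)
    also have "\<dots> = sw \<Lambda> (\<lambda>a b. lam (S x * scale (q b) a))"
      by (simp add: linear_simps)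
    also have "\<dots> = lam (S x * h)"
      unfolding h_def by (rule sw_additive[symmetric]) (simp add: linear_simps)
    also have "\<dots> = lam (S (S h * x))" by (simp add: S_mult S_involution)
    also have "\<dots> = lam (S h * x)" by (simp only: lam_S lam_mu)
    finally show ?thesis .
  qed
  have "sw \<Lambda> (\<lambda>a b. q b * p a) = p (sw \<Lambda> (\<lambda>a b. scale (mu (b * S h)) a))"
    by (simp only: form_sw[OF p] q_eq lam_mu lam_comm[of "S h"])
  moreover have "sw \<Lambda> (\<lambda>a b. q a * p b) = p (sw \<Lambda> (\<lambda>a b. scale (lam (S h * a)) b))"
    by (simp only: form_sw[OF p] q_eq)
  ultimately show "sw \<Lambda> (\<lambda>a b. p a * q b) = sw \<Lambda> (\<lambda>a b. q a * p b)"
    by (simp add: dual_bases_mu dual_bases_lam mult.commute)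
qed

end

section \<open>Convolution products and the twisted cyclic operator\<close>

context hopf_calculus
begin

text \<open>
  The convolution product of a list of functionals, so that the value at \<open>x\<close> is their product evaluated on the iterated
  coproduct of \<open>x\<close>.  The empty product is the unit \<open>\<epsilon>\<close> of convolution, which makes the recursion start one step
  earlier than that of \<open>iterated_comult\<close>.
\<close>

fun conv :: "('h \<Rightarrow> 'k) list \<Rightarrow> 'h \<Rightarrow> 'k" where
  "conv [] x = \<epsilon> x"
| "conv (\<phi> # \<phi>s) x = sw x (\<lambda>a b. \<phi> a * conv \<phi>s b)"

lemma sw_product: "sw x F * sw y G = sw x (\<lambda>a b. sw y (\<lambda>c d. F a b * (G c d :: 'w::ring)))"
  by (simp add: sw_mult_const sw_mult_const_right)

lemma form_add: "form \<phi> \<Longrightarrow> \<phi> (x + y) = \<phi> x + \<phi> y" and form_scale: "form \<phi> \<Longrightarrow> \<phi> (scale c x) = c * \<phi> x"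
  by (simp_all add: form_iff)

lemma conv_form: "(\<And>\<phi>. \<phi> \<in> set \<phi>s \<Longrightarrow> form \<phi>) \<Longrightarrow> form (conv \<phi>s)"
proof (induction \<phi>s)
  case Nil
  then show ?case by (simp add: form_iff lin)
next
  case (Cons \<phi> \<phi>s)
  then have "form \<phi>" "form (conv \<phi>s)" by simp_all
  then show ?case
    unfolding form_iff[of "conv (\<phi> # \<phi>s)"] by (simp add: lin form_add form_scale mult_ac)
qed

lemma conv_append:
  assumes "\<And>\<phi>. \<phi> \<in> set (\<phi>s @ \<psi>s) \<Longrightarrow> form \<phi>"
  shows "conv (\<phi>s @ \<psi>s) x = sw x (\<lambda>a b. conv \<phi>s a * conv \<psi>s b)"
  using assms
proof (induction \<phi>s arbitrary: x)
  case Nil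
  then have \<psi>: "form (conv \<psi>s)" by (intro conv_form) simp
  have "sw x (\<lambda>a b. conv [] a * conv \<psi>s b) = sw x (\<lambda>a b. conv \<psi>s (scale (\<epsilon> a) b))"
    by (simp add: form_scale[OF \<psi>])
  also have "\<dots> = conv \<psi>s x" by (rule sw_counit_left') (rule form_add[OF \<psi>])
  finally show ?case by simp
next
  case (Cons \<phi> \<phi>s)
  then have forms: "form \<phi>" "form (conv \<phi>s)" "form (conv \<psi>s)" by (auto intro!: conv_form)
  have "conv ((\<phi> # \<phi>s) @ \<psi>s) x = sw x (\<lambda>a u. sw u (\<lambda>b c. \<phi> a * conv \<phi>s b * conv \<psi>s c))"
    using Cons by (simp add: mult.assoc sw_mult_const)
  also have "\<dots> = sw x (\<lambda>u c. sw u (\<lambda>a b. \<phi> a * conv \<phi>s b * conv \<psi>s c))"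
    by (rule sw_coassoc[symmetric]) (simp add: lin form_add[OF forms(1)] form_add[OF forms(2)] form_add[OF forms(3)] form_scale[OF forms(1)] form_scale[OF forms(2)] form_scale[OF forms(3)] mult_ac)
  finally show ?case by (simp add: sw_mult_const_right)
qed

lemma conv_iterated_comult:
  "length \<phi>s = Suc n \<Longrightarrow> (\<And>\<phi>. \<phi> \<in> set \<phi>s \<Longrightarrow> form \<phi>) \<Longrightarrow>
    conv \<phi>s x = (\<Sum>xs\<in>#iterated_comult \<Delta> n x. prod_list (map2 (\<lambda>\<phi> x. \<phi> x) \<phi>s xs))"
proof (induction n arbitrary: \<phi>s x)
  case 0
  then obtain \<phi> where \<phi>: "\<phi>s = [\<phi>]" by (auto simp: length_Suc_conv)
  then have "form \<phi>" using 0 by simp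
  then have "sw x (\<lambda>a b. \<phi> a * \<epsilon> b) = \<phi> x"
    using sw_counit_right'[of \<phi> x] by (simp add: form_add form_scale mult.commute)
  then show ?case by (simp add: \<phi>)
next
  case (Suc n)
  then obtain \<phi> \<psi>s where \<phi>: "\<phi>s = \<phi> # \<psi>s" "length \<psi>s = Suc n" by (auto simp: length_Suc_conv)
  have sum: "(\<Sum>q\<in>#(\<Sum>p\<in>#M. f p). F q) = (\<Sum>p\<in>#M. \<Sum>q\<in>#f p. F q)"
    for M :: "('h \<times> 'h) multiset" and f :: "_ \<Rightarrow> 'h list multiset" and F :: "_ \<Rightarrow> 'k"
    by (induction M) simp_all
  have "conv \<phi>s x = (\<Sum>(a, b)\<in>#\<Delta> x. \<Sum>ys\<in>#iterated_comult \<Delta> n b. prod_list (map2 (\<lambda>\<phi> x. \<phi> x) \<phi>s (a # ys)))"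
    using Suc \<phi> by (simp add: sw_def sum_mset_distrib_left)
  then show ?case
    by (simp add: case_prod_unfold sum image_mset.compositionality comp_def)
qed

lemma length_iterated_comult: "xs \<in># iterated_comult \<Delta> n x \<Longrightarrow> length xs = Suc n"
  by (induction n arbitrary: x xs) (auto simp: case_prod_unfold)

end

locale twisted_module = semisimple_hopf_closed scale \<Delta> \<epsilon> S Basis \<Lambda> +
    V: finite_dimensional_vector_space scaleV BV + M: hopf_module scale scaleV act
  for scale :: "'k::{alg_closed_field, field_char_0} \<Rightarrow> 'h::ring_1 \<Rightarrow> 'h"
    and \<Delta> :: "'h \<Rightarrow> ('h \<times> 'h) multiset"
    and \<epsilon> :: "'h \<Rightarrow> 'k"
    and S :: "'h \<Rightarrow> 'h"
    and Basis :: "'h set"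
    and \<Lambda> :: 'h
    and scaleV :: "'k \<Rightarrow> 'v::ab_group_add \<Rightarrow> 'v"
    and act :: "'h \<Rightarrow> 'v \<Rightarrow> 'v"
    and BV :: "'v set" +
  fixes \<tau> :: "'h \<Rightarrow> 'h" and m :: nat
  assumes automorphism: "hopf_automorphism scale \<Delta> \<epsilon> \<tau>"
    and m_pos: "m > 0" and \<tau>_order: "\<tau> ^^ m = id"
begin

definition \<rho> :: "'v \<Rightarrow> 'v \<Rightarrow> 'h \<Rightarrow> 'k" where
  "\<rho> a b h = V.representation BV (act h b) a"

lemma \<rho>_form: "form (\<rho> a b)"
  using V.independent_Basis V.span_Basis
  by (simp add: form_iff \<rho>_def M.act_add_left M.act_scale_left V.representation_add V.representation_scale)

lemma \<rho>_mult: "\<rho> a c (x * y) = (\<Sum>b\<in>BV. \<rho> a b x * \<rho> b c y)"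
proof -
  have V: "V.representation BV (v + v') a = V.representation BV v a + V.representation BV v' a"
    "V.representation BV (scaleV r v) a = r * V.representation BV v a" for v v' r
    using V.independent_Basis V.span_Basis by (simp_all add: V.representation_add V.representation_scale)
  have zero: "act x 0 = 0" using M.act_add_right[of x 0 0] by simp
  have act_sum: "act x (\<Sum>b\<in>C. f b) = (\<Sum>b\<in>C. act x (f b))" for C :: "'v set" and f
    by (induction C rule: infinite_finite_induct) (simp_all add: M.act_add_right zero)
  have rep_sum: "V.representation BV (\<Sum>b\<in>C. f b) a = (\<Sum>b\<in>C. V.representation BV (f b) a)" for C :: "'v set" and f
    by (induction C rule: infinite_finite_induct) (simp_all add: V V.representation_zero)
  have "act y c = (\<Sum>b\<in>BV. scaleV (\<rho> b c y) b)"
    unfolding \<rho>_def using V.sum_representation_eq[OF V.independent_Basis _ V.finite_Basis] V.span_Basis by simp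
  then have "act (x * y) c = (\<Sum>b\<in>BV. scaleV (\<rho> b c y) (act x b))"
    by (simp add: M.act_mult act_sum M.act_scale_right)
  then show ?thesis by (simp add: \<rho>_def rep_sum V mult.commute)
qed

lemma character_eq: "character scaleV BV act h = (\<Sum>b\<in>BV. \<rho> b b h)"
  by (simp add: character_def \<rho>_def)

lemma \<tau>_add: "\<tau> (x + y) = \<tau> x + \<tau> y" and \<tau>_scale: "\<tau> (scale c x) = scale c (\<tau> x)"
  using automorphism unfolding hopf_automorphism_def endo_iff by blast+

lemma \<tau>_mult: "\<tau> (x * y) = \<tau> x * \<tau> y" and \<epsilon>_\<tau>: "\<epsilon> (\<tau> x) = \<epsilon> x"
  using automorphism unfolding hopf_automorphism_def by blast+

lemma sw_\<tau>: "balanced2 G \<Longrightarrow> sw (\<tau> x) G = sw x (\<lambda>a b. G (\<tau> a) (\<tau> b))"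
  using sw_tensor[of "\<Delta> (\<tau> x)" "image_mset (map_prod \<tau> \<tau>) (\<Delta> x)" G] automorphism
  unfolding hopf_automorphism_def sw_def
  by (simp add: case_prod_unfold image_mset.compositionality comp_def)

lemma \<tau>_\<Lambda>: "\<tau> \<Lambda> = \<Lambda>"
proof -
  obtain y where y: "\<Lambda> = \<tau> y" using automorphism unfolding hopf_automorphism_def by (metis bij_pointE)
  have "\<Lambda> * \<tau> \<Lambda> = \<tau> (y * \<Lambda>)" by (simp add: y \<tau>_mult)
  then have "\<Lambda> * \<tau> \<Lambda> = scale (\<epsilon> y) (\<tau> \<Lambda>)" by (simp add: \<Lambda>_left \<tau>_scale)
  moreover have "\<epsilon> y = 1" using \<epsilon>_\<tau>[of y] integral_normalized y by simp
  moreover have "\<Lambda> * \<tau> \<Lambda> = \<Lambda>" by (simp add: \<Lambda>_right \<epsilon>_\<tau> integral_normalized)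
  ultimately show ?thesis by simp
qed

lemma \<tau>_pow: "(\<tau> ^^ k) (x + y) = (\<tau> ^^ k) x + (\<tau> ^^ k) y" "(\<tau> ^^ k) (scale c x) = scale c ((\<tau> ^^ k) x)"
  "(\<tau> ^^ k) (x * y) = (\<tau> ^^ k) x * (\<tau> ^^ k) y"
  by (induction k) (simp_all add: \<tau>_add \<tau>_scale \<tau>_mult)

text \<open>
  The factors of the matrix coefficient with row \<open>\<alpha>\<close> and column \<open>\<beta>\<close> of a tensor power of the module on which the successive
  factors are twisted by \<open>\<tau>\<^sup>k\<close>, \<open>\<tau>\<^sup>k\<^sup>+\<^sup>1\<close>, and so on; \<open>conv\<close> of this list is the coefficient as a functional on
  \<open>H\<close>.
\<close>

fun matrix_coeffs :: "nat \<Rightarrow> 'v list \<Rightarrow> 'v list \<Rightarrow> ('h \<Rightarrow> 'k) list" where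
  "matrix_coeffs k (a # \<alpha>) (b # \<beta>) = (\<lambda>x. \<rho> a b ((\<tau> ^^ k) x)) # matrix_coeffs (Suc k) \<alpha> \<beta>"
| "matrix_coeffs k _ _ = []"

lemma \<rho>_\<tau>_form: "form (\<lambda>x. \<rho> a b ((\<tau> ^^ k) x))"
  using \<rho>_form[of a b] by (simp add: form_iff \<tau>_pow)

lemma matrix_coeffs_form: "\<phi> \<in> set (matrix_coeffs k \<alpha> \<beta>) \<Longrightarrow> form \<phi>"
  by (induction k \<alpha> \<beta> rule: matrix_coeffs.induct) (auto intro: \<rho>_\<tau>_form)

lemma matrix_coeffs_append:
  "length \<alpha> = length \<beta> \<Longrightarrow>
    matrix_coeffs k (\<alpha> @ [a]) (\<beta> @ [b]) = matrix_coeffs k \<alpha> \<beta> @ [\<lambda>x. \<rho> a b ((\<tau> ^^ (k + length \<alpha>)) x)]"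
  by (induction \<alpha> \<beta> arbitrary: k rule: list_induct2) simp_all

lemma length_matrix_coeffs: "length \<alpha> = length \<beta> \<Longrightarrow> length (matrix_coeffs k \<alpha> \<beta>) = length \<alpha>"
  by (induction \<alpha> \<beta> arbitrary: k rule: list_induct2) simp_all

definition multi_index :: "nat \<Rightarrow> 'v list set" where
  "multi_index n = {\<alpha>. set \<alpha> \<subseteq> BV \<and> length \<alpha> = n}"

lemma multi_index_0: "multi_index 0 = {[]}"
  by (auto simp: multi_index_def)

lemma sum_multi_index_Suc: "(\<Sum>\<alpha>\<in>multi_index (Suc n). f \<alpha>) = (\<Sum>a\<in>BV. \<Sum>\<alpha>\<in>multi_index n. f (a # \<alpha>))"
proof -
  have "multi_index (Suc n) = (\<lambda>(a, \<alpha>). a # \<alpha>) ` (BV \<times> multi_index n)"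
    by (auto simp: multi_index_def length_Suc_conv image_iff)
  moreover have "inj_on (\<lambda>(a, \<alpha>). a # \<alpha>) (BV \<times> multi_index n)"
    by (auto simp: inj_on_def)
  ultimately show ?thesis
    by (simp add: sum.reindex sum.cartesian_product case_prod_unfold)
qed

lemma finite_multi_index: "finite (multi_index n)"
  unfolding multi_index_def by (rule finite_lists_length_eq[OF V.finite_Basis])

text \<open>
  The twisted tensor power is a representation, because the coproduct and \<open>\<tau>\<close> are multiplicative.
\<close>

lemma conv_matrix_coeffs_mult:
  "length \<alpha> = length \<gamma> \<Longrightarrow>
    (\<Sum>\<beta>\<in>multi_index (length \<alpha>). conv (matrix_coeffs k \<alpha> \<beta>) x * conv (matrix_coeffs k \<beta> \<gamma>) y) = conv (matrix_coeffs k \<alpha> \<gamma>) (x * y)"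
proof (induction \<alpha> \<gamma> arbitrary: k x y rule: list_induct2)
  case Nil
  then show ?case by (simp add: multi_index_0 counit_mult)
next
  case (Cons a \<alpha> c \<gamma>)
  note forms = form_add[OF \<rho>_\<tau>_form] form_scale[OF \<rho>_\<tau>_form] form_add[OF conv_form[OF matrix_coeffs_form]] form_scale[OF conv_form[OF matrix_coeffs_form]]
  have "(\<Sum>\<beta>\<in>multi_index (length (a # \<alpha>)). conv (matrix_coeffs k (a # \<alpha>) \<beta>) x * conv (matrix_coeffs k \<beta> (c # \<gamma>)) y)
      = (\<Sum>b\<in>BV. \<Sum>\<beta>\<in>multi_index (length \<alpha>). sw x (\<lambda>x1 x2. sw y (\<lambda>y1 y2.
          \<rho> a b ((\<tau> ^^ k) x1) * \<rho> b c ((\<tau> ^^ k) y1) * (conv (matrix_coeffs (Suc k) \<alpha> \<beta>) x2 * conv (matrix_coeffs (Suc k) \<beta> \<gamma>) y2))))"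
    unfolding list.size add_Suc_right add_0_right sum_multi_index_Suc matrix_coeffs.simps conv.simps sw_product
    by (simp only: mult_ac)
  also have "\<dots> = sw x (\<lambda>x1 x2. sw y (\<lambda>y1 y2. (\<Sum>b\<in>BV. \<rho> a b ((\<tau> ^^ k) x1) * \<rho> b c ((\<tau> ^^ k) y1)) *
      (\<Sum>\<beta>\<in>multi_index (length \<alpha>). conv (matrix_coeffs (Suc k) \<alpha> \<beta>) x2 * conv (matrix_coeffs (Suc k) \<beta> \<gamma>) y2)))"
    by (simp only: sw_sum[symmetric] sum_product)
  also have "\<dots> = sw x (\<lambda>x1 x2. sw y (\<lambda>y1 y2. \<rho> a c ((\<tau> ^^ k) (x1 * y1)) * conv (matrix_coeffs (Suc k) \<alpha> \<gamma>) (x2 * y2)))"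
    by (simp add: Cons.IH \<tau>_pow \<rho>_mult)
  also have "\<dots> = conv (matrix_coeffs k (a # \<alpha>) (c # \<gamma>)) (x * y)"
    by (simp, rule sw_mult[symmetric]) (simp add: balanced2_def forms distrib_left distrib_right mult_ac)
  finally show ?case .
qed

lemma conv_\<tau>: "conv (matrix_coeffs k \<alpha> \<beta>) (\<tau> x) = conv (matrix_coeffs (Suc k) \<alpha> \<beta>) x"
proof (induction k \<alpha> \<beta> arbitrary: x rule: matrix_coeffs.induct)
  case (1 k a \<alpha> b \<beta>)
  note forms = form_add[OF \<rho>_\<tau>_form] form_scale[OF \<rho>_\<tau>_form] form_add[OF conv_form[OF matrix_coeffs_form]] form_scale[OF conv_form[OF matrix_coeffs_form]]
  have "conv (matrix_coeffs k (a # \<alpha>) (b # \<beta>)) (\<tau> x) = sw x (\<lambda>x1 x2. \<rho> a b ((\<tau> ^^ k) (\<tau> x1)) * conv (matrix_coeffs (Suc k) \<alpha> \<beta>) (\<tau> x2))"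
    by (simp, rule sw_\<tau>) (simp add: balanced2_def forms distrib_left distrib_right mult_ac)
  then show ?case by (simp add: 1 funpow_swap1)
qed (simp_all add: \<epsilon>_\<tau>)

text \<open>
  The matrix of the action of \<open>\<Lambda>\<close> on the twisted tensor power, that is, of the projection onto the invariants.
\<close>

definition inv_proj :: "'v list \<Rightarrow> 'v list \<Rightarrow> 'k" where
  "inv_proj \<alpha> \<beta> = conv (matrix_coeffs 0 \<alpha> \<beta>) \<Lambda>"

lemma inv_proj_idempotent:
  assumes "\<alpha> \<in> multi_index m" "\<gamma> \<in> multi_index m"
  shows "(\<Sum>\<beta>\<in>multi_index m. inv_proj \<alpha> \<beta> * inv_proj \<beta> \<gamma>) = inv_proj \<alpha> \<gamma>"
  using conv_matrix_coeffs_mult[of \<alpha> \<gamma> 0 \<Lambda> \<Lambda>] assms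
  by (simp add: inv_proj_def multi_index_def \<Lambda>_left integral_normalized)

text \<open>
  Rotating both multi-indices moves the first functional to the end of the convolution product, where it meets \<open>\<tau>\<^sup>m\<^sup>-\<^sup>1\<close>.
  Cocommutativity of \<open>\<Lambda>\<close> brings it back to the front, and precomposing all functionals with \<open>\<tau>\<close>, which fixes
  \<open>\<Lambda>\<close>, restores the exponents since \<open>\<tau>\<^sup>m = id\<close>.
\<close>

lemma inv_proj_rotate:
  assumes "\<alpha> \<in> multi_index m" "\<beta> \<in> multi_index m"
  shows "inv_proj (rotate1 \<alpha>) (rotate1 \<beta>) = inv_proj \<alpha> \<beta>"
proof -
  obtain a \<alpha>' b \<beta>' where ab: "\<alpha> = a # \<alpha>'" "\<beta> = b # \<beta>'"
    using assms m_pos by (cases \<alpha>; cases \<beta>) (auto simp: multi_index_def)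
  have len: "length \<alpha>' = m - 1" "length \<beta>' = m - 1" using assms ab by (auto simp: multi_index_def)
  define \<phi> where "\<phi> = (\<lambda>x. \<rho> a b ((\<tau> ^^ (m - 1)) x))"
  have \<phi>: "form \<phi>" unfolding \<phi>_def by (rule \<rho>_\<tau>_form)
  have C: "form (conv (matrix_coeffs k \<alpha>' \<beta>'))" for k by (rule conv_form) (rule matrix_coeffs_form)
  have \<phi>_\<tau>: "\<phi> (\<tau> x) = \<rho> a b x" for x
  proof -
    have "(\<tau> ^^ (m - 1)) (\<tau> x) = (\<tau> ^^ m) x" using m_pos by (cases m) (simp_all add: funpow_swap1)
    then show ?thesis by (simp add: \<phi>_def \<tau>_order)
  qed
  have "inv_proj (rotate1 \<alpha>) (rotate1 \<beta>) = conv (matrix_coeffs 0 \<alpha>' \<beta>' @ [\<phi>]) \<Lambda>"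
    using len by (simp add: inv_proj_def ab matrix_coeffs_append \<phi>_def)
  also have "\<dots> = sw \<Lambda> (\<lambda>x y. conv (matrix_coeffs 0 \<alpha>' \<beta>') x * conv [\<phi>] y)"
    using \<phi> by (intro conv_append) (auto dest: matrix_coeffs_form)
  also have "conv [\<phi>] = \<phi>"
    using sw_counit_right'[of \<phi>] by (auto simp: form_add[OF \<phi>] form_scale[OF \<phi>] mult.commute)
  also have "sw \<Lambda> (\<lambda>x y. conv (matrix_coeffs 0 \<alpha>' \<beta>') x * \<phi> y) = sw \<Lambda> (\<lambda>x y. conv (matrix_coeffs 0 \<alpha>' \<beta>') y * \<phi> x)"
    by (rule \<Lambda>_cocommutative)
       (simp add: balanced2_def form_add[OF \<phi>] form_scale[OF \<phi>] form_add[OF C] form_scale[OF C] distrib_left distrib_right mult_ac)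
  also have "\<dots> = sw (\<tau> \<Lambda>) (\<lambda>x y. \<phi> x * conv (matrix_coeffs 0 \<alpha>' \<beta>') y)"
    by (simp add: \<tau>_\<Lambda> mult.commute)
  also have "\<dots> = sw \<Lambda> (\<lambda>x y. \<phi> (\<tau> x) * conv (matrix_coeffs 0 \<alpha>' \<beta>') (\<tau> y))"
    by (rule sw_\<tau>)
       (simp add: balanced2_def form_add[OF \<phi>] form_scale[OF \<phi>] form_add[OF C] form_scale[OF C] distrib_left distrib_right mult_ac)
  also have "\<dots> = inv_proj \<alpha> \<beta>"
    by (simp add: inv_proj_def ab \<phi>_\<tau> conv_\<tau>)
  finally show ?thesis .
qed

fun twisted_product :: "nat \<Rightarrow> 'h list \<Rightarrow> 'h" where
  "twisted_product k [] = 1"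
| "twisted_product k (x # xs) = (\<tau> ^^ k) x * twisted_product (Suc k) xs"

lemma twisted_product_eq:
  "prod_list (map (\<lambda>i. (\<tau> ^^ (k + i)) (xs ! i)) [0..<length xs]) = twisted_product k xs"
proof (induction xs arbitrary: k)
  case (Cons x xs)
  have "map (\<lambda>i. (\<tau> ^^ (k + i)) ((x # xs) ! i)) [0..<length (x # xs)]
      = (\<tau> ^^ k) x # map (\<lambda>i. (\<tau> ^^ (Suc k + i)) (xs ! i)) [0..<length xs]"
    by (simp add: upt_conv_Cons map_Suc_upt[symmetric] comp_def del: upt_Suc)
  then show ?case using Cons[of "Suc k"] by (simp only: prod_list.Cons twisted_product.simps)
qed simp

text \<open>
  The shift by one position between \<open>a # \<alpha>\<close> and \<open>\<alpha> @ [c]\<close> makes the sum over \<open>\<alpha>\<close> a product of matrices.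
\<close>

lemma path_sum:
  "length xs = Suc n \<Longrightarrow>
    (\<Sum>\<alpha>\<in>multi_index n. prod_list (map2 (\<lambda>\<phi> x. \<phi> x) (matrix_coeffs k (a # \<alpha>) (\<alpha> @ [c])) xs)) = \<rho> a c (twisted_product k xs)"
proof (induction n arbitrary: k a xs)
  case 0
  then show ?case by (auto simp: length_Suc_conv multi_index_0)
next
  case (Suc n)
  then obtain x xs' where xs: "xs = x # xs'" "length xs' = Suc n" by (auto simp: length_Suc_conv)
  have "(\<Sum>\<alpha>\<in>multi_index (Suc n). prod_list (map2 (\<lambda>\<phi> x. \<phi> x) (matrix_coeffs k (a # \<alpha>) (\<alpha> @ [c])) xs))
      = (\<Sum>b\<in>BV. \<rho> a b ((\<tau> ^^ k) x) * (\<Sum>\<alpha>\<in>multi_index n. prod_list (map2 (\<lambda>\<phi> x. \<phi> x) (matrix_coeffs (Suc k) (b # \<alpha>) (\<alpha> @ [c])) xs')))"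
    by (simp add: sum_multi_index_Suc xs sum_distrib_left)
  also have "\<dots> = \<rho> a c (twisted_product k xs)"
    using Suc.IH[OF xs(2)] by (simp add: xs \<rho>_mult)
  finally show ?case .
qed

lemma trace_inv_proj_rotate:
  "(\<Sum>\<alpha>\<in>multi_index m. inv_proj \<alpha> (rotate1 \<alpha>)) = twisted_FS_indicator scale \<Delta> \<epsilon> m (character scaleV BV act) \<tau>"
proof -
  have m: "m = Suc (m - 1)" using m_pos by simp
  have "(\<Sum>\<alpha>\<in>multi_index m. inv_proj \<alpha> (rotate1 \<alpha>))
      = (\<Sum>\<alpha>\<in>multi_index m. \<Sum>xs\<in>#iterated_comult \<Delta> (m - 1) \<Lambda>. prod_list (map2 (\<lambda>\<phi> x. \<phi> x) (matrix_coeffs 0 \<alpha> (rotate1 \<alpha>)) xs))"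
    unfolding inv_proj_def
  proof (rule sum.cong[OF HOL.refl])
    fix \<alpha> assume "\<alpha> \<in> multi_index m"
    then show "conv (matrix_coeffs 0 \<alpha> (rotate1 \<alpha>)) \<Lambda>
        = (\<Sum>xs\<in>#iterated_comult \<Delta> (m - 1) \<Lambda>. prod_list (map2 (\<lambda>\<phi> x. \<phi> x) (matrix_coeffs 0 \<alpha> (rotate1 \<alpha>)) xs))"
      using m_pos by (intro conv_iterated_comult) (auto simp: length_matrix_coeffs multi_index_def matrix_coeffs_form)
  qed
  also have "\<dots> = (\<Sum>xs\<in>#iterated_comult \<Delta> (m - 1) \<Lambda>. \<Sum>\<alpha>\<in>multi_index m. prod_list (map2 (\<lambda>\<phi> x. \<phi> x) (matrix_coeffs 0 \<alpha> (rotate1 \<alpha>)) xs))"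
  proof -
    have "(\<Sum>\<alpha>\<in>A. \<Sum>xs\<in>#X. f \<alpha> xs) = (\<Sum>xs\<in>#X. \<Sum>\<alpha>\<in>A. f \<alpha> xs)"
      for A :: "'v list set" and X :: "'h list multiset" and f :: "_ \<Rightarrow> _ \<Rightarrow> 'k"
      by (induction X) (simp_all add: sum.distrib)
    then show ?thesis .
  qed
  also have "\<dots> = (\<Sum>xs\<in>#iterated_comult \<Delta> (m - 1) \<Lambda>.
      character scaleV BV act (prod_list (map (\<lambda>i. (\<tau> ^^ i) (xs ! i)) [0..<m])))"
  proof (intro arg_cong[of _ _ sum_mset] image_mset_cong)
    fix xs assume "xs \<in># iterated_comult \<Delta> (m - 1) \<Lambda>"
    then have len: "length xs = Suc (m - 1)" by (rule length_iterated_comult)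
    have "(\<Sum>\<alpha>\<in>multi_index m. prod_list (map2 (\<lambda>\<phi> x. \<phi> x) (matrix_coeffs 0 \<alpha> (rotate1 \<alpha>)) xs))
        = (\<Sum>a\<in>BV. \<Sum>\<alpha>\<in>multi_index (m - 1). prod_list (map2 (\<lambda>\<phi> x. \<phi> x) (matrix_coeffs 0 (a # \<alpha>) (\<alpha> @ [a])) xs))"
      by (subst m, subst sum_multi_index_Suc) simp
    also have "\<dots> = character scaleV BV act (twisted_product 0 xs)"
      by (simp only: path_sum[OF len] character_eq)
    also have "twisted_product 0 xs = prod_list (map (\<lambda>i. (\<tau> ^^ i) (xs ! i)) [0..<m])"
      using twisted_product_eq[of 0 xs] len m_pos by simp
    finally show "(\<Sum>\<alpha>\<in>multi_index m. prod_list (map2 (\<lambda>\<phi> x. \<phi> x) (matrix_coeffs 0 \<alpha> (rotate1 \<alpha>)) xs))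
        = character scaleV BV act (prod_list (map (\<lambda>i. (\<tau> ^^ i) (xs ! i)) [0..<m]))" .
  qed
  finally show ?thesis
    unfolding twisted_FS_indicator_def normalized_integral_eq[OF integral integral_normalized] .
qed

lemma rotate1_multi_index: "bij_betw rotate1 (multi_index m) (multi_index m)"
proof -
  have maps: "rotate1 ` multi_index m \<subseteq> multi_index m" by (auto simp: multi_index_def)
  have "inj_on rotate1 (multi_index m)"
    using inj_rotate1 by (rule inj_on_subset) simp
  then show ?thesis
    using maps finite_multi_index by (simp add: bij_betw_def endo_inj_surj)
qed

text \<open>
  The projection composed with the cyclic shift, acting on the coordinate functions of tensors; functions are cut off
  outside the finite set of multi-indices.
\<close>

definition cyclic_op :: "('v list \<Rightarrow> 'k) \<Rightarrow> 'v list \<Rightarrow> 'k" where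
  "cyclic_op f \<alpha> = (if \<alpha> \<in> multi_index m then \<Sum>\<gamma>\<in>multi_index m. inv_proj \<alpha> (rotate1 \<gamma>) * f \<gamma> else 0)"

lemma rotate_multi_index: "\<gamma> \<in> multi_index m \<Longrightarrow> rotate k \<gamma> \<in> multi_index m"
  by (auto simp: multi_index_def)

text \<open>
  As the projection is idempotent and commutes with the shift, only the shift is iterated.
\<close>

lemma cyclic_op_pow:
  "(cyclic_op ^^ Suc k) f \<alpha> = (if \<alpha> \<in> multi_index m then \<Sum>\<gamma>\<in>multi_index m. inv_proj \<alpha> (rotate (Suc k) \<gamma>) * f \<gamma> else 0)"
proof (induction k arbitrary: \<alpha>)
  case 0
  then show ?case by (simp add: cyclic_op_def)
next
  case (Suc k)
  have "(\<Sum>\<beta>\<in>multi_index m. inv_proj \<alpha> (rotate1 \<beta>) * inv_proj \<beta> (rotate (Suc k) \<gamma>)) = inv_proj \<alpha> (rotate (Suc (Suc k)) \<gamma>)"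
    if \<alpha>: "\<alpha> \<in> multi_index m" and \<gamma>: "\<gamma> \<in> multi_index m" for \<gamma>
  proof -
    have "(\<Sum>\<beta>\<in>multi_index m. inv_proj \<alpha> (rotate1 \<beta>) * inv_proj \<beta> (rotate (Suc k) \<gamma>))
        = (\<Sum>\<beta>\<in>multi_index m. inv_proj \<alpha> (rotate1 \<beta>) * inv_proj (rotate1 \<beta>) (rotate (Suc (Suc k)) \<gamma>))"
    proof (rule sum.cong[OF HOL.refl])
      fix \<beta> assume "\<beta> \<in> multi_index m"
      from inv_proj_rotate[OF this rotate_multi_index[OF \<gamma>, of "Suc k"]]
      show "inv_proj \<alpha> (rotate1 \<beta>) * inv_proj \<beta> (rotate (Suc k) \<gamma>) = inv_proj \<alpha> (rotate1 \<beta>) * inv_proj (rotate1 \<beta>) (rotate (Suc (Suc k)) \<gamma>)"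
        by simp
    qed
    also have "\<dots> = (\<Sum>\<beta>\<in>multi_index m. inv_proj \<alpha> \<beta> * inv_proj \<beta> (rotate (Suc (Suc k)) \<gamma>))"
      by (rule sum.reindex_bij_betw[OF rotate1_multi_index])
    also have "\<dots> = inv_proj \<alpha> (rotate (Suc (Suc k)) \<gamma>)"
      using \<alpha> \<gamma> by (intro inv_proj_idempotent rotate_multi_index)
    finally show ?thesis .
  qed
  moreover have "(\<Sum>\<beta>\<in>multi_index m. inv_proj \<alpha> (rotate1 \<beta>) * (\<Sum>\<gamma>\<in>multi_index m. inv_proj \<beta> (rotate (Suc k) \<gamma>) * f \<gamma>))
      = (\<Sum>\<gamma>\<in>multi_index m. (\<Sum>\<beta>\<in>multi_index m. inv_proj \<alpha> (rotate1 \<beta>) * inv_proj \<beta> (rotate (Suc k) \<gamma>)) * f \<gamma>)"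
    unfolding sum_distrib_left sum_distrib_right by (subst sum.swap) (simp add: mult.assoc)
  moreover have "(cyclic_op ^^ Suc (Suc k)) f \<alpha> = cyclic_op ((cyclic_op ^^ Suc k) f) \<alpha>" by simp
  ultimately show ?case
    by (simp add: cyclic_op_def[of "(cyclic_op ^^ Suc k) f"] Suc del: funpow.simps rotate_Suc)
qed

lemma indicator_in_int_adjoin:
  assumes \<zeta>: "primitive_root_of_unity m \<zeta>"
  shows "twisted_FS_indicator scale \<Delta> \<epsilon> m (character scaleV BV act) \<tau> \<in> int_adjoin \<zeta>"
proof -
  define scaleF where "scaleF c f = (\<lambda>\<alpha>. c * f \<alpha>)" for c :: 'k and f :: "'v list \<Rightarrow> 'k"
  interpret F: linear_space scaleF
    by unfold_locales (auto simp: scaleF_def algebra_simps)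
  define e where "e \<alpha> = (\<lambda>\<beta>. if \<beta> = \<alpha> then 1 else 0 :: 'k)" for \<alpha> :: "'v list"
  have "\<exists>d :: nat \<Rightarrow> nat. \<forall>k\<in>{1..m}. (\<Sum>\<alpha>\<in>multi_index m. ((cyclic_op ^^ k) (e \<alpha>)) \<alpha>) = (\<Sum>j<m. of_nat (d j) * \<zeta> ^ (j * k))"
  proof (rule F.trace_powers_finite_order[OF finite_multi_index _ _ _ \<zeta> m_pos])
    show "F.endo cyclic_op"
      by (auto simp: F.endo_iff cyclic_op_def scaleF_def fun_eq_iff algebra_simps sum.distrib sum_distrib_left)
    show "F.form (\<lambda>f. f \<alpha>)" for \<alpha>
      by (simp add: F.form_iff scaleF_def)
    show "cyclic_op f = (\<Sum>\<alpha>\<in>multi_index m. scaleF (cyclic_op f \<alpha>) (e \<alpha>))" for f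
    proof
      fix \<beta>
      have "(\<Sum>\<alpha>\<in>A. scaleF (c \<alpha>) (e \<alpha>)) \<beta> = (\<Sum>\<alpha>\<in>A. scaleF (c \<alpha>) (e \<alpha>) \<beta>)" for A c
        by (induction A rule: infinite_finite_induct) simp_all
      then show "cyclic_op f \<beta> = (\<Sum>\<alpha>\<in>multi_index m. scaleF (cyclic_op f \<alpha>) (e \<alpha>)) \<beta>"
        using finite_multi_index by (simp add: scaleF_def e_def if_distrib[of "\<lambda>x. _ * x"] cong: if_cong) (simp add: cyclic_op_def)
    qed
    show "(cyclic_op ^^ Suc m) f = cyclic_op f" for f
    proof
      fix \<alpha>
      have "rotate (Suc m) \<gamma> = rotate1 \<gamma>" if "\<gamma> \<in> multi_index m" for \<gamma>
        using that by (auto simp: multi_index_def)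
      then show "(cyclic_op ^^ Suc m) f \<alpha> = cyclic_op f \<alpha>" unfolding cyclic_op_pow by (simp add: cyclic_op_def)
    qed
  qed
  then obtain d :: "nat \<Rightarrow> nat" where
    "\<forall>k\<in>{1..m}. (\<Sum>\<alpha>\<in>multi_index m. ((cyclic_op ^^ k) (e \<alpha>)) \<alpha>) = (\<Sum>j<m. of_nat (d j) * \<zeta> ^ (j * k))"
    by blast
  from this[THEN bspec, of 1] have d: "(\<Sum>\<alpha>\<in>multi_index m. cyclic_op (e \<alpha>) \<alpha>) = (\<Sum>j<m. of_nat (d j) * \<zeta> ^ j)"
    using m_pos by simp
  have "(\<Sum>\<alpha>\<in>multi_index m. cyclic_op (e \<alpha>) \<alpha>) = (\<Sum>\<alpha>\<in>multi_index m. inv_proj \<alpha> (rotate1 \<alpha>))"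
    using finite_multi_index by (simp add: cyclic_op_def e_def if_distrib[of "\<lambda>x. _ * x"] cong: if_cong)
  then have "twisted_FS_indicator scale \<Delta> \<epsilon> m (character scaleV BV act) \<tau> = (\<Sum>j<m. of_nat (d j) * \<zeta> ^ j)"
    using d trace_inv_proj_rotate by simp
  also have "\<dots> = poly (map_poly of_int (\<Sum>j<m. monom (int (d j)) j)) \<zeta>"
  proof -
    have "map_poly of_int (\<Sum>j<m. monom (int (d j)) j) = (\<Sum>j<m. monom (of_nat (d j) :: 'k) j)"
      by (rule poly_eqI) (simp add: coeff_map_poly coeff_sum)
    then show ?thesis by (simp add: poly_sum poly_monom)
  qed
  also have "\<dots> \<in> int_adjoin \<zeta>" unfolding int_adjoin_def by blast
  finally show ?thesis .
qed

end

theorem corollary3p6: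
  fixes scale :: "'k::{alg_closed_field, field_char_0} \<Rightarrow> 'h::ring_1 \<Rightarrow> 'h"
    and \<Delta> :: "'h \<Rightarrow> ('h \<times> 'h) multiset"
    and \<epsilon> :: "'h \<Rightarrow> 'k"
    and S \<tau> :: "'h \<Rightarrow> 'h"
    and m :: nat
    and scaleV :: "'k \<Rightarrow> 'v::ab_group_add \<Rightarrow> 'v"
    and B :: "'v set"
    and act :: "'h \<Rightarrow> 'v \<Rightarrow> 'v"
    and \<zeta> :: 'k
  assumes "hopf_algebra scale \<Delta> \<epsilon> S"
    and "semisimple_ring TYPE('h)"
    and "m > 0"
    and "hopf_automorphism scale \<Delta> \<epsilon> \<tau>"
    and "\<tau> ^^ m = id"
    and "hopf_module scale scaleV act"
    and "finite_dimensional_vector_space scaleV B"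
    and "primitive_root_of_unity m \<zeta>"
  shows "twisted_FS_indicator scale \<Delta> \<epsilon> m (character scaleV B act) \<tau> \<in> int_adjoin \<zeta>"
proof -
  interpret hopf_algebra scale \<Delta> \<epsilon> S by fact
  interpret hopf_calculus scale \<Delta> \<epsilon> S by unfold_locales
  obtain t where t: "two_sided_integral scale \<epsilon> t" "\<epsilon> t = 1"
    using exists_integral[OF assms(2)] .
  obtain E where E: "finite E" "independent E" "span E = UNIV"
    using finite_dimensional[OF t] .
  interpret hopf_module scale scaleV act by fact
  interpret V: finite_dimensional_vector_space scaleV B by fact
  interpret twisted_module scale \<Delta> \<epsilon> S E t scaleV act B \<tau> m
    by unfold_locales (use E t assms in simp_all)
  show ?thesis using assms(8) by (rule indicator_in_int_adjoin)
qed

end
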